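(* Let $n\ge3$ and let $W\in C_b(\mathbb S^{n-1}\times\mathbb S^{n-1})$ be a rotationally symmetric interaction kernel with $\hat W_j<0$ for at least one $j\in\mathbb N$, satisfying the relaxed resonance condition with some bandwidth $\delta\ge0$. Then there exists a discontinuous transition point $\gamma_c\in(0,\gamma_\#)$ of the free energy functional $\mathcal F_\gamma$ associated with the stationary McKean–Vlasov equation $\gamma^{-1}\Delta\rho+\mathrm{div}(\rho\nabla_xW(x,\cdot)*\rho)=0$ on $\mathbb S^{n-1}$, where $\gamma_\#=-1/\min_{k\in\mathbb N}\hat W_k$.
   Context: $\mathbb N=\{1,2,\dots\}$. $\sigma$ is the surface measure on $\mathbb S^{n-1}\subset\mathbb R^n$, $\omega_n=\sigma(\mathbb S^{n-1})$, $m=\sigma/\omega_n$, $\langle f,g\rangle_{L_2}=\omega_n^{-1}\int fg\,d\sigma$; $\bar\rho=1/\omega_n$ is the density (w.r.t. $\sigma$) of the uniform measure. Rotationally symmetric means $W(x,y)=W(\langle x,y\rangle)$, $W:[-1,1]\to\mathbb R$. Gegenbauer polynomials: $C_0^\lambda=1$, $C_1^\lambda(t)=2\lambda t$, $(k+2)C_{k+2}^\lambda(t)=2(\lambda+k+1)tC_{k+1}^\lambda(t)-(2\lambda+k)C_k^\lambda(t)$. $$\hat W_k=\frac{\Gamma(\frac n2)}{\sqrt\pi\,\Gamma(\frac{n-1}2)}\int_{-1}^1W(t)\frac{C_k^{\frac{n-2}2}(t)}{C_k^{\frac{n-2}2}(1)}(1-t^2)^{\frac{n-3}2}dt ,$$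 and $Y_{k,0}(x)=A_kC_k^{\frac{n-2}2}(x_n)$ with $A_k>0$ such that $\|Y_{k,0}\|_{L_2}=1$. Relaxed resonance condition with bandwidth $\delta$: with $K_{\sharp,\delta}=\{k\in\mathbb N:\hat W_k\le-\frac{1-\delta}{\gamma_\#}\}$, there is a linear combination $u=\sum_{l\in K_{\sharp,\delta}}c_lY_{l,0}$ with $\int_{\mathbb S^{n-1}}u^3d\sigma=U_3\ne0$ and $\|u\|_\infty\le1$, and $\delta<\min\bigl(\frac14,\frac{U_3^2}{49\,\sigma(\mathbb S^{n-1})^2}\bigr)$ for some such $u$. Free energy: $\mathcal F_\gamma(\mu)=\gamma^{-1}\mathcal E(\mu)+\mathcal I(\mu)$ on probability measures, where $\mathcal E(\mu)=\int\rho\log\rho\,dm$ if $\mu$ has a positive density $\rho$ w.r.t. $m$ and $+\infty$ otherwise, and $\mathcal I(\mu)=\frac12\iint W(x,y)\,d\mu(x)d\mu(y)$. Transition point: $\gamma_c>0$ such that (1) for all $\gamma\in(0,\gamma_c)$ the uniform measure is the unique minimizer of $\mathcal F_\gamma$; (2) the uniform measure is a minimizer of $\mathcal F_{\gamma_c}$; (3) for every $\gamma>\gamma_c$ there is a minimizer of $\mathcal F_\gamma$ with a.e. positive density different from the uniform measure. A transition point is continuous if $\bar\rho$ is the unique minimizer of $\mathcal F_{\gamma_c}$ and for any family of minimizers $\rho_\gamma$ of $\mathcal F_\gamma$, $\gamma>\gamma_c$, one has $\lim_{\gamma\downarrow\gamma_c}\|\rho_\gamma-\bar\rho\|_{L_1}=0$;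 otherwise it is discontinuous. *)

theory Defs
  imports "HOL-Probability.Probability"
begin

text \<open>
  The ambient space is \<open>\<real>\<^sup>n = real ^ 'n\<close> with \<open>n = CARD('n)\<close>. Measures on the unit sphere are
  measures on the ambient type whose space is \<open>sphere 0 1\<close>, with the Borel sets of the sphere.
\<close>

text \<open>
  Surface measure in polar-coordinates form:
  \<open>\<sigma>(A) = n \<cdot> Leb {r x | 0 < r \<le> 1, x \<in> A}\<close>.
\<close>

definition surface_measure :: "(real ^ 'n) measure" where
  "surface_measure =
     scale_measure (ennreal (real CARD('n)))
       (distr (restrict_space lborel (cball 0 1 - {0}))
              (restrict_space borel (sphere 0 1))
              (\<lambda>x. x /\<^sub>R norm x))"

lemma radial_measurable:
  "(\<lambda>x :: real ^ 'n. x /\<^sub>R norm x) \<in>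
     measurable (restrict_space lborel (cball 0 1 - {0})) (restrict_space borel (sphere 0 1))"
  by (intro measurable_restrict_space3) auto

lemma space_surface_measure [simp]: "space surface_measure = sphere 0 1"
  by (simp add: surface_measure_def space_scale_measure space_restrict_space)

lemma sets_surface_measure [simp]:
  "sets surface_measure = sets (restrict_space borel (sphere 0 1))"
  by (simp add: surface_measure_def)

lemma emeasure_surface_measure:
  assumes "A \<in> sets (restrict_space borel (sphere 0 1))"
  shows "emeasure (surface_measure :: (real ^ 'n) measure) A =
           ennreal (real CARD('n)) *
             emeasure lborel {x \<in> cball 0 1 - {0}. x /\<^sub>R norm x \<in> A}"
proof -
  have "(\<lambda>x :: real ^ 'n. x /\<^sub>R norm x) -` A \<inter> (cball 0 1 - {0})
          = {x \<in> cball 0 1 - {0}. x /\<^sub>R norm x \<in> A}"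
    by auto
  then show ?thesis
    using assms unfolding surface_measure_def
    by (subst emeasure_scale_measure, subst emeasure_distr[OF radial_measurable])
       (auto simp: space_restrict_space intro!: arg_cong2[where f = "(*)"] emeasure_restrict_space)
qed

definition sphere_area :: "'n::finite itself \<Rightarrow> real" where
  "sphere_area _ = measure (surface_measure :: (real ^ 'n) measure) (sphere 0 1)"

definition uniform_sphere :: "(real ^ 'n) measure" where
  "uniform_sphere = scale_measure (ennreal (1 / sphere_area TYPE('n))) surface_measure"

definition sphere_L2_inner :: "(real ^ 'n \<Rightarrow> real) \<Rightarrow> (real ^ 'n \<Rightarrow> real) \<Rightarrow> real" where
  "sphere_L2_inner f g = (LINT x|surface_measure. f x * g x) / sphere_area TYPE('n)"

definition sphere_L2_norm :: "(real ^ 'n \<Rightarrow> real) \<Rightarrow> real" where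
  "sphere_L2_norm f = sqrt (sphere_L2_inner f f)"

fun gegenbauer :: "real \<Rightarrow> nat \<Rightarrow> real \<Rightarrow> real" where
  "gegenbauer l 0 t = 1"
| "gegenbauer l (Suc 0) t = 2 * l * t"
| "gegenbauer l (Suc (Suc k)) t =
     (2 * (l + real k + 1) * t * gegenbauer l (Suc k) t - (2 * l + real k) * gegenbauer l k t)
       / (real k + 2)"

definition gegenbauer_coeff :: "nat \<Rightarrow> (real \<Rightarrow> real) \<Rightarrow> nat \<Rightarrow> real" where
  "gegenbauer_coeff n w k =
     Gamma (real n / 2) / (sqrt pi * Gamma ((real n - 1) / 2)) *
     (LBINT t:{-1..1}. w t * (gegenbauer ((real n - 2) / 2) k t / gegenbauer ((real n - 2) / 2) k 1)
        * (1 - t\<^sup>2) powr ((real n - 3) / 2))"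

text \<open>
  The zonal harmonic \<open>Y\<^sub>k\<^sub>,\<^sub>0\<close>. The coordinate \<open>p\<close> plays the role of the last one, since the index
  type carries no order. The normalising factor \<open>A\<^sub>k > 0\<close> is the reciprocal of the norm of
  the Gegenbauer polynomial in \<open>x\<^sub>p\<close>.
\<close>

definition zonal_harmonic :: "'n \<Rightarrow> nat \<Rightarrow> real ^ 'n \<Rightarrow> real" where
  "zonal_harmonic p k x =
     1 / sphere_L2_norm (\<lambda>y :: real ^ 'n. gegenbauer ((real CARD('n) - 2) / 2) k (y $ p))
       * gegenbauer ((real CARD('n) - 2) / 2) k (x $ p)"

text \<open>\<open>Least\<close> on the set of values is the minimum over \<open>k \<ge> 1\<close>.\<close>

definition gamma_sharp :: "nat \<Rightarrow> (real \<Rightarrow> real) \<Rightarrow> real" where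
  "gamma_sharp n w = - 1 / (LEAST v. v \<in> gegenbauer_coeff n w ` {1..})"

definition resonant_modes :: "nat \<Rightarrow> (real \<Rightarrow> real) \<Rightarrow> real \<Rightarrow> nat set" where
  "resonant_modes n w \<delta> =
     {k. 1 \<le> k \<and> gegenbauer_coeff n w k \<le> - ((1 - \<delta>) / gamma_sharp n w)}"

definition relaxed_resonance :: "'n::finite \<Rightarrow> (real \<Rightarrow> real) \<Rightarrow> real \<Rightarrow> bool" where
  "relaxed_resonance p w \<delta> \<longleftrightarrow>
     (\<exists>L c u U3. finite L \<and> L \<subseteq> resonant_modes CARD('n) w \<delta>
        \<and> u = (\<lambda>x :: real ^ 'n. \<Sum>l\<in>L. c l * zonal_harmonic p l x)
        \<and> U3 = (LINT x|surface_measure. u x ^ 3) \<and> U3 \<noteq> 0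
        \<and> (\<forall>x\<in>sphere 0 1. \<bar>u x\<bar> \<le> 1)
        \<and> \<delta> < min (1 / 4) (U3\<^sup>2 / (49 * (sphere_area TYPE('n))\<^sup>2)))"

definition rotationally_symmetric_with ::
    "(real ^ 'n \<Rightarrow> real ^ 'n \<Rightarrow> real) \<Rightarrow> (real \<Rightarrow> real) \<Rightarrow> bool" where
  "rotationally_symmetric_with W w \<longleftrightarrow>
     (\<forall>x\<in>sphere 0 1. \<forall>y\<in>sphere 0 1. W x y = w (x \<bullet> y))"

definition sphere_probs :: "(real ^ 'n) measure set" where
  "sphere_probs = {\<mu>. prob_space \<mu> \<and> sets \<mu> = sets (restrict_space borel (sphere 0 1))}"

definition has_density :: "'a measure \<Rightarrow> 'a measure \<Rightarrow> ('a \<Rightarrow> real) \<Rightarrow> bool" where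
  "has_density M \<mu> \<rho> \<longleftrightarrow>
     \<rho> \<in> borel_measurable M \<and> (AE x in M. 0 \<le> \<rho> x) \<and> \<mu> = density M (\<lambda>x. ennreal (\<rho> x))"

definition has_pos_density :: "'a measure \<Rightarrow> 'a measure \<Rightarrow> ('a \<Rightarrow> real) \<Rightarrow> bool" where
  "has_pos_density M \<mu> \<rho> \<longleftrightarrow> has_density M \<mu> \<rho> \<and> (AE x in M. 0 < \<rho> x)"

text \<open>
  Densities are unique up to null sets, so the integral does not depend on the one chosen.
  As \<open>\<rho> ln \<rho> \<ge> - 1 / e\<close>, the integral over a finite measure exists in \<open>(-\<infinity>, \<infinity>]\<close>, and it
  equals \<open>\<infinity>\<close> exactly when \<open>\<rho> ln \<rho>\<close> is not integrable.
\<close>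

definition sphere_entropy :: "(real ^ 'n) measure \<Rightarrow> ereal" where
  "sphere_entropy \<mu> =
     (if \<exists>\<rho>. has_pos_density uniform_sphere \<mu> \<rho>
      then let \<rho> = (SOME \<rho>. has_pos_density uniform_sphere \<mu> \<rho>) in
        if integrable uniform_sphere (\<lambda>x. \<rho> x * ln (\<rho> x))
        then ereal (LINT x|uniform_sphere. \<rho> x * ln (\<rho> x))
        else \<infinity>
      else \<infinity>)"

definition interaction_energy ::
    "(real ^ 'n \<Rightarrow> real ^ 'n \<Rightarrow> real) \<Rightarrow> (real ^ 'n) measure \<Rightarrow> real" where
  "interaction_energy W \<mu> = 1 / 2 * (LINT x|\<mu>. LINT y|\<mu>. W x y)"

definition free_energy ::
    "(real ^ 'n \<Rightarrow> real ^ 'n \<Rightarrow> real) \<Rightarrow> real \<Rightarrow> (real ^ 'n) measure \<Rightarrow> ereal" where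
  "free_energy W \<gamma> \<mu> = ereal (1 / \<gamma>) * sphere_entropy \<mu> + ereal (interaction_energy W \<mu>)"

definition is_minimizer ::
    "(real ^ 'n \<Rightarrow> real ^ 'n \<Rightarrow> real) \<Rightarrow> real \<Rightarrow> (real ^ 'n) measure \<Rightarrow> bool" where
  "is_minimizer W \<gamma> \<mu> \<longleftrightarrow>
     \<mu> \<in> sphere_probs \<and> (\<forall>\<nu>\<in>sphere_probs. free_energy W \<gamma> \<mu> \<le> free_energy W \<gamma> \<nu>)"

definition is_unique_minimizer ::
    "(real ^ 'n \<Rightarrow> real ^ 'n \<Rightarrow> real) \<Rightarrow> real \<Rightarrow> (real ^ 'n) measure \<Rightarrow> bool" where
  "is_unique_minimizer W \<gamma> \<mu> \<longleftrightarrow>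
     is_minimizer W \<gamma> \<mu> \<and> (\<forall>\<nu>. is_minimizer W \<gamma> \<nu> \<longrightarrow> \<nu> = \<mu>)"

definition transition_point :: "(real ^ 'n \<Rightarrow> real ^ 'n \<Rightarrow> real) \<Rightarrow> real \<Rightarrow> bool" where
  "transition_point W \<gamma>c \<longleftrightarrow>
     0 < \<gamma>c
     \<and> (\<forall>\<gamma>. 0 < \<gamma> \<and> \<gamma> < \<gamma>c \<longrightarrow> is_unique_minimizer W \<gamma> uniform_sphere)
     \<and> is_minimizer W \<gamma>c uniform_sphere
     \<and> (\<forall>\<gamma>>\<gamma>c. \<exists>\<mu> \<rho>. is_minimizer W \<gamma> \<mu> \<and> has_pos_density surface_measure \<mu> \<rho>
                     \<and> \<mu> \<noteq> uniform_sphere)"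

definition continuous_transition_point :: "(real ^ 'n \<Rightarrow> real ^ 'n \<Rightarrow> real) \<Rightarrow> real \<Rightarrow> bool" where
  "continuous_transition_point W \<gamma>c \<longleftrightarrow>
     transition_point W \<gamma>c
     \<and> is_unique_minimizer W \<gamma>c uniform_sphere
     \<and> (\<forall>\<mu> \<rho>. (\<forall>\<gamma>>\<gamma>c. is_minimizer W \<gamma> (\<mu> \<gamma>) \<and> has_density surface_measure (\<mu> \<gamma>) (\<rho> \<gamma>)) \<longrightarrow>
          ((\<lambda>\<gamma>. LINT x|surface_measure. \<bar>\<rho> \<gamma> x - 1 / sphere_area TYPE('n)\<bar>) \<longlongrightarrow> 0)
            (at_right \<gamma>c))"

definition discontinuous_transition_point :: "(real ^ 'n \<Rightarrow> real ^ 'n \<Rightarrow> real) \<Rightarrow> real \<Rightarrow> bool" where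
  "discontinuous_transition_point W \<gamma>c \<longleftrightarrow>
     transition_point W \<gamma>c \<and> \<not> continuous_transition_point W \<gamma>c"

end

theory Submission
  imports Defs "HOL-Complex_Analysis.Great_Picard" "HOL-Computational_Algebra.Polynomial"
begin

text \<open>
  Write \<open>m\<close> for the uniform probability measure on the sphere, \<open>r\<close> for a density with respect to
  \<open>m\<close>, \<open>E(r) = \<integral> r ln r dm\<close> for the entropy and \<open>Q(f) = \<integral>\<integral> W(x,y) f(x) f(y) dm dm\<close>. The minimum \<open>v\<close>
  of the Gegenbauer coefficients of index at least 1 is negative and \<open>\<gamma>\<^sub># = -1/v\<close>. As
  \<open>\<integral> W(x,y) dm(y)\<close> does not depend on \<open>x\<close>, the free energy satisfies
  \<open>F\<^sub>\<gamma>(r) - F\<^sub>\<gamma>(1) = E(r)/\<gamma> + Q(r - 1)/2\<close>. The critical parameter is therefore the infimum of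
  \<open>2 E(r) / (-Q(r - 1))\<close> over all densities with \<open>Q(r - 1) < 0\<close>. Below it the uniform density is the
  only minimizer, above it some density has smaller energy, and it is positive by a Pinsker-type
  inequality, because \<open>Q\<close> is bounded on \<open>L\<^sup>1\<close> (\<open>critical_parameter\<close>).

  Minimizers exist for every \<open>\<gamma>\<close>. Moving \<open>r\<close> a little towards its Gibbs density
  \<open>exp (-\<gamma> W r) / Z\<close> lowers the energy at a rate given by the relative entropy of \<open>r\<close> with respect to
  that density (\<open>gibbs_step\<close>). Along a minimizing sequence this relative entropy must tend to 0, while
  the potentials \<open>W r\<close> have a uniformly convergent subsequence by Arzela-Ascoli; so the densities
  converge in \<open>L\<^sup>1\<close> to a Gibbs density, which is a minimizer and is positive. The same inequality
  shows that every minimizer is the Gibbs density of its own potential.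

  The critical parameter is smaller than \<open>\<gamma>\<^sub>#\<close>. For the resonant function \<open>u\<close> put \<open>a = \<integral> u\<^sup>3 dm\<close> and
  \<open>r = 1 + (a/4) u\<close>. In the expansion of \<open>E(r)\<close> the quadratic term is cancelled by \<open>Q\<close> up to the
  bandwidth \<open>\<delta>\<close>, and the cubic term wins because \<open>\<delta> < a\<^sup>2/49\<close> (\<open>cubic_resonance_witness\<close>).

  The transition is discontinuous, because for \<open>\<gamma>\<close> bounded away from \<open>\<gamma>\<^sub>#\<close> the uniform density is an
  isolated minimizer in \<open>L\<^sup>1\<close>: a minimizer close to 1 in \<open>L\<^sup>1\<close> is uniformly close to 1, being a Gibbs
  density, so \<open>E(r)\<close> is nearly \<open>\<parallel>r - 1\<parallel>\<^sup>2/2\<close>, whereas \<open>-\<gamma> Q(r - 1)/2 \<le> (\<gamma>/\<gamma>\<^sub>#) \<parallel>r - 1\<parallel>\<^sup>2/2\<close> by the spectral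
  bound \<open>Q(f) \<ge> v \<parallel>f\<parallel>\<^sup>2\<close> for functions \<open>f\<close> of mean zero, with norms in \<open>L\<^sup>2\<close>. Hence nonuniform minimizers for parameters just
  above the critical one cannot tend to the uniform density.

  The spectral bound and the diagonal form of \<open>Q\<close> on zonal functions rest on the Funk-Hecke formula.
  It is derived from rotation invariance alone: \<open>\<integral> \<langle>y,x\<rangle>\<^sup>N dm(y)\<close> is a multiple of \<open>\<parallel>x\<parallel>\<^sup>N\<close>, and expanding
  this in \<open>x + s z\<close> shows that convolution with a polynomial zonal kernel does not raise the degree
  of a zonal polynomial. Being symmetric, the convolution is then diagonal in the orthogonal family
  of Gegenbauer polynomials; the Weierstrass theorem extends this to continuous kernels, and the
  spectral bound follows from polynomial approximation of the kernel and Bessel's inequality.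
\<close>

section \<open>Inequalities for the entropy integrand\<close>

text \<open>
  The integrand of the relative entropy of \<open>r\<close> with respect to \<open>g\<close> dominates
  \<open>(sqrt r - sqrt g)\<^sup>2\<close>, and \<open>r - g\<close> factors through \<open>sqrt r - sqrt g\<close>. The weight \<open>a\<close> from the
  arithmetic-geometric inequality stays free, so that optimising it after integration replaces an
  appeal to the Cauchy-Schwarz inequality.
\<close>

lemma entropy_pointwise:
  fixes r g a :: real
  assumes "0 < r" "0 < g" "0 < a"
  shows "\<bar>r - g\<bar> \<le> a / 2 * (r * ln r - r * ln g - r + g) + 1 / a * (r + g)"
proof -
  define s t where "s = sqrt r" and "t = sqrt g"
  have st: "0 < s" "0 < t" "r = s^2" "g = t^2" using assms by (auto simp: s_def t_def)
  have "ln (t / s) \<le> t / s - 1" using st by (intro ln_le_minus_one) auto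
  hence "ln t - ln s \<le> t / s - 1" using st by (simp add: ln_div)
  hence "2 * s^2 * (ln t - ln s) \<le> 2 * s^2 * (t / s - 1)" using st by (intro mult_left_mono) auto
  also have "\<dots> = 2 * s * t - 2 * s^2" using st by (simp add: field_simps power2_eq_square)
  finally have "2 * s^2 * (ln t - ln s) \<le> 2 * s * t - 2 * s^2" .
  moreover have "ln r = 2 * ln s" "ln g = 2 * ln t" using st ln_realpow[of s 2] ln_realpow[of t 2] by auto
  ultimately have H: "(s - t)^2 \<le> r * ln r - r * ln g - r + g"
    using st by (simp add: power2_eq_square algebra_simps)
  have "0 \<le> (a * \<bar>s - t\<bar> - (s + t))^2" by simp
  hence "2 * (a * (\<bar>s - t\<bar> * (s + t))) \<le> a^2 * (s - t)^2 + (s + t)^2"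
    by (simp add: power2_diff power_mult_distrib algebra_simps)
  also have "(s + t)^2 \<le> 2 * (r + g)" using sum_squares_bound[of s t] st by (simp add: power2_sum)
  finally have "2 * (a * (\<bar>s - t\<bar> * (s + t))) \<le> a^2 * (s - t)^2 + 2 * (r + g)" by simp
  also have "\<bar>s - t\<bar> * (s + t) = \<bar>r - g\<bar>"
    using st by (simp add: square_diff_square_factored power2_eq_square abs_mult)
  finally have "2 * (a * \<bar>r - g\<bar>) \<le> a^2 * (s - t)^2 + 2 * (r + g)" .
  also have "\<dots> = 2 * a * (a / 2 * (s - t)^2 + 1 / a * (r + g))"
    using assms by (simp add: distrib_left power2_eq_square)
  finally have "2 * a * \<bar>r - g\<bar> \<le> 2 * a * (a / 2 * (s - t)^2 + 1 / a * (r + g))" by (simp add: mult.assoc)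
  hence "\<bar>r - g\<bar> \<le> a / 2 * (s - t)^2 + 1 / a * (r + g)" using assms by simp
  also have "a / 2 * (s - t)^2 \<le> a / 2 * (r * ln r - r * ln g - r + g)"
    using H assms by (intro mult_left_mono) auto
  finally show ?thesis by simp
qed

lemma xlnx_lower: "0 < r \<Longrightarrow> r - 1 \<le> r * ln (r::real)"
proof -
  assume r: "0 < r"
  have "ln (1 / r) \<le> 1 / r - 1" using r by (intro ln_le_minus_one) auto
  hence "r * (1 - 1 / r) \<le> r * ln r" using r by (intro mult_left_mono) (auto simp: ln_div)
  thus ?thesis using r by (simp add: algebra_simps)
qed

lemma xlnx_convex:
  fixes a b t :: real
  assumes "0 < a" "0 < b" "0 \<le> t" "t \<le> 1"
  shows "((1 - t) * a + t * b) * ln ((1 - t) * a + t * b) \<le> (1 - t) * (a * ln a) + t * (b * ln b)"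
proof -
  define c where "c = (1 - t) * a + t * b"
  have c: "0 < c" unfolding c_def using assms
    by (cases "t = 0") (auto intro: add_nonneg_pos mult_pos_pos)
  have tangent: "x * ln c + x - c \<le> x * ln x" if "0 < x" for x
  proof -
    have "ln (c / x) \<le> c / x - 1" using that c by (intro ln_le_minus_one) auto
    hence "x * (ln c - ln x) \<le> x * (c / x - 1)" using that c by (intro mult_left_mono) (auto simp: ln_div)
    thus ?thesis using that by (simp add: algebra_simps)
  qed
  have "(1 - t) * (a * ln c + a - c) + t * (b * ln c + b - c) \<le> (1 - t) * (a * ln a) + t * (b * ln b)"
    using tangent assms by (intro add_mono mult_left_mono) auto
  also have "(1 - t) * (a * ln c + a - c) + t * (b * ln c + b - c) = c * ln c"
    by (simp add: c_def algebra_simps)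
  finally show ?thesis unfolding c_def .
qed

text \<open>
  Taylor expansion at 1 with the second derivative \<open>1/x\<close> bounded below by \<open>1/M\<close>.
\<close>

lemma xlnx_quadratic_lower:
  fixes x M :: real
  assumes "0 < x" "x \<le> M" "1 \<le> M"
  shows "(x - 1) + (x - 1)\<^sup>2 / (2 * M) \<le> x * ln x"
proof -
  let ?h = "\<lambda>x. x * ln x - (x - 1) - (x - 1)\<^sup>2 / (2 * M)"
  have deriv: "(?h has_real_derivative ln y - (y - 1) / M) (at y)" if "0 < y" for y
    using that assms(3) by (auto intro!: derivative_eq_intros simp: field_simps)
  have "?h 1 \<le> ?h x"
  proof (cases "1 \<le> x")
    case True
    show ?thesis
    proof (rule DERIV_nonneg_imp_nondecreasing[OF True])
      fix y :: real assume y: "1 \<le> y" "y \<le> x"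
      have "1 - 1 / y \<le> ln y" using ln_le_minus_one[of "1 / y"] y by (simp add: ln_div)
      moreover have "(y - 1) / M \<le> (y - 1) / y" using y assms by (intro divide_left_mono) auto
      moreover have "(y - 1) / y = 1 - 1 / y" using y by (simp add: field_simps)
      ultimately have "0 \<le> ln y - (y - 1) / M" by simp
      thus "\<exists>d. (?h has_real_derivative d) (at y) \<and> 0 \<le> d" using deriv[of y] y by auto
    qed
  next
    case False
    show ?thesis
    proof (rule DERIV_nonpos_imp_nonincreasing[of x 1 ?h])
      fix y :: real assume y: "x \<le> y" "y \<le> 1"
      have "ln y \<le> y - 1" using y assms by (intro ln_le_minus_one) auto
      also have "(1 - y) * 1 \<le> (1 - y) * M" using y assms by (intro mult_left_mono) auto
      hence "y - 1 \<le> (y - 1) / M" using assms by (simp add: field_simps)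
      finally show "\<exists>d. (?h has_real_derivative d) (at y) \<and> d \<le> 0" using deriv[of y] y assms by force
    qed (use False in auto)
  qed
  thus ?thesis by simp
qed

text \<open>
  Multiplied by \<open>1 + s\<close>, this bound gives an upper bound for \<open>(1 + s) ln (1 + s)\<close> whose
  quadratic and cubic Taylor terms are exact.
\<close>

lemma ln_cubic_upper:
  fixes s :: real
  assumes "-1 < s" shows "ln (1 + s) \<le> s - s\<^sup>2 / 2 + s ^ 3 / 3"
proof -
  let ?h = "\<lambda>s. s - s\<^sup>2 / 2 + s ^ 3 / 3 - ln (1 + s)"
  have deriv: "(?h has_real_derivative y ^ 3 / (1 + y)) (at y)" if "-1 < y" for y
    using that by (auto intro!: derivative_eq_intros simp: field_simps power2_eq_square power3_eq_cube)
  have "?h 0 \<le> ?h s"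
  proof (cases "0 \<le> s")
    case True
    show ?thesis
    proof (rule DERIV_nonneg_imp_nondecreasing[OF True])
      fix y :: real assume y: "0 \<le> y" "y \<le> s"
      have "0 \<le> y ^ 3 / (1 + y)" using y by simp
      thus "\<exists>d. (?h has_real_derivative d) (at y) \<and> 0 \<le> d" using deriv[of y] y by auto
    qed
  next
    case False
    show ?thesis
    proof (rule DERIV_nonpos_imp_nonincreasing[of s 0 ?h])
      fix y :: real assume y: "s \<le> y" "y \<le> 0"
      have "y ^ 3 / (1 + y) \<le> 0" using y assms
        by (intro divide_nonpos_pos) (auto simp: power3_eq_cube mult_le_0_iff zero_le_mult_iff)
      thus "\<exists>d. (?h has_real_derivative d) (at y) \<and> d \<le> 0" using deriv[of y] y assms by auto
    qed (use False in auto)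
  qed
  thus ?thesis by simp
qed

section \<open>Probability measures on compact sets\<close>

lemma integral_abs_le:
  fixes f g :: "'b \<Rightarrow> real"
  assumes "integrable M f" "integrable M g" "\<And>x. x \<in> space M \<Longrightarrow> \<bar>f x\<bar> \<le> g x"
  shows "(LINT x|M. \<bar>f x\<bar>) \<le> integral\<^sup>L M g" "\<bar>integral\<^sup>L M f\<bar> \<le> integral\<^sup>L M g"
proof -
  show "(LINT x|M. \<bar>f x\<bar>) \<le> integral\<^sup>L M g"
    by (rule integral_mono) (use assms in auto)
  thus "\<bar>integral\<^sup>L M f\<bar> \<le> integral\<^sup>L M g" using integral_abs_bound[of M f] by linarith
qed

lemma continuous_interval_bound:
  fixes f :: "real \<Rightarrow> real"
  assumes "continuous_on {-1..1} f"
  obtains M where "0 \<le> M" "\<And>t. t \<in> {-1..1} \<Longrightarrow> \<bar>f t\<bar> \<le> M"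
proof -
  have "compact (f ` {-1..1})" by (intro compact_continuous_image assms) auto
  then obtain M where M: "\<And>t. t \<in> {-1..1} \<Longrightarrow> \<bar>f t\<bar> \<le> M"
    using compact_imp_bounded bounded_iff by (metis imageI real_norm_def)
  have "0 \<le> M" using M[of 0] by simp
  with M that show thesis by blast
qed

lemma orthogonal_transformation_borel:
  fixes T :: "'a::euclidean_space \<Rightarrow> 'a"
  assumes "orthogonal_transformation T" shows "T \<in> borel \<rightarrow>\<^sub>M borel"
  using assms
  by (intro borel_measurable_continuous_onI)
     (simp add: orthogonal_transformation_linear linear_continuous_on linear_linear)

locale compact_prob_space = prob_space U for U :: "'a::euclidean_space measure" +
  fixes S :: "'a set"
  assumes compact_S: "compact S"
    and sets_U: "sets U = sets (restrict_space borel S)"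
begin

lemma space_U: "space U = S"
  using sets_eq_imp_space_eq[OF sets_U] by (simp add: space_restrict_space)

lemma S_nonempty: "S \<noteq> {}" using not_empty space_U by simp

lemma ident_measurable: "(\<lambda>x. x) \<in> U \<rightarrow>\<^sub>M borel"
  using measurable_ident_sets[OF sets_U] by (simp add: measurable_restrict_space2_iff)

lemma continuous_measurable: "continuous_on S (f :: 'a \<Rightarrow> real) \<Longrightarrow> f \<in> borel_measurable U"
  using borel_measurable_continuous_on_restrict[of S f] measurable_cong_sets[OF sets_U refl] by blast

lemma bounded_integrable:
  fixes f :: "'a \<Rightarrow> real"
  assumes "f \<in> borel_measurable U" "\<And>x. x \<in> S \<Longrightarrow> \<bar>f x\<bar> \<le> C"
  shows "integrable U f"
  by (rule integrable_const_bound[of _ C]) (use assms space_U in auto)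

lemma continuous_integrable:
  fixes f :: "'a \<Rightarrow> real"
  assumes "continuous_on S f" shows "integrable U f"
proof -
  have "compact (f ` S)" by (rule compact_continuous_image[OF assms compact_S])
  then obtain C where "\<And>x. x \<in> S \<Longrightarrow> \<bar>f x\<bar> \<le> C"
    using compact_imp_bounded bounded_iff by (metis imageI real_norm_def)
  thus ?thesis by (intro bounded_integrable continuous_measurable assms)
qed

lemma bounded_fubini:
  fixes f :: "'a \<Rightarrow> 'a \<Rightarrow> real"
  assumes "(\<lambda>(x, y). f x y) \<in> borel_measurable (U \<Otimes>\<^sub>M U)" "\<And>x y. x \<in> S \<Longrightarrow> y \<in> S \<Longrightarrow> \<bar>f x y\<bar> \<le> C"
  shows "(LINT x|U. LINT y|U. f x y) = (LINT y|U. LINT x|U. f x y)"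
proof -
  interpret P: pair_prob_space U U ..
  have "integrable (U \<Otimes>\<^sub>M U) (\<lambda>(x, y). f x y)"
    by (rule P.integrable_const_bound[of _ C]) (use assms space_U in \<open>auto simp: space_pair_measure\<close>)
  from P.Fubini_integral[OF this] show ?thesis by simp
qed

lemma continuous_kernel_measurable:
  fixes k :: "'a \<Rightarrow> 'a \<Rightarrow> real"
  assumes "continuous_on (S \<times> S) (\<lambda>(x, y). k x y)"
  shows "(\<lambda>(x, y). k x y) \<in> borel_measurable (U \<Otimes>\<^sub>M U)"
proof -
  have m: "(\<lambda>(x, y). indicator (S \<times> S) (x, y) *\<^sub>R k x y) \<in> borel_measurable (borel \<Otimes>\<^sub>M borel)"
    using borel_measurable_continuous_on_indicator[OF _ assms] compact_S
    by (simp add: borel_prod compact_Times compact_imp_closed borel_closed case_prod_beta')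
  have "(\<lambda>z. (fst z, snd z)) \<in> U \<Otimes>\<^sub>M U \<rightarrow>\<^sub>M borel \<Otimes>\<^sub>M borel"
    by (intro measurable_Pair measurable_compose[OF measurable_fst ident_measurable]
        measurable_compose[OF measurable_snd ident_measurable])
  from measurable_compose[OF this m]
  have "(\<lambda>(x, y). indicator (S \<times> S) (x, y) *\<^sub>R k x y) \<in> borel_measurable (U \<Otimes>\<^sub>M U)"
    by (simp add: case_prod_beta')
  then show ?thesis
    by (rule measurable_cong[THEN iffD1, rotated]) (auto simp: space_pair_measure space_U)
qed

end

section \<open>Potentials and the interaction pairing\<close>

text \<open>
  The assumption on the marginals, which rotation symmetry provides on the sphere, makes the
  uniform density a critical point of the energy for every parameter.
\<close>

locale compact_interaction = compact_prob_space U S for U :: "'a::euclidean_space measure" and S +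
  fixes K :: "'a \<Rightarrow> 'a \<Rightarrow> real" and B \<kappa> :: real
  assumes continuous_K: "continuous_on (S \<times> S) (\<lambda>(x, y). K x y)"
    and K_sym: "x \<in> S \<Longrightarrow> y \<in> S \<Longrightarrow> K x y = K y x"
    and K_bound: "x \<in> S \<Longrightarrow> y \<in> S \<Longrightarrow> \<bar>K x y\<bar> \<le> B"
    and K_marginal: "x \<in> S \<Longrightarrow> (LINT y|U. K x y) = \<kappa>"
begin

lemma B_nonneg: "0 \<le> B" using S_nonempty K_bound by (meson abs_ge_zero equals0I order_trans)

lemmas K_measurable_pair = continuous_kernel_measurable[OF continuous_K]

lemma K_measurable: "x \<in> S \<Longrightarrow> K x \<in> borel_measurable U"
  using measurable_compose[OF measurable_Pair1'[of x U U] K_measurable_pair] space_U by simp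

lemma K_mult_integrable:
  assumes "integrable U f" "x \<in> S" shows "integrable U (\<lambda>y. K x y * f y)"
proof (rule Bochner_Integration.integrable_bound[of _ "\<lambda>y. B * \<bar>f y\<bar>"])
  show "integrable U (\<lambda>y. B * \<bar>f y\<bar>)" using assms by simp
  show "(\<lambda>y. K x y * f y) \<in> borel_measurable U" using K_measurable[OF assms(2)] assms(1) by simp
  show "AE y in U. norm (K x y * f y) \<le> norm (B * \<bar>f y\<bar>)"
    using K_bound[OF assms(2)] B_nonneg by (auto simp: space_U abs_mult intro!: mult_right_mono)
qed

definition potential :: "('a \<Rightarrow> real) \<Rightarrow> 'a \<Rightarrow> real" where
  "potential f x = (LINT y|U. K x y * f y)"

definition pairing :: "('a \<Rightarrow> real) \<Rightarrow> ('a \<Rightarrow> real) \<Rightarrow> real" where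
  "pairing f g = (LINT x|U. f x * potential g x)"

lemma potential_bound:
  assumes "integrable U f" "x \<in> S" shows "\<bar>potential f x\<bar> \<le> B * (LINT y|U. \<bar>f y\<bar>)"
proof -
  have "\<bar>potential f x\<bar> \<le> (LINT y|U. B * \<bar>f y\<bar>)"
    unfolding potential_def
    by (rule integral_abs_le[OF K_mult_integrable[OF assms]])
       (use assms K_bound[OF assms(2)] in \<open>auto simp: space_U abs_mult intro!: mult_right_mono\<close>)
  thus ?thesis by simp
qed

text \<open>
  Uniform continuity of the kernel gives a modulus of continuity common to
  all potentials of densities; this is the equicontinuity needed for Arzela-Ascoli.
\<close>

lemma potential_equicontinuous:
  assumes "0 < e"
  obtains d where "0 < d" "\<And>f x y. integrable U f \<Longrightarrow> x \<in> S \<Longrightarrow> y \<in> S \<Longrightarrow> norm (x - y) < d \<Longrightarrow>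
     \<bar>potential f x - potential f y\<bar> \<le> e * (LINT y|U. \<bar>f y\<bar>)"
proof -
  have "uniformly_continuous_on (S \<times> S) (\<lambda>(x, y). K x y)"
    by (rule compact_uniformly_continuous[OF continuous_K compact_Times[OF compact_S compact_S]])
  then obtain d where d: "0 < d" "\<And>z z'. z \<in> S \<times> S \<Longrightarrow> z' \<in> S \<times> S \<Longrightarrow> dist z' z < d \<Longrightarrow>
      dist ((\<lambda>(x, y). K x y) z') ((\<lambda>(x, y). K x y) z) < e"
    unfolding uniformly_continuous_on_def using assms by metis
  have *: "\<bar>K x z - K y z\<bar> \<le> e" if "x \<in> S" "y \<in> S" "z \<in> S" "norm (x - y) < d" for x y z
    using d(2)[of "(y,z)" "(x,z)"] that by (auto simp: dist_Pair_Pair dist_norm)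
  show ?thesis
  proof (rule that[OF d(1)])
    fix f :: "'a \<Rightarrow> real" and x y assume f: "integrable U f" and xy: "x \<in> S" "y \<in> S" "norm (x - y) < d"
    have "potential f x - potential f y = (LINT z|U. K x z * f z - K y z * f z)"
      unfolding potential_def using K_mult_integrable[OF f] xy by simp
    also have "\<bar>\<dots>\<bar> \<le> (LINT z|U. e * \<bar>f z\<bar>)"
    proof (rule integral_abs_le)
      show "\<bar>K x z * f z - K y z * f z\<bar> \<le> e * \<bar>f z\<bar>" if "z \<in> space U" for z
        using *[OF xy(1,2) _ xy(3), of z] that
        by (auto simp: space_U abs_mult left_diff_distrib[symmetric] intro!: mult_right_mono)
    qed (use f K_mult_integrable[OF f] xy in auto)
    finally show "\<bar>potential f x - potential f y\<bar> \<le> e * (LINT y|U. \<bar>f y\<bar>)" by simp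
  qed
qed

lemma potential_continuous:
  fixes f :: "'a \<Rightarrow> real"
  assumes "integrable U f" shows "continuous_on S (potential f)"
proof (unfold continuous_on_iff, intro ballI allI impI)
  fix e :: real and x0 assume "x0 \<in> S" "0 < e"
  define L where "L = (LINT y|U. \<bar>f y\<bar>)"
  have L: "0 \<le> L" unfolding L_def by simp
  have "0 < e / (L + 1)" using \<open>0 < e\<close> L by simp
  from potential_equicontinuous[OF this] obtain d where d: "0 < d"
    "\<And>f x y. integrable U f \<Longrightarrow> x \<in> S \<Longrightarrow> y \<in> S \<Longrightarrow> norm (x - y) < d \<Longrightarrow>
     \<bar>potential f x - potential f y\<bar> \<le> (e / (L + 1)) * (LINT y|U. \<bar>f y\<bar>)" by blast
  have "e / (L + 1) * L < e" using \<open>0 < e\<close> L by (simp add: field_simps)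
  hence "dist (potential f x') (potential f x0) < e" if "x' \<in> S" "dist x' x0 < d" for x'
    using d(2)[OF assms that(1) \<open>x0 \<in> S\<close>] that by (auto simp: dist_norm L_def[symmetric])
  with d(1) show "\<exists>d>0. \<forall>x'\<in>S. dist x' x0 < d \<longrightarrow> dist (potential f x') (potential f x0) < e" by blast
qed

lemma potential_measurable: "integrable U f \<Longrightarrow> potential f \<in> borel_measurable U"
  by (intro continuous_measurable potential_continuous)

lemma mult_bounded_integrable:
  fixes f V :: "'a \<Rightarrow> real"
  assumes "integrable U f" "V \<in> borel_measurable U" "\<And>x. x \<in> S \<Longrightarrow> \<bar>V x\<bar> \<le> C"
  shows "integrable U (\<lambda>x. f x * V x)"
proof (rule Bochner_Integration.integrable_bound[of _ "\<lambda>y. C * \<bar>f y\<bar>"])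
  show "integrable U (\<lambda>y. C * \<bar>f y\<bar>)" using assms by simp
  show "AE y in U. norm (f y * V y) \<le> norm (C * \<bar>f y\<bar>)"
  proof (rule AE_I2)
    fix y assume "y \<in> space U"
    hence "\<bar>V y\<bar> \<le> \<bar>C\<bar>" using assms(3)[of y] by (simp add: space_U)
    hence "\<bar>f y\<bar> * \<bar>V y\<bar> \<le> \<bar>f y\<bar> * \<bar>C\<bar>" by (intro mult_left_mono) auto
    thus "norm (f y * V y) \<le> norm (C * \<bar>f y\<bar>)" by (simp add: abs_mult mult.commute)
  qed
qed (use assms in auto)

lemma pairing_integrable: "integrable U f \<Longrightarrow> integrable U g \<Longrightarrow> integrable U (\<lambda>x. f x * potential g x)"
  by (rule mult_bounded_integrable[OF _ potential_measurable potential_bound])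

lemma pairing_bound:
  fixes f g :: "'a \<Rightarrow> real"
  assumes "integrable U f" "integrable U g"
  shows "\<bar>pairing f g\<bar> \<le> B * (LINT x|U. \<bar>f x\<bar>) * (LINT x|U. \<bar>g x\<bar>)"
proof -
  have "\<bar>pairing f g\<bar> \<le> (LINT x|U. \<bar>f x\<bar> * (B * (LINT x|U. \<bar>g x\<bar>)))"
    unfolding pairing_def
    by (rule integral_abs_le[OF pairing_integrable[OF assms]])
       (use assms potential_bound[OF assms(2)] in \<open>auto simp: space_U abs_mult intro!: mult_left_mono\<close>)
  thus ?thesis by (simp add: mult_ac)
qed

lemma potential_add:
  "integrable U f \<Longrightarrow> integrable U g \<Longrightarrow> x \<in> S \<Longrightarrow> potential (\<lambda>y. f y + g y) x = potential f x + potential g x"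
  unfolding potential_def using K_mult_integrable by (simp add: distrib_left)

lemma potential_scale: "potential (\<lambda>y. c * f y) x = c * potential f x"
  unfolding potential_def by (simp add: mult.left_commute)

lemma pairing_add_left:
  "integrable U f \<Longrightarrow> integrable U g \<Longrightarrow> integrable U h \<Longrightarrow> pairing (\<lambda>y. f y + g y) h = pairing f h + pairing g h"
  unfolding pairing_def using pairing_integrable by (simp add: distrib_right)

lemma pairing_add_right:
  assumes "integrable U f" "integrable U g" "integrable U h"
  shows "pairing h (\<lambda>y. f y + g y) = pairing h f + pairing h g"
proof -
  have "pairing h (\<lambda>y. f y + g y) = (LINT x|U. h x * potential f x + h x * potential g x)"
    unfolding pairing_def using assms
    by (intro Bochner_Integration.integral_cong) (auto simp: space_U potential_add distrib_left)
  thus ?thesis using assms pairing_integrable unfolding pairing_def by simp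
qed

lemma pairing_scale_left: "pairing (\<lambda>y. c * f y) h = c * pairing f h"
  unfolding pairing_def by (simp add: mult.assoc)

lemma pairing_scale_right: "pairing h (\<lambda>y. c * f y) = c * pairing h f"
  unfolding pairing_def potential_scale by (simp add: mult.left_commute)

lemma kernel_pair_integrable:
  assumes "integrable U f" "integrable U g"
  shows "integrable (U \<Otimes>\<^sub>M U) (\<lambda>(x, y). f x * (K x y * g y))"
proof -
  interpret pair_sigma_finite U U ..
  have [measurable]: "f \<in> borel_measurable U" "g \<in> borel_measurable U" using assms by auto
  note K_measurable_pair[measurable]
  show ?thesis
  proof (rule Fubini_integrable)
    show m: "(\<lambda>(x, y). f x * (K x y * g y)) \<in> borel_measurable (U \<Otimes>\<^sub>M U)" by measurable
    show "AE x in U. integrable U (\<lambda>y. case (x, y) of (x, y) \<Rightarrow> f x * (K x y * g y))"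
      using K_mult_integrable[OF assms(2)] by (auto simp: space_U)
    show "integrable U (\<lambda>x. LINT y|U. norm (case (x, y) of (x, y) \<Rightarrow> f x * (K x y * g y)))"
    proof (rule Bochner_Integration.integrable_bound[of _ "\<lambda>x. \<bar>f x\<bar> * (B * (LINT y|U. \<bar>g y\<bar>))"])
      show "integrable U (\<lambda>x. \<bar>f x\<bar> * (B * (LINT y|U. \<bar>g y\<bar>)))" using assms by simp
      show "(\<lambda>x. LINT y|U. norm (case (x, y) of (x, y) \<Rightarrow> f x * (K x y * g y))) \<in> borel_measurable U"
        by measurable
      show "AE x in U. norm (LINT y|U. norm (case (x, y) of (x, y) \<Rightarrow> f x * (K x y * g y)))
          \<le> norm (\<bar>f x\<bar> * (B * (LINT y|U. \<bar>g y\<bar>)))"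
      proof (intro AE_I2)
        fix x assume "x \<in> space U"
        hence x: "x \<in> S" by (simp add: space_U)
        have "(LINT y|U. \<bar>K x y * g y\<bar>) \<le> (LINT y|U. B * \<bar>g y\<bar>)"
          by (rule integral_abs_le[OF K_mult_integrable[OF assms(2) x]])
             (use assms K_bound[OF x] in \<open>auto simp: space_U abs_mult intro!: mult_right_mono\<close>)
        hence "\<bar>f x\<bar> * (LINT y|U. \<bar>K x y * g y\<bar>) \<le> \<bar>f x\<bar> * (B * (LINT y|U. \<bar>g y\<bar>))"
          by (intro mult_left_mono) auto
        thus "norm (LINT y|U. norm (case (x, y) of (x, y) \<Rightarrow> f x * (K x y * g y)))
          \<le> norm (\<bar>f x\<bar> * (B * (LINT y|U. \<bar>g y\<bar>)))"
          using B_nonneg by (simp add: abs_mult)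
      qed
    qed
  qed
qed

lemma pairing_commute:
  assumes "integrable U f" "integrable U g"
  shows "pairing f g = pairing g f"
proof -
  interpret pair_sigma_finite U U ..
  have "pairing f g = (LINT x|U. LINT y|U. f x * (K x y * g y))"
    unfolding pairing_def potential_def by simp
  also have "\<dots> = (LINT y|U. LINT x|U. f x * (K x y * g y))"
    using Fubini_integral[OF kernel_pair_integrable[OF assms]] by simp
  also have "\<dots> = (LINT y|U. LINT x|U. g y * (K y x * f x))"
    by (intro Bochner_Integration.integral_cong) (auto simp: space_U K_sym[of _ ] mult_ac)
  also have "\<dots> = pairing g f" unfolding pairing_def potential_def by simp
  finally show ?thesis .
qed

end

section \<open>Entropy and Gibbs densities\<close>

context compact_interaction
begin

definition densities :: "('a \<Rightarrow> real) set" where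
  "densities = {r. r \<in> borel_measurable U \<and> (AE x in U. 0 < r x) \<and> integrable U r
     \<and> (LINT x|U. r x) = 1 \<and> integrable U (\<lambda>x. r x * ln (r x))}"

definition boltzmann_entropy :: "('a \<Rightarrow> real) \<Rightarrow> real" where
  "boltzmann_entropy r = (LINT x|U. r x * ln (r x))"

definition energy :: "real \<Rightarrow> ('a \<Rightarrow> real) \<Rightarrow> real" where
  "energy \<gamma> r = boltzmann_entropy r / \<gamma> + pairing r r / 2"

definition partition :: "('a \<Rightarrow> real) \<Rightarrow> real" where
  "partition V = (LINT x|U. exp (- V x))"

definition gibbs :: "('a \<Rightarrow> real) \<Rightarrow> 'a \<Rightarrow> real" where
  "gibbs V x = exp (- V x) / partition V"

text \<open>
  The relative entropy of \<open>r\<close> with respect to \<open>gibbs V\<close>.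
\<close>

definition gibbs_divergence :: "('a \<Rightarrow> real) \<Rightarrow> ('a \<Rightarrow> real) \<Rightarrow> real" where
  "gibbs_divergence V r = boltzmann_entropy r + (LINT x|U. r x * V x) + ln (partition V)"

lemma densitiesD:
  assumes "r \<in> densities"
  shows "r \<in> borel_measurable U" "AE x in U. 0 < r x" "integrable U r" "(LINT x|U. r x) = 1"
    "integrable U (\<lambda>x. r x * ln (r x))" "(LINT x|U. \<bar>r x\<bar>) = 1"
proof -
  show 1: "r \<in> borel_measurable U" "AE x in U. 0 < r x" "integrable U r" "(LINT x|U. r x) = 1"
    "integrable U (\<lambda>x. r x * ln (r x))" using assms by (auto simp: densities_def)
  have "(LINT x|U. \<bar>r x\<bar>) = (LINT x|U. r x)"
    using 1 by (intro integral_cong_AE) auto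
  thus "(LINT x|U. \<bar>r x\<bar>) = 1" using 1 by simp
qed

lemma bounded_density:
  assumes "f \<in> borel_measurable U" "\<And>x. x \<in> S \<Longrightarrow> 0 < f x" "\<And>x. x \<in> S \<Longrightarrow> f x \<le> D" "(LINT x|U. f x) = 1"
  shows "f \<in> densities"
proof -
  have "\<bar>f x * ln (f x)\<bar> \<le> D * D + 1" if "x \<in> S" for x
  proof -
    have p: "0 < f x" "f x \<le> D" using assms that by auto
    have "f x * ln (f x) \<le> f x * (f x - 1)"
      using p by (intro mult_left_mono ln_le_minus_one) auto
    also have "\<dots> \<le> f x * f x" using p by (simp add: algebra_simps)
    also have "\<dots> \<le> D * D" using p by (intro mult_mono) auto
    finally show ?thesis using xlnx_lower[OF p(1)] p zero_le_square[of D] by linarith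
  qed
  moreover have "(\<lambda>x. f x * ln (f x)) \<in> borel_measurable U" using assms(1) by measurable
  ultimately have "integrable U (\<lambda>x. f x * ln (f x))" by (intro bounded_integrable)
  moreover have "integrable U f"
    using assms(2,3) by (intro bounded_integrable[of _ D]) (auto simp: assms(1) abs_of_pos)
  ultimately show ?thesis using assms by (auto simp: densities_def space_U)
qed

lemma exp_potential_integrable:
  fixes V :: "'a \<Rightarrow> real"
  assumes "V \<in> borel_measurable U" "\<And>x. x \<in> S \<Longrightarrow> \<bar>V x\<bar> \<le> C"
  shows "integrable U (\<lambda>x. exp (- V x))"
proof (rule bounded_integrable[of _ "exp C"])
  show "(\<lambda>x. exp (- V x)) \<in> borel_measurable U" using assms(1) by measurable
qed (use assms(2) abs_le_D2 in force)

lemma partition_bounds: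
  assumes "V \<in> borel_measurable U" "\<And>x. x \<in> S \<Longrightarrow> \<bar>V x\<bar> \<le> C"
  shows "exp (- C) \<le> partition V" "partition V \<le> exp C"
proof -
  note i = exp_potential_integrable[OF assms]
  have *: "V x \<le> C" "- V x \<le> C" if "x \<in> S" for x using assms(2)[OF that] by auto
  have "(LINT x|U. exp (- C)) \<le> partition V" unfolding partition_def
    by (rule integral_mono) (use i * in \<open>auto simp: space_U\<close>)
  thus "exp (- C) \<le> partition V" by (simp add: prob_space)
  have "partition V \<le> (LINT x|U. exp C)" unfolding partition_def
    by (rule integral_mono) (use i * in \<open>auto simp: space_U\<close>)
  thus "partition V \<le> exp C" by (simp add: prob_space)
qed

lemma partition_pos:
  assumes "V \<in> borel_measurable U" "\<And>x. x \<in> S \<Longrightarrow> \<bar>V x\<bar> \<le> C"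
  shows "0 < partition V"
  using partition_bounds(1)[OF assms] by (meson exp_gt_zero less_le_trans)

lemma gibbs_bounds:
  assumes "V \<in> borel_measurable U" "\<And>x. x \<in> S \<Longrightarrow> \<bar>V x\<bar> \<le> C" "x \<in> S"
  shows "exp (- (2 * C)) \<le> gibbs V x" "gibbs V x \<le> exp (2 * C)"
proof -
  note Z = partition_bounds[OF assms(1,2)] partition_pos[OF assms(1,2)]
  have V: "V x \<le> C" "- V x \<le> C" using assms(2)[OF assms(3)] by auto
  have "exp (- (2 * C)) * partition V \<le> exp (- (2 * C)) * exp C"
    using Z by (intro mult_left_mono) auto
  also have "\<dots> = exp (- C)" by (simp flip: exp_add)
  also have "\<dots> \<le> exp (- V x)" using V by simp
  finally show "exp (- (2 * C)) \<le> gibbs V x" using Z by (simp add: gibbs_def pos_le_divide_eq)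
  have "exp (- V x) \<le> exp (2 * C) * exp (- C)" using V by (simp flip: exp_add)
  also have "\<dots> \<le> exp (2 * C) * partition V" using Z by (intro mult_left_mono) auto
  finally show "gibbs V x \<le> exp (2 * C)" using Z by (simp add: gibbs_def pos_divide_le_eq)
qed

lemma gibbs_density:
  assumes "V \<in> borel_measurable U" "\<And>x. x \<in> S \<Longrightarrow> \<bar>V x\<bar> \<le> C"
  shows "gibbs V \<in> densities"
proof (rule bounded_density[of _ "exp (2 * C)"])
  have "(LINT x|U. gibbs V x) = partition V / partition V"
    unfolding gibbs_def partition_def by simp
  thus "(LINT x|U. gibbs V x) = 1" using partition_pos[OF assms] by simp
  show "gibbs V \<in> borel_measurable U" unfolding gibbs_def[abs_def] using assms(1) by measurable
  show "0 < gibbs V x" for x unfolding gibbs_def using partition_pos[OF assms] by simp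
qed (use gibbs_bounds[OF assms] in auto)

lemma ln_gibbs:
  assumes "V \<in> borel_measurable U" "\<And>x. x \<in> S \<Longrightarrow> \<bar>V x\<bar> \<le> C"
  shows "ln (gibbs V x) = - V x - ln (partition V)"
  using partition_pos[OF assms] by (simp add: gibbs_def ln_div)

text \<open>
  A Pinsker-type inequality, with a worse constant than the classical one. Integrating
  \<open>entropy_pointwise\<close> gives \<open>L \<le> a D / 2 + 2 / a\<close> for every \<open>a > 0\<close>, where \<open>L\<close> is the \<open>L\<^sup>1\<close> distance and
  \<open>D\<close> the relative entropy; the choice \<open>a = 4 / L\<close> gives the claim.
\<close>

lemma pinsker_gibbs:
  assumes "V \<in> borel_measurable U" "\<And>x. x \<in> S \<Longrightarrow> \<bar>V x\<bar> \<le> C" "r \<in> densities"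
  shows "(LINT x|U. \<bar>r x - gibbs V x\<bar>)\<^sup>2 \<le> 4 * gibbs_divergence V r"
proof -
  note r = densitiesD[OF assms(3)]
  note g = densitiesD[OF gibbs_density[OF assms(1,2)]]
  have gpos: "0 < gibbs V x" for x unfolding gibbs_def using partition_pos[OF assms(1,2)] by simp
  have rV: "integrable U (\<lambda>x. r x * V x)" by (rule mult_bounded_integrable[OF r(3) assms(1,2)])
  define L D where "L = (LINT x|U. \<bar>r x - gibbs V x\<bar>)" and "D = gibbs_divergence V r"
  have key: "L \<le> a / 2 * D + 2 / a" if a: "0 < a" for a
  proof -
    let ?h = "\<lambda>x. a / 2 * (r x * ln (r x) + r x * V x + ln (partition V) * r x - r x + gibbs V x)
                  + 1 / a * (r x + gibbs V x)"
    have "L \<le> (LINT x|U. ?h x)" unfolding L_def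
    proof (rule integral_mono_AE)
      show "AE x in U. \<bar>r x - gibbs V x\<bar> \<le> ?h x"
        using r(2)
      proof eventually_elim
        case (elim x)
        show ?case using entropy_pointwise[OF elim gpos[of x] a]
          by (simp add: ln_gibbs[OF assms(1,2)] algebra_simps)
      qed
    qed (use r g rV in auto)
    also have "\<dots> = a / 2 * D + 2 / a"
      using r g rV by (simp add: D_def gibbs_divergence_def boltzmann_entropy_def)
    finally show ?thesis .
  qed
  have L0: "0 \<le> L" unfolding L_def by simp
  show ?thesis
  proof (cases "L = 0")
    case False
    hence L: "0 < L" using L0 by simp
    \<comment> \<open>both terms of the bound balance at \<open>L / 2\<close>\<close>
    have "L \<le> (4 / L) / 2 * D + 2 / (4 / L)" using key[of "4 / L"] L by simp
    hence "L * L \<le> 4 * D" using L by (simp add: field_simps)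
    thus ?thesis by (simp add: L_def D_def power2_eq_square)
  next
    case True
    have "0 \<le> D"
    proof (rule ccontr)
      assume "\<not> 0 \<le> D"
      hence D: "D < 0" by simp
      \<comment> \<open>for negative \<open>D\<close> a large \<open>a\<close> makes the bound negative\<close>
      define a where "a = 1 + 4 / (- D)"
      have a: "1 \<le> a" using D by (auto simp: a_def field_simps)
      have "a * (a * D) \<le> 1 * (a * D)" using a D by (intro mult_right_mono_neg) (auto simp: mult_le_0_iff)
      moreover have "a * D = D - 4" using D by (simp add: a_def field_simps)
      ultimately have "a * (a * D) < -4" using D by linarith
      hence "a * a * D < -4" by (simp only: mult.assoc)
      moreover have "0 \<le> a / 2 * D + 2 / a" using key[of a] a True by simp
      hence "0 \<le> (a / 2 * D + 2 / a) * (2 * a)" using a by simp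
      moreover have "(a / 2 * D + 2 / a) * (2 * a) = a * a * D + 4" using a by (simp add: field_simps)
      ultimately show False by linarith
    qed
    thus ?thesis using True by (simp add: L_def D_def)
  qed
qed

lemma gibbs_divergence_nonneg:
  assumes "V \<in> borel_measurable U" "\<And>x. x \<in> S \<Longrightarrow> \<bar>V x\<bar> \<le> C" "r \<in> densities"
  shows "0 \<le> gibbs_divergence V r"
  using pinsker_gibbs[OF assms] zero_le_power2[of "LINT x|U. \<bar>r x - gibbs V x\<bar>"] by linarith

lemma entropy_gibbs:
  assumes "V \<in> borel_measurable U" "\<And>x. x \<in> S \<Longrightarrow> \<bar>V x\<bar> \<le> C"
  shows "boltzmann_entropy (gibbs V) = - (LINT x|U. gibbs V x * V x) - ln (partition V)"
proof -
  note g = densitiesD[OF gibbs_density[OF assms]]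
  have gV: "integrable U (\<lambda>x. gibbs V x * V x)" by (rule mult_bounded_integrable[OF g(3) assms])
  have "boltzmann_entropy (gibbs V) = (LINT x|U. - (gibbs V x * V x) - ln (partition V) * gibbs V x)"
    unfolding boltzmann_entropy_def by (simp add: ln_gibbs[OF assms] algebra_simps)
  also have "\<dots> = - (LINT x|U. gibbs V x * V x) - ln (partition V)" using g gV by simp
  finally show ?thesis .
qed

lemma const_one_density: "(\<lambda>_. 1) \<in> densities"
  by (rule bounded_density[of _ 1]) (auto simp: prob_space)

lemma pinsker_uniform:
  assumes "r \<in> densities" shows "(LINT x|U. \<bar>r x - 1\<bar>)\<^sup>2 \<le> 4 * boltzmann_entropy r"
  using pinsker_gibbs[of "\<lambda>_. 0" 0 r] assms
  by (simp add: gibbs_def[abs_def] partition_def gibbs_divergence_def prob_space)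

lemma entropy_nonneg: "r \<in> densities \<Longrightarrow> 0 \<le> boltzmann_entropy r"
  using pinsker_uniform[of r] zero_le_power2[of "LINT x|U. \<bar>r x - 1\<bar>"] by linarith

lemma potential_density_bound: "r \<in> densities \<Longrightarrow> x \<in> S \<Longrightarrow> \<bar>potential r x\<bar> \<le> B"
  using potential_bound[of r x] densitiesD[of r] by simp

lemma scaled_potential:
  assumes "r \<in> densities" "0 < \<gamma>"
  shows "(\<lambda>x. \<gamma> * potential r x) \<in> borel_measurable U" "x \<in> S \<Longrightarrow> \<bar>\<gamma> * potential r x\<bar> \<le> \<gamma> * B"
  using potential_measurable[OF densitiesD(3)[OF assms(1)]] potential_density_bound[OF assms(1)] assms(2)
  by (auto simp: abs_mult)

lemma mixture_density:
  assumes "r \<in> densities" "g \<in> densities" "0 \<le> t" "t \<le> 1"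
  shows "(\<lambda>x. (1 - t) * r x + t * g x) \<in> densities"
    "boltzmann_entropy (\<lambda>x. (1 - t) * r x + t * g x) \<le> (1 - t) * boltzmann_entropy r + t * boltzmann_entropy g"
proof -
  note r = densitiesD[OF assms(1)] and g = densitiesD[OF assms(2)]
  let ?m = "\<lambda>x. (1 - t) * r x + t * g x"
  let ?u = "\<lambda>x. (1 - t) * (r x * ln (r x)) + t * (g x * ln (g x))"
  have m[measurable]: "?m \<in> borel_measurable U" using r(1) g(1) by measurable
  have pos: "AE x in U. 0 < ?m x \<and> ?m x - 1 \<le> ?m x * ln (?m x) \<and> ?m x * ln (?m x) \<le> ?u x"
    using r(2) g(2)
  proof eventually_elim
    case (elim x)
    have "0 < ?m x" using elim assms by (cases "t = 0") (auto intro: add_nonneg_pos mult_pos_pos)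
    thus ?case using xlnx_lower xlnx_convex[OF elim assms(3,4)] by blast
  qed
  have im: "integrable U ?m" and iu: "integrable U ?u" using r g by auto
  have i: "integrable U (\<lambda>x. ?m x * ln (?m x))"
  proof (rule Bochner_Integration.integrable_bound[of _ "\<lambda>x. \<bar>?u x\<bar> + \<bar>?m x - 1\<bar>"])
    show "integrable U (\<lambda>x. \<bar>?u x\<bar> + \<bar>?m x - 1\<bar>)" using im iu by simp
    show "AE x in U. norm (?m x * ln (?m x)) \<le> norm (\<bar>?u x\<bar> + \<bar>?m x - 1\<bar>)"
      using pos by eventually_elim auto
  qed measurable
  have "(LINT x|U. ?m x) = 1" using r g by simp
  thus "?m \<in> densities" using pos im i by (auto simp: densities_def)
  have "boltzmann_entropy ?m \<le> (LINT x|U. ?u x)" unfolding boltzmann_entropy_def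
    by (rule integral_mono_AE[OF i iu]) (use pos in auto)
  also have "\<dots> = (1 - t) * boltzmann_entropy r + t * boltzmann_entropy g" using r g by (simp add: boltzmann_entropy_def)
  finally show "boltzmann_entropy ?m \<le> (1 - t) * boltzmann_entropy r + t * boltzmann_entropy g" .
qed

lemma pairing_expand:
  fixes r d :: "'a \<Rightarrow> real"
  assumes "integrable U r" "integrable U d"
  shows "pairing (\<lambda>x. r x + t * d x) (\<lambda>x. r x + t * d x) = pairing r r + 2 * t * pairing d r + t\<^sup>2 * pairing d d"
  using assms pairing_commute[of r d]
  by (simp add: pairing_add_left pairing_add_right pairing_scale_left pairing_scale_right power2_eq_square algebra_simps)

text \<open>
  The entropy is convex, so along the segment from \<open>r\<close> to its Gibbs density the energy
  drops linearly with slope at least the relative entropy divided by \<open>\<gamma>\<close>, up to the quadratic term of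
  the pairing, which \<open>2 B t\<^sup>2\<close> controls.
\<close>

lemma gibbs_step:
  assumes r: "r \<in> densities" and \<gamma>: "0 < \<gamma>" and t: "0 \<le> t" "t \<le> 1"
  defines "V \<equiv> \<lambda>x. \<gamma> * potential r x"
  shows "\<exists>q\<in>densities. energy \<gamma> q \<le> energy \<gamma> r - t / \<gamma> * gibbs_divergence V r + 2 * B * t\<^sup>2"
proof -
  have V: "V \<in> borel_measurable U" "\<And>x. x \<in> S \<Longrightarrow> \<bar>V x\<bar> \<le> \<gamma> * B"
    unfolding V_def by (fact scaled_potential[OF r \<gamma>])+
  define g where "g = gibbs V"
  have gd: "g \<in> densities" unfolding g_def by (rule gibbs_density[OF V]) 
  note R = densitiesD[OF r] and G = densitiesD[OF gd]
  define q where "q = (\<lambda>x. (1 - t) * r x + t * g x)"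
  define d where "d = (\<lambda>x. g x - r x)"
  have q: "q \<in> densities" "boltzmann_entropy q \<le> (1 - t) * boltzmann_entropy r + t * boltzmann_entropy g"
    unfolding q_def using mixture_density[OF r gd t] by auto
  have id: "integrable U d" using R G by (simp add: d_def)
  have qd: "q = (\<lambda>x. r x + t * d x)" by (auto simp: q_def d_def algebra_simps)
  have P: "pairing q q = pairing r r + 2 * t * pairing d r + t\<^sup>2 * pairing d d"
    unfolding qd by (rule pairing_expand[OF R(3) id])
  have dn: "(LINT x|U. \<bar>d x\<bar>) \<le> 2"
  proof -
    have "(LINT x|U. \<bar>d x\<bar>) \<le> (LINT x|U. \<bar>g x\<bar> + \<bar>r x\<bar>)"
      by (rule integral_mono) (use R G id in \<open>auto simp: d_def\<close>)
    thus ?thesis using R G by simp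
  qed
  have "pairing d d \<le> B * (LINT x|U. \<bar>d x\<bar>) * (LINT x|U. \<bar>d x\<bar>)"
    using pairing_bound[OF id id] by simp
  also have "\<dots> \<le> B * 2 * 2" using dn B_nonneg by (intro mult_mono) auto
  finally have "t\<^sup>2 * pairing d d \<le> t\<^sup>2 * (4 * B)" by (intro mult_left_mono) auto
  hence dd: "t\<^sup>2 * pairing d d / 2 \<le> 2 * B * t\<^sup>2" by (simp add: mult_ac)
  have gV: "(LINT x|U. g x * V x) = \<gamma> * pairing g r" and rV: "(LINT x|U. r x * V x) = \<gamma> * pairing r r"
    unfolding V_def pairing_def by (simp_all add: mult.left_commute)
  have dr: "pairing d r = pairing g r - pairing r r"
    unfolding d_def pairing_def using pairing_integrable[OF G(3) R(3)] pairing_integrable[OF R(3) R(3)]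
    by (simp add: left_diff_distrib)
  have eg: "boltzmann_entropy g = - \<gamma> * pairing g r - ln (partition V)"
    unfolding g_def using entropy_gibbs[OF V] gV g_def by simp
  have "energy \<gamma> q \<le> ((1 - t) * boltzmann_entropy r + t * boltzmann_entropy g) / \<gamma> + pairing q q / 2"
    unfolding energy_def using q(2) \<gamma> by (simp add: divide_right_mono)
  also have "\<dots> \<le> ((1 - t) * boltzmann_entropy r + t * boltzmann_entropy g) / \<gamma> + (pairing r r + 2 * t * pairing d r) / 2 + 2 * B * t\<^sup>2"
    unfolding P using dd by (simp add: add_divide_distrib)
  also have "\<dots> = energy \<gamma> r - t / \<gamma> * gibbs_divergence V r + 2 * B * t\<^sup>2"
    unfolding energy_def gibbs_divergence_def rV eg dr using \<gamma> by (simp add: field_simps)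
  finally show ?thesis using q(1) by blast
qed

end

section \<open>Minimizers of the energy\<close>

context compact_interaction
begin

text \<open>
  The Euler-Lagrange equation. A minimizer cannot gain in \<open>gibbs_step\<close>, so its relative
  entropy is at most a constant times \<open>t\<close> for all small \<open>t\<close>, hence zero.
\<close>

theorem minimizer_is_gibbs:
  assumes r: "r \<in> densities" and \<gamma>: "0 < \<gamma>" and min: "\<And>q. q \<in> densities \<Longrightarrow> energy \<gamma> r \<le> energy \<gamma> q"
  shows "AE x in U. r x = gibbs (\<lambda>x. \<gamma> * potential r x) x"
proof -
  define V where "V = (\<lambda>x. \<gamma> * potential r x)"
  have V: "V \<in> borel_measurable U" "\<And>x. x \<in> S \<Longrightarrow> \<bar>V x\<bar> \<le> \<gamma> * B"
    unfolding V_def by (fact scaled_potential[OF r \<gamma>])+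
  define D where "D = gibbs_divergence V r"
  have D: "D \<le> 2 * B * \<gamma> * t" if t: "0 < t" "t \<le> 1" for t
  proof -
    obtain q where "q \<in> densities" "energy \<gamma> q \<le> energy \<gamma> r - t / \<gamma> * D + 2 * B * t\<^sup>2"
      using gibbs_step[OF r \<gamma>, of t] t by (auto simp: V_def D_def)
    with min[of q] have "t / \<gamma> * D \<le> 2 * B * t\<^sup>2" by linarith
    hence "t * D \<le> t * (2 * B * \<gamma> * t)" using \<gamma> by (simp add: field_simps power2_eq_square)
    thus ?thesis using t by simp
  qed
  have *: "D \<le> 2 * B * \<gamma> * (1 / real (Suc n))" for n
    by (rule D) auto
  have "D \<le> 2 * B * \<gamma> * 0"
    by (rule LIMSEQ_le_const[OF tendsto_mult_left[OF lim_1_over_n[THEN LIMSEQ_Suc]]]) (use * in auto)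
  hence "(LINT x|U. \<bar>r x - gibbs V x\<bar>)\<^sup>2 \<le> 0"
    using pinsker_gibbs[OF V r] unfolding D_def by linarith
  hence 0: "(LINT x|U. \<bar>r x - gibbs V x\<bar>) = 0" by simp
  have "integrable U (\<lambda>x. \<bar>r x - gibbs V x\<bar>)"
    using densitiesD(3)[OF r] densitiesD(3)[OF gibbs_density[OF V]] by simp
  from integral_nonneg_eq_0_iff_AE[OF this] 0 have "AE x in U. \<bar>r x - gibbs V x\<bar> = 0" by simp
  thus ?thesis unfolding V_def by eventually_elim simp
qed

text \<open>
  Let \<open>\<rho> j\<close> have energy within \<open>1/(j+1)\<^sup>2\<close> of the infimum. By \<open>gibbs_step\<close> its relative
  entropy with respect to its Gibbs density is \<open>O(1/j)\<close>. The potentials converge uniformly along a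
  subsequence, so the relative entropy with respect to the Gibbs density \<open>g\<close> of the limit potential
  also tends to zero, and \<open>\<rho> j\<close> tends to \<open>g\<close> in \<open>L\<^sup>1\<close>. Lower semicontinuity of the energy at \<open>g\<close> holds
  because \<open>ln g\<close> is bounded.
\<close>

theorem minimizer_exists:
  assumes \<gamma>: "0 < \<gamma>"
  obtains g where "g \<in> densities" "\<And>r. r \<in> densities \<Longrightarrow> energy \<gamma> g \<le> energy \<gamma> r"
proof -
  define X where "X = energy \<gamma> ` densities"
  define I where "I = Inf X"
  have lower: "- B / 2 \<le> energy \<gamma> r" if "r \<in> densities" for r
  proof -
    note R = densitiesD[OF that]
    have "- B \<le> pairing r r" using pairing_bound[OF R(3) R(3)] R(6) by simp
    moreover have "0 \<le> boltzmann_entropy r / \<gamma>" using entropy_nonneg[OF that] \<gamma> by simp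
    ultimately show ?thesis by (simp add: energy_def)
  qed
  have X: "X \<noteq> {}" "bdd_below X" unfolding X_def using const_one_density lower by (auto intro!: bdd_belowI)
  have I: "I \<le> energy \<gamma> r" if "r \<in> densities" for r
    unfolding I_def by (rule cInf_lower[OF _ X(2)]) (use that in \<open>auto simp: X_def\<close>)
  have "\<exists>r\<in>densities. energy \<gamma> r < I + (1 / real (Suc j))\<^sup>2" for j
    using cInf_lessD[OF X(1), of "I + (1 / real (Suc j))\<^sup>2"] by (auto simp: I_def X_def)
  then obtain \<rho> where \<rho>: "\<And>j. \<rho> j \<in> densities" "\<And>j. energy \<gamma> (\<rho> j) < I + (1 / real (Suc j))\<^sup>2" by metis
  define W where "W j = (\<lambda>x. \<gamma> * potential (\<rho> j) x)" for j
  have WV: "W j \<in> borel_measurable U" "x \<in> S \<Longrightarrow> \<bar>W j x\<bar> \<le> \<gamma> * B" for j x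
    using scaled_potential[OF \<rho>(1)[of j] \<gamma>] by (auto simp: W_def)
  have KL: "gibbs_divergence (W j) (\<rho> j) \<le> \<gamma> * (1 + 2 * B) / real (Suc j)" for j
  proof -
    define t where "t = 1 / real (Suc j)"
    have t: "0 < t" "t \<le> 1" by (auto simp: t_def)
    obtain q where "q \<in> densities"
      "energy \<gamma> q \<le> energy \<gamma> (\<rho> j) - t / \<gamma> * gibbs_divergence (W j) (\<rho> j) + 2 * B * t\<^sup>2"
      using gibbs_step[OF \<rho>(1)[of j] \<gamma>, of t] t by (auto simp: W_def)
    with I[of q] \<rho>(2)[of j] have "t / \<gamma> * gibbs_divergence (W j) (\<rho> j) \<le> (1 + 2 * B) * t\<^sup>2"
      unfolding t_def[symmetric] by (simp add: algebra_simps)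
    hence "t * gibbs_divergence (W j) (\<rho> j) \<le> t * (\<gamma> * (1 + 2 * B) * t)"
      using \<gamma> by (simp add: field_simps power2_eq_square)
    hence "gibbs_divergence (W j) (\<rho> j) \<le> \<gamma> * (1 + 2 * B) * t" using t(1) by (rule mult_left_le_imp_le)
    thus ?thesis by (simp add: t_def)
  qed
  obtain V0 k where V0: "continuous_on S V0" "strict_mono (k :: nat \<Rightarrow> nat)"
    "\<And>e. 0 < e \<Longrightarrow> \<exists>N. \<forall>n x. n \<ge> N \<and> x \<in> S \<longrightarrow> norm (potential (\<rho> (k n)) x - V0 x) < e"
  proof (rule Arzela_Ascoli[OF compact_S, of "\<lambda>j. potential (\<rho> j)" B])
    show "norm (potential (\<rho> n) x) \<le> B" if "x \<in> S" for n x
      using potential_density_bound[OF \<rho>(1) that] by simp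
    show "\<exists>d>0. \<forall>n y. y \<in> S \<and> norm (x - y) < d \<longrightarrow> norm (potential (\<rho> n) x - potential (\<rho> n) y) < e"
      if "x \<in> S" "0 < e" for x e
    proof -
      from potential_equicontinuous[of "e / 2"] \<open>0 < e\<close> obtain d where d: "0 < d"
        "\<And>f x y. integrable U f \<Longrightarrow> x \<in> S \<Longrightarrow> y \<in> S \<Longrightarrow> norm (x - y) < d \<Longrightarrow>
         \<bar>potential f x - potential f y\<bar> \<le> e / 2 * (LINT y|U. \<bar>f y\<bar>)" by (metis half_gt_zero)
      have "norm (potential (\<rho> n) x - potential (\<rho> n) y) < e" if "y \<in> S" "norm (x - y) < d" for n y
        using d(2)[OF densitiesD(3)[OF \<rho>(1)[of n]] \<open>x \<in> S\<close> that] densitiesD(6)[OF \<rho>(1)[of n]] \<open>0 < e\<close> by simp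
      with d(1) show ?thesis by blast
    qed
  qed (rule that)
  define V where "V = (\<lambda>x. \<gamma> * V0 x)"
  have "compact (V ` S)" using V0(1) compact_S unfolding V_def
    by (intro compact_continuous_image continuous_intros)
  then obtain C where C0: "\<And>x. x \<in> S \<Longrightarrow> \<bar>V x\<bar> \<le> C" using compact_imp_bounded bounded_iff by (metis imageI real_norm_def)
  have Vm: "V \<in> borel_measurable U" unfolding V_def using V0(1)
    by (intro continuous_measurable continuous_intros)
  note V = Vm C0
  have C: "0 \<le> C" using S_nonempty C0 by (meson abs_ge_zero equals0I order_trans)
  define g where "g = gibbs V"
  have gd: "g \<in> densities" unfolding g_def by (rule gibbs_density[OF V])
  note G = densitiesD[OF gd]
  have approx: "\<exists>r\<in>densities. energy \<gamma> r \<le> I + e \<and> (LINT x|U. \<bar>r x - g x\<bar>) \<le> e" if e: "0 < e" for e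
  proof -
    \<comment> \<open>by \<open>pinsker_gibbs\<close>, relative entropy at most \<open>\<eta>\<close> means distance at most \<open>e\<close>\<close>
    define \<eta> where "\<eta> = e\<^sup>2 / 4"
    have \<eta>: "0 < \<eta>" using e by (simp add: \<eta>_def)
    obtain N1 where N1: "\<And>n x. n \<ge> N1 \<Longrightarrow> x \<in> S \<Longrightarrow> \<bar>potential (\<rho> (k n)) x - V0 x\<bar> < \<eta> / (4 * \<gamma>)"
      using V0(3)[of "\<eta> / (4 * \<gamma>)"] \<eta> \<gamma> by auto
    have "(\<lambda>n. \<gamma> * (1 + 2 * B) * (1 / real (Suc n))) \<longlonglongrightarrow> \<gamma> * (1 + 2 * B) * 0"
      by (intro tendsto_mult_left lim_1_over_n[THEN LIMSEQ_Suc])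
    hence "eventually (\<lambda>n. \<gamma> * (1 + 2 * B) * (1 / real (Suc n)) < \<eta> / 2) sequentially"
      using \<eta> by (intro order_tendstoD(2)[of _ 0]) auto
    moreover have "(\<lambda>n. (1 / real (Suc n)) * (1 / real (Suc n))) \<longlonglongrightarrow> 0 * 0"
      by (intro tendsto_mult lim_1_over_n[THEN LIMSEQ_Suc])
    hence "eventually (\<lambda>n. (1 / real (Suc n)) * (1 / real (Suc n)) < e) sequentially"
      using e by (intro order_tendstoD(2)[of _ 0]) auto
    ultimately have "eventually (\<lambda>n. \<gamma> * (1 + 2 * B) * (1 / real (Suc n)) < \<eta> / 2 \<and> 
        (1 / real (Suc n)) * (1 / real (Suc n)) < e \<and> N1 \<le> n) sequentially"
      using eventually_ge_at_top[of N1] by eventually_elim auto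
    then obtain n where n: "\<gamma> * (1 + 2 * B) * (1 / real (Suc n)) < \<eta> / 2"
        "(1 / real (Suc n)) * (1 / real (Suc n)) < e" "N1 \<le> n"
      using eventually_happens'[OF sequentially_bot] by blast
    define r where "r = \<rho> (k n)"
    define Vn where "Vn = W (k n)"
    have kn: "1 / real (Suc (k n)) \<le> 1 / real (Suc n)"
      using seq_suble[OF V0(2), of n] by (simp add: frac_le)
    have rd: "r \<in> densities" by (simp add: r_def \<rho>)
    note R = densitiesD[OF rd]
    have "energy \<gamma> r \<le> I + (1 / real (Suc (k n)))\<^sup>2" using \<rho>(2)[of "k n"] by (simp add: r_def)
    also have "(1 / real (Suc (k n)))\<^sup>2 \<le> (1 / real (Suc n))\<^sup>2" by (rule power_mono[OF kn]) simp
    also have "\<dots> \<le> e" using n(2) by (simp add: power2_eq_square)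
    finally have E: "energy \<gamma> r \<le> I + e" by simp
    have Vn: "Vn \<in> borel_measurable U" "\<And>x. x \<in> S \<Longrightarrow> \<bar>Vn x\<bar> \<le> \<gamma> * B"
      using WV by (auto simp: Vn_def)
    have close: "\<bar>Vn x - V x\<bar> \<le> \<eta> / 4" if "x \<in> S" for x
    proof -
      have "\<bar>Vn x - V x\<bar> = \<gamma> * \<bar>potential (\<rho> (k n)) x - V0 x\<bar>"
        using \<gamma> by (simp add: Vn_def V_def W_def abs_mult flip: right_diff_distrib)
      also have "\<dots> \<le> \<gamma> * (\<eta> / (4 * \<gamma>))" using N1[OF n(3) that] \<gamma> by (intro mult_left_mono) auto
      finally show ?thesis using \<gamma> by simp
    qed
    have rV: "integrable U (\<lambda>x. r x * V x)" "integrable U (\<lambda>x. r x * Vn x)"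
      by (rule mult_bounded_integrable[OF R(3) V], assumption)
         (rule mult_bounded_integrable[OF R(3) Vn], assumption)
    have "(LINT x|U. r x * V x) \<le> (LINT x|U. r x * Vn x + \<eta> / 4 * r x)"
    proof (rule integral_mono_AE)
      show "AE x in U. r x * V x \<le> r x * Vn x + \<eta> / 4 * r x"
        using R(2) AE_space
      proof eventually_elim
        case (elim x)
        have "r x * V x \<le> r x * (Vn x + \<eta> / 4)"
          using elim abs_le_D2[OF close[of x]] by (intro mult_left_mono) (auto simp: space_U)
        thus ?case by (simp add: algebra_simps)
      qed
    qed (use rV R in auto)
    hence 1: "(LINT x|U. r x * V x) \<le> (LINT x|U. r x * Vn x) + \<eta> / 4" using rV R by simp
    have "partition V \<le> (LINT x|U. exp (\<eta> / 4) * exp (- Vn x))" unfolding partition_def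
    proof (rule integral_mono)
      show "exp (- V x) \<le> exp (\<eta> / 4) * exp (- Vn x)" if "x \<in> space U" for x
        using abs_le_D1[OF close[of x]] that by (auto simp: space_U simp flip: exp_add)
    qed (use exp_potential_integrable[OF V] exp_potential_integrable[OF Vn] in auto)
    hence "partition V \<le> exp (\<eta> / 4) * partition Vn" by (simp add: partition_def)
    moreover have Z: "0 < partition V" "0 < partition Vn"
      by (rule partition_pos[OF V], assumption) (rule partition_pos[OF Vn], assumption)
    ultimately have "ln (partition V) \<le> ln (exp (\<eta> / 4) * partition Vn)"
      by (subst ln_le_cancel_iff) auto
    hence 2: "ln (partition V) \<le> \<eta> / 4 + ln (partition Vn)" using Z by (simp add: ln_mult)
    have "gibbs_divergence V r \<le> gibbs_divergence Vn r + \<eta> / 2"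
      using 1 2 by (simp add: gibbs_divergence_def)
    also have "gibbs_divergence Vn r \<le> \<gamma> * (1 + 2 * B) * (1 / real (Suc (k n)))"
      using KL[of "k n"] by (simp add: Vn_def r_def)
    also have "\<dots> \<le> \<gamma> * (1 + 2 * B) * (1 / real (Suc n))"
      using kn \<gamma> B_nonneg by (intro mult_left_mono) auto
    finally have "gibbs_divergence V r \<le> \<eta>" using n(1) by linarith
    moreover have "(LINT x|U. \<bar>r x - g x\<bar>)\<^sup>2 \<le> 4 * gibbs_divergence V r"
      unfolding g_def by (rule pinsker_gibbs[OF V rd])
    ultimately have "(LINT x|U. \<bar>r x - g x\<bar>)\<^sup>2 \<le> e\<^sup>2" by (simp add: \<eta>_def)
    hence "(LINT x|U. \<bar>r x - g x\<bar>) \<le> e" using e by (simp add: abs_le_square_iff[symmetric])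
    with E rd show ?thesis by blast
  qed
  have compare: "energy \<gamma> g \<le> energy \<gamma> r + (C / \<gamma> + B) * (LINT x|U. \<bar>r x - g x\<bar>)" if rd: "r \<in> densities" for r
  proof -
    note R = densitiesD[OF rd]
    define d where "d = (\<lambda>x. r x - g x)"
    have id: "integrable U d" using R G by (simp add: d_def)
    have i: "integrable U (\<lambda>x. r x * V x)" "integrable U (\<lambda>x. g x * V x)"  "integrable U (\<lambda>x. d x * V x)"
      using mult_bounded_integrable[OF _ V] R G id by auto
    have "(LINT x|U. d x * V x) \<le> (LINT x|U. \<bar>d x\<bar> * C)"
    proof (rule integral_mono)
      fix x assume "x \<in> space U"
      hence "\<bar>d x * V x\<bar> \<le> \<bar>d x\<bar> * C" using C0[of x] by (auto simp: space_U abs_mult intro!: mult_left_mono)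
      thus "d x * V x \<le> \<bar>d x\<bar> * C" by linarith
    qed (use i id in auto)
    also have "(LINT x|U. d x * V x) = (LINT x|U. r x * V x) - (LINT x|U. g x * V x)"
      using i by (simp add: d_def left_diff_distrib)
    finally have dV: "(LINT x|U. r x * V x) - (LINT x|U. g x * V x) \<le> C * (LINT x|U. \<bar>d x\<bar>)" by (simp add: mult.commute)
    have "0 \<le> gibbs_divergence V r" by (rule gibbs_divergence_nonneg[OF V rd])
    hence "boltzmann_entropy g \<le> boltzmann_entropy r + C * (LINT x|U. \<bar>d x\<bar>)"
      using entropy_gibbs[OF V] dV by (simp add: gibbs_divergence_def g_def)
    hence 1: "boltzmann_entropy g / \<gamma> \<le> boltzmann_entropy r / \<gamma> + C / \<gamma> * (LINT x|U. \<bar>d x\<bar>)"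
      using \<gamma> by (simp add: field_simps)
    have rg: "r = (\<lambda>x. g x + d x)" by (auto simp: d_def)
    have "pairing r r = pairing g r + pairing d r"
      by (subst (1) rg) (rule pairing_add_left[OF G(3) id R(3)])
    also have "pairing g r = pairing g g + pairing g d"
      by (subst rg) (rule pairing_add_right[OF G(3) id G(3)])
    finally have "pairing g g = pairing r r - pairing g d - pairing d r" by simp
    moreover have "\<bar>pairing g d\<bar> \<le> B * (LINT x|U. \<bar>d x\<bar>)" "\<bar>pairing d r\<bar> \<le> B * (LINT x|U. \<bar>d x\<bar>)"
      using pairing_bound[OF G(3) id] pairing_bound[OF id R(3)] G(6) R(6) by auto
    ultimately have "pairing g g / 2 \<le> pairing r r / 2 + B * (LINT x|U. \<bar>d x\<bar>)" by linarith
    with 1 show ?thesis unfolding energy_def d_def by (simp add: algebra_simps)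
  qed
  have "energy \<gamma> g \<le> I"
  proof (rule field_le_epsilon)
    fix e :: real assume e: "0 < e"
    define A where "A = 1 + (C / \<gamma> + B)"
    have A: "1 \<le> A" using C \<gamma> B_nonneg by (simp add: A_def)
    obtain r where r: "r \<in> densities" "energy \<gamma> r \<le> I + e / A" "(LINT x|U. \<bar>r x - g x\<bar>) \<le> e / A"
      using approx[of "e / A"] e A by auto
    have "energy \<gamma> g \<le> energy \<gamma> r + (C / \<gamma> + B) * (LINT x|U. \<bar>r x - g x\<bar>)" by (rule compare[OF r(1)])
    also have "\<dots> \<le> (I + e / A) + (C / \<gamma> + B) * (e / A)"
      using r C \<gamma> B_nonneg by (intro add_mono mult_left_mono) auto
    also have "\<dots> = I + A * (e / A)" by (simp only: A_def distrib_right mult_1 add.assoc)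
    finally show "energy \<gamma> g \<le> I + e" using A by simp
  qed
  with I have "energy \<gamma> g \<le> energy \<gamma> r" if "r \<in> densities" for r using that by (meson order_trans)
  thus thesis using that gd by blast
qed

end

section \<open>The critical parameter\<close>

context compact_interaction
begin

abbreviation excess :: "('a \<Rightarrow> real) \<Rightarrow> real" where
  "excess r \<equiv> pairing (\<lambda>x. r x - 1) (\<lambda>x. r x - 1)"

lemma potential_one: "x \<in> S \<Longrightarrow> potential (\<lambda>_. 1) x = \<kappa>"
  unfolding potential_def using K_marginal by simp

lemma pairing_one: "integrable U d \<Longrightarrow> pairing d (\<lambda>_. 1) = \<kappa> * (LINT x|U. d x)"
proof -
  have "pairing d (\<lambda>_. 1) = (LINT x|U. \<kappa> * d x)" unfolding pairing_def
    by (rule Bochner_Integration.integral_cong) (auto simp: space_U potential_one)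
  thus ?thesis by simp
qed

text \<open>
  The linear term of the pairing at the uniform density vanishes because that density
  has constant potential.
\<close>

lemma energy_decomposition:
  assumes "r \<in> densities" "0 < \<gamma>"
  shows "energy \<gamma> r = energy \<gamma> (\<lambda>_. 1) + boltzmann_entropy r / \<gamma> + excess r / 2"
proof -
  note R = densitiesD[OF assms(1)]
  define d where "d = (\<lambda>x. r x - 1)"
  have id: "integrable U d" using R by (simp add: d_def)
  have d0: "(LINT x|U. d x) = 0" using R by (simp add: d_def prob_space)
  have "r = (\<lambda>x. 1 + 1 * d x)" by (auto simp: d_def)
  hence "pairing r r = pairing (\<lambda>_. 1) (\<lambda>_. 1) + 2 * 1 * pairing d (\<lambda>_. 1) + 1\<^sup>2 * pairing d d"
    using pairing_expand[OF _ id, of "\<lambda>_. 1" 1] by simp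
  thus ?thesis using pairing_one[OF id] d0
    by (simp add: energy_def boltzmann_entropy_def d_def add_divide_distrib)
qed

lemma excess_bound:
  assumes "r \<in> densities" shows "\<bar>excess r\<bar> \<le> 4 * B * boltzmann_entropy r"
proof -
  note R = densitiesD[OF assms]
  have "\<bar>excess r\<bar> \<le> B * (LINT x|U. \<bar>r x - 1\<bar>) * (LINT x|U. \<bar>r x - 1\<bar>)"
    using R by (intro pairing_bound) auto
  also have "\<dots> = B * (LINT x|U. \<bar>r x - 1\<bar>)\<^sup>2" by (simp add: power2_eq_square)
  also have "\<dots> \<le> B * (4 * boltzmann_entropy r)" using pinsker_uniform[OF assms] B_nonneg by (intro mult_left_mono)
  finally show ?thesis by simp
qed

lemma entropy_zero_imp_uniform:
  assumes "r \<in> densities" "boltzmann_entropy r \<le> 0" shows "AE x in U. r x = 1"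
proof -
  have "(LINT x|U. \<bar>r x - 1\<bar>)\<^sup>2 \<le> 0" using pinsker_uniform[OF assms(1)] assms(2) by linarith
  hence 0: "(LINT x|U. \<bar>r x - 1\<bar>) = 0" by simp
  have "integrable U (\<lambda>x. \<bar>r x - 1\<bar>)" using densitiesD(3)[OF assms(1)] by simp
  from integral_nonneg_eq_0_iff_AE[OF this] 0 have "AE x in U. \<bar>r x - 1\<bar> = 0" by simp
  thus ?thesis by eventually_elim simp
qed

text \<open>
  The quotient whose infimum is taken compares the two terms of
  \<open>energy_decomposition\<close>. The witness shows that it is taken over a nonempty set and is smaller than \<open>g\<close>, and
  \<open>excess_bound\<close> makes it positive.
\<close>

theorem critical_parameter:
  assumes g: "0 < g" and witness: "r0 \<in> densities" "boltzmann_entropy r0 + g / 2 * excess r0 < 0"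
  obtains \<gamma>c where "0 < \<gamma>c" "\<gamma>c < g"
    "\<And>\<gamma> r. 0 < \<gamma> \<Longrightarrow> \<gamma> < \<gamma>c \<Longrightarrow> r \<in> densities \<Longrightarrow> energy \<gamma> r \<le> energy \<gamma> (\<lambda>_. 1) \<Longrightarrow> AE x in U. r x = 1"
    "\<And>\<gamma> r. 0 < \<gamma> \<Longrightarrow> \<gamma> \<le> \<gamma>c \<Longrightarrow> r \<in> densities \<Longrightarrow> energy \<gamma> (\<lambda>_. 1) \<le> energy \<gamma> r"
    "\<And>\<gamma>. \<gamma>c < \<gamma> \<Longrightarrow> \<exists>r\<in>densities. energy \<gamma> r < energy \<gamma> (\<lambda>_. 1)"
proof -
  define X where "X = (\<lambda>r. 2 * boltzmann_entropy r / (- excess r)) ` {r \<in> densities. excess r < 0}"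
  define \<gamma>c where "\<gamma>c = Inf X"
  have lower: "1 / (2 * (B + 1)) \<le> x" if xX: "x \<in> X" for x
  proof -
    obtain r where r: "r \<in> densities" "excess r < 0" "x = 2 * boltzmann_entropy r / (- excess r)"
      using xX unfolding X_def by blast
    have "- excess r \<le> 4 * B * boltzmann_entropy r" using excess_bound[OF r(1)] by linarith
    also have "\<dots> \<le> 4 * (B + 1) * boltzmann_entropy r" using entropy_nonneg[OF r(1)] by (intro mult_right_mono) auto
    finally have "1 / (2 * (B + 1)) * (- excess r) \<le> 1 / (2 * (B + 1)) * (4 * (B + 1) * boltzmann_entropy r)"
      using B_nonneg by (intro mult_left_mono) auto
    also have "\<dots> = 2 * boltzmann_entropy r"
    proof -
      have "B + 1 \<noteq> 0" using B_nonneg by simp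
      thus ?thesis by (simp add: divide_simps)
    qed
    finally show ?thesis unfolding r(3) using r(2) by (subst pos_le_divide_eq) auto
  qed
  have bdd: "bdd_below X" using lower by (intro bdd_belowI)
  have r0: "excess r0 < 0"
  proof (rule ccontr)
    assume "\<not> excess r0 < 0"
    hence "0 \<le> g / 2 * excess r0" using g by simp
    with witness(2) entropy_nonneg[OF witness(1)] show False by linarith
  qed
  hence ne: "X \<noteq> {}" using witness(1) by (auto simp: X_def)
  have pos: "0 < \<gamma>c"
  proof -
    have "1 / (2 * (B + 1)) \<le> \<gamma>c" unfolding \<gamma>c_def by (rule cInf_greatest[OF ne lower])
    thus ?thesis using B_nonneg by (smt (verit) divide_pos_pos)
  qed
  have le: "\<gamma>c * (- excess r) \<le> 2 * boltzmann_entropy r" if "r \<in> densities" "excess r < 0" for r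
  proof -
    have "\<gamma>c \<le> 2 * boltzmann_entropy r / (- excess r)"
      unfolding \<gamma>c_def by (rule cInf_lower[OF _ bdd]) (use that in \<open>auto simp: X_def\<close>)
    thus ?thesis using that by (simp add: field_simps)
  qed
  have "\<gamma>c \<le> 2 * boltzmann_entropy r0 / (- excess r0)"
    unfolding \<gamma>c_def by (rule cInf_lower[OF _ bdd]) (use witness r0 in \<open>auto simp: X_def\<close>)
  also have "\<dots> < g" using witness(2) r0 by (simp add: field_simps)
  finally have less: "\<gamma>c < g" .
  have above: "energy \<gamma> (\<lambda>_. 1) \<le> energy \<gamma> r" if \<gamma>: "0 < \<gamma>" "\<gamma> \<le> \<gamma>c" and r: "r \<in> densities" for \<gamma> r
  proof -
    have "0 \<le> boltzmann_entropy r / \<gamma> + excess r / 2"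
    proof (cases "excess r < 0")
      case True
      have "\<gamma> * (- excess r) \<le> \<gamma>c * (- excess r)" using \<gamma> True by (intro mult_right_mono) auto
      also have "\<dots> \<le> 2 * boltzmann_entropy r" by (rule le[OF r True])
      finally show ?thesis using \<gamma> by (simp add: field_simps)
    next
      case False
      thus ?thesis using entropy_nonneg[OF r] \<gamma> by simp
    qed
    thus ?thesis using energy_decomposition[OF r \<gamma>(1)] by simp
  qed
  have uniq: "AE x in U. r x = 1"
    if \<gamma>: "0 < \<gamma>" "\<gamma> < \<gamma>c" and r: "r \<in> densities" and E: "energy \<gamma> r \<le> energy \<gamma> (\<lambda>_. 1)" for \<gamma> r
  proof (rule entropy_zero_imp_uniform[OF r])
    have E': "boltzmann_entropy r / \<gamma> + excess r / 2 \<le> 0" using E energy_decomposition[OF r \<gamma>(1)] by simp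
    show "boltzmann_entropy r \<le> 0"
    proof (cases "excess r < 0")
      case True
      have "\<gamma> * (- excess r) < \<gamma>c * (- excess r)" using \<gamma> True by (intro mult_strict_right_mono) auto
      also have "\<dots> \<le> 2 * boltzmann_entropy r" by (rule le[OF r True])
      finally have "0 < boltzmann_entropy r / \<gamma> + excess r / 2" using \<gamma> by (simp add: field_simps)
      with E' show ?thesis by simp
    next
      case False
      hence "boltzmann_entropy r / \<gamma> \<le> 0" using E' by simp
      thus ?thesis using \<gamma> by (simp add: divide_le_0_iff)
    qed
  qed
  have below: "\<exists>r\<in>densities. energy \<gamma> r < energy \<gamma> (\<lambda>_. 1)" if above: "\<gamma>c < \<gamma>" for \<gamma>
  proof -
    obtain x where x: "x \<in> X" "x < \<gamma>" using cInf_lessD[OF ne, of \<gamma>] above unfolding \<gamma>c_def by blast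
    from x(1) obtain r where r': "r \<in> densities" "excess r < 0" "x = 2 * boltzmann_entropy r / (- excess r)"
      unfolding X_def by blast
    note r = r'(1,2) x(2)[unfolded r'(3)]
    have "0 < \<gamma>" using pos above by simp
    have "boltzmann_entropy r / \<gamma> + excess r / 2 < 0" using r \<open>0 < \<gamma>\<close> by (simp add: field_simps)
    thus ?thesis using energy_decomposition[OF r(1) \<open>0 < \<gamma>\<close>] r(1) by (intro bexI[of _ r]) auto
  qed
  show thesis by (rule that[OF pos less uniq above below])
qed

lemma gibbs_shift: "gibbs (\<lambda>x. c + V x) = gibbs V"
proof -
  have "partition (\<lambda>x. c + V x) = exp (- c) * partition V"
  proof -
    have "exp (- (c + V x)) = exp (- c) * exp (- V x)" for x by (simp flip: exp_add)
    thus ?thesis by (simp add: partition_def)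
  qed
  thus ?thesis by (auto simp: gibbs_def exp_diff exp_minus field_simps)
qed

lemma energy_cong_AE:
  assumes "r \<in> densities" "q \<in> densities" "AE x in U. r x = q x"
  shows "energy \<gamma> r = energy \<gamma> q"
proof -
  note R = densitiesD[OF assms(1)] and Q = densitiesD[OF assms(2)]
  have [measurable]: "r \<in> borel_measurable U" "q \<in> borel_measurable U" using R Q by auto
  have "boltzmann_entropy r = boltzmann_entropy q" unfolding boltzmann_entropy_def
    by (rule integral_cong_AE) (use assms(3) in auto)
  moreover have pot: "potential r x = potential q x" if "x \<in> S" for x
    unfolding potential_def
    by (rule integral_cong_AE) (use assms(3) K_measurable[OF that] in auto)
  have "pairing r r = pairing q q" unfolding pairing_def
  proof (rule integral_cong_AE)
    show "AE x in U. r x * potential r x = q x * potential q x"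
      using assms(3) AE_space by eventually_elim (simp add: pot space_U)
  qed (use R Q potential_measurable in auto)
  ultimately show ?thesis by (simp add: energy_def)
qed

text \<open>
  A minimizer within \<open>\<eta>\<close> of 1 in \<open>L\<^sup>1\<close> has a nearly constant potential, so as a
  Gibbs density it lies below \<open>M\<close>, with \<open>M\<close> close to 1. Its entropy is then at least
  \<open>\<parallel>r - 1\<parallel>\<^sup>2 / (2 M)\<close>, while minimality and the spectral bound give at most \<open>a \<parallel>r - 1\<parallel>\<^sup>2 / 2\<close> with
  \<open>a = - \<gamma>1 v\<close>. The constant \<open>M\<close> is chosen between 1 and \<open>1 / a\<close>.
\<close>

theorem uniform_isolated_minimizer:
  assumes v: "v < 0"
    and spectral: "\<And>d F. d \<in> borel_measurable U \<Longrightarrow> (\<And>x. x \<in> S \<Longrightarrow> \<bar>d x\<bar> \<le> F) \<Longrightarrow> (LINT x|U. d x) = 0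
        \<Longrightarrow> v * (LINT x|U. (d x)\<^sup>2) \<le> pairing d d"
    and \<gamma>1: "0 < \<gamma>1" "\<gamma>1 * (- v) < 1"
  obtains \<eta> where "0 < \<eta>"
    "\<And>\<gamma> r. 0 < \<gamma> \<Longrightarrow> \<gamma> \<le> \<gamma>1 \<Longrightarrow> r \<in> densities \<Longrightarrow> (\<And>q. q \<in> densities \<Longrightarrow> energy \<gamma> r \<le> energy \<gamma> q) \<Longrightarrow>
        (LINT x|U. \<bar>r x - 1\<bar>) \<le> \<eta> \<Longrightarrow> AE x in U. r x = 1"
proof -
  define a where "a = \<gamma>1 * (- v)"
  have a: "0 < a" "a < 1" using \<gamma>1 v by (auto simp: a_def mult_pos_neg)
  \<comment> \<open>the midpoint between 1 and \<open>1 / a\<close>\<close>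
  define M where "M = (1 + 1 / a) / 2"
  have M: "1 < M" "a * M < 1" using a by (auto simp: M_def field_simps)
  \<comment> \<open>makes \<open>ln M / 2\<close> a bound for \<open>V\<close> below; \<open>B + 1\<close> avoids division by zero\<close>
  define \<eta> where "\<eta> = ln M / (2 * \<gamma>1 * (B + 1))"
  have \<eta>: "0 < \<eta>" using M \<gamma>1 B_nonneg by (auto simp: \<eta>_def)
  show thesis
  proof (rule that[OF \<eta>])
    fix \<gamma> r assume \<gamma>: "0 < \<gamma>" "\<gamma> \<le> \<gamma>1" and r: "r \<in> densities"
      and min: "\<And>q. q \<in> densities \<Longrightarrow> energy \<gamma> r \<le> energy \<gamma> q" and close: "(LINT x|U. \<bar>r x - 1\<bar>) \<le> \<eta>"
    note R = densitiesD[OF r]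
    define V where "V = (\<lambda>x. \<gamma> * potential (\<lambda>x. r x - 1) x)"
    define c where "c = ln M / 2"
    have Vm: "V \<in> borel_measurable U" unfolding V_def
      using potential_measurable[of "\<lambda>x. r x - 1"] R by simp
    have Vb: "\<bar>V x\<bar> \<le> c" if "x \<in> S" for x
    proof -
      have "\<bar>potential (\<lambda>x. r x - 1) x\<bar> \<le> B * (LINT y|U. \<bar>r y - 1\<bar>)"
        using R by (intro potential_bound that) auto
      also have "\<dots> \<le> (B + 1) * \<eta>" using close B_nonneg \<eta> by (intro mult_mono) auto
      finally have "\<bar>V x\<bar> \<le> \<gamma> * ((B + 1) * \<eta>)"
        using \<gamma> by (simp add: V_def abs_mult)
      also have "\<dots> \<le> \<gamma>1 * ((B + 1) * \<eta>)" using \<gamma> B_nonneg \<eta> by (intro mult_right_mono) auto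
      also have "\<dots> = c"
      proof -
        have "B + 1 \<noteq> 0" "\<gamma>1 \<noteq> 0" using \<gamma>1 B_nonneg by auto
        thus ?thesis unfolding \<eta>_def c_def by (simp add: divide_simps)
      qed
      finally show ?thesis .
    qed
    have "AE x in U. r x = gibbs (\<lambda>x. \<gamma> * potential r x) x" by (rule minimizer_is_gibbs[OF r \<gamma>(1) min])
    moreover have "gibbs (\<lambda>x. \<gamma> * potential r x) x = gibbs V x" if "x \<in> S" for x
    proof -
      have pot: "\<gamma> * potential r x = \<gamma> * \<kappa> + V x" if "x \<in> S" for x
      proof -
        have "potential r x = potential (\<lambda>y. 1 + (r y - 1)) x" by simp
        also have "\<dots> = \<kappa> + potential (\<lambda>y. r y - 1) x"
          using R potential_add[of "\<lambda>_. 1" "\<lambda>y. r y - 1" x] that by (simp add: potential_one)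
        finally show ?thesis by (simp add: V_def distrib_left)
      qed
      have "partition (\<lambda>x. \<gamma> * potential r x) = partition (\<lambda>x. \<gamma> * \<kappa> + V x)"
        unfolding partition_def by (rule Bochner_Integration.integral_cong) (auto simp: space_U pot)
      hence "gibbs (\<lambda>x. \<gamma> * potential r x) x = gibbs (\<lambda>x. \<gamma> * \<kappa> + V x) x"
        using that by (simp add: gibbs_def pot)
      thus ?thesis by (simp add: gibbs_shift)
    qed
    ultimately have rg: "AE x in U. r x = gibbs V x"
      using AE_space by (auto simp: space_U elim: eventually_elim2)
    define g where "g = gibbs V"
    have gd: "g \<in> densities" unfolding g_def by (rule gibbs_density[OF Vm Vb])
    note G = densitiesD[OF gd]
    have gb: "0 < g x" "g x \<le> M" if "x \<in> S" for x
    proof -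
      have "exp (2 * c) = M" using M by (simp add: c_def)
      thus "g x \<le> M" using gibbs_bounds(2)[OF Vm Vb that] by (simp add: g_def)
      show "0 < g x" using gibbs_bounds(1)[OF Vm Vb that] unfolding g_def by (meson exp_gt_zero less_le_trans)
    qed
    define d where "d = (\<lambda>x. g x - 1)"
    define N2 where "N2 = (LINT x|U. (d x)\<^sup>2)"
    have dm[measurable]: "d \<in> borel_measurable U" using G by (simp add: d_def)
    have db: "\<bar>d x\<bar> \<le> M" if "x \<in> S" for x using gb[OF that] M by (auto simp: d_def)
    have d0: "(LINT x|U. d x) = 0" using G by (simp add: d_def prob_space)
    have id2: "integrable U (\<lambda>x. (d x)\<^sup>2)"
    proof (rule bounded_integrable)
      show "\<bar>(d x)\<^sup>2\<bar> \<le> M\<^sup>2" if "x \<in> S" for x using db[OF that] M by (simp add: abs_le_square_iff[symmetric])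
    qed measurable
    have "energy \<gamma> g \<le> energy \<gamma> (\<lambda>_. 1)"
      using min[OF const_one_density] energy_cong_AE[OF r gd] rg by (simp add: g_def)
    hence "boltzmann_entropy g / \<gamma> + pairing d d / 2 \<le> 0"
      using energy_decomposition[OF gd \<gamma>(1)] by (simp add: d_def)
    hence 1: "boltzmann_entropy g \<le> \<gamma> * (- pairing d d) / 2" using \<gamma> by (simp add: field_simps)
    have "- pairing d d \<le> - v * N2" using spectral[OF dm db d0] by (simp add: N2_def)
    hence "\<gamma> * (- pairing d d) \<le> \<gamma> * (- v * N2)" using \<gamma> by (intro mult_left_mono) auto
    also have "\<dots> \<le> \<gamma>1 * (- v * N2)"
      using \<gamma> v by (intro mult_right_mono mult_nonneg_nonneg) (auto simp: N2_def)
    finally have "\<gamma> * (- pairing d d) \<le> \<gamma>1 * (- v * N2)" .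
    hence 2: "boltzmann_entropy g \<le> a * N2 / 2" using 1 by (simp add: a_def)
    have "(LINT x|U. d x + (d x)\<^sup>2 / (2 * M)) \<le> boltzmann_entropy g" unfolding boltzmann_entropy_def
    proof (rule integral_mono)
      show "d x + (d x)\<^sup>2 / (2 * M) \<le> g x * ln (g x)" if "x \<in> space U" for x
        using xlnx_quadratic_lower[of "g x" M] gb[of x] M that by (simp add: d_def space_U)
    qed (use G id2 in \<open>auto simp: d_def\<close>)
    hence 3: "N2 / (2 * M) \<le> boltzmann_entropy g" using G id2 d0 by (simp add: N2_def d_def)
    have "N2 / (2 * M) \<le> a * N2 / 2" using 2 3 by simp
    hence "N2 \<le> (a * M) * N2" using M by (simp add: field_simps)
    moreover have "0 \<le> N2" by (simp add: N2_def)
    ultimately have "N2 = 0" using M(2) by (smt (verit) mult_less_cancel_right2)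
    hence "AE x in U. (d x)\<^sup>2 = 0" using integral_nonneg_eq_0_iff_AE[OF id2] by (simp add: N2_def)
    with rg show "AE x in U. r x = 1" by eventually_elim (simp add: d_def g_def)
  qed
qed

text \<open>
  The test density is \<open>1 + e u\<close> with \<open>e = m3 / 4\<close>. Its entropy exceeds the quadratic
  part \<open>e\<^sup>2 N / 2\<close> by at most \<open>- e\<^sup>3 m3 / 6 + e\<^sup>4 / 3\<close>, which equals \<open>- e\<^sup>2 m3\<^sup>2 / 48\<close>, and the loss from the
  bandwidth is at most \<open>e\<^sup>2 \<delta> / 2 < e\<^sup>2 m3\<^sup>2 / 98\<close>.
\<close>

theorem cubic_resonance_witness:
  assumes u: "u \<in> borel_measurable U" "\<And>x. x \<in> S \<Longrightarrow> \<bar>u x\<bar> \<le> 1" "(LINT x|U. u x) = 0"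
    and m3: "(LINT x|U. u x ^ 3) = m3" "m3 \<noteq> 0"
    and g: "0 < g" and \<delta>: "0 \<le> \<delta>" "\<delta> < m3\<^sup>2 / 49"
    and neg: "g * pairing u u \<le> - (1 - \<delta>) * (LINT x|U. (u x)\<^sup>2)"
  obtains r where "r \<in> densities" "boltzmann_entropy r + g / 2 * excess r < 0"
proof -
  note u(1)[measurable]
  have pow: "\<bar>u x ^ k\<bar> \<le> 1" if "x \<in> S" for x k
    using power_le_one[OF abs_ge_zero u(2)[OF that]] by (simp add: power_abs)
  have ip: "integrable U (\<lambda>x. u x ^ k)" for k by (rule bounded_integrable[OF _ pow]) measurable
  define N where "N = (LINT x|U. (u x)\<^sup>2)"
  have N: "0 \<le> N" "N \<le> 1"
  proof -
    show "0 \<le> N" by (simp add: N_def)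
    have "N \<le> (LINT x|U. 1)" unfolding N_def
      by (rule integral_mono) (use ip[of 2] pow[of _ 2] in \<open>auto simp: space_U\<close>)
    thus "N \<le> 1" by (simp add: prob_space)
  qed
  have U4: "(LINT x|U. u x ^ 4) \<le> 1"
  proof -
    have "(LINT x|U. u x ^ 4) \<le> (LINT x|U. 1)"
      by (rule integral_mono) (use ip[of 4] pow[of _ 4] in \<open>auto simp: space_U\<close>)
    thus ?thesis by (simp add: prob_space)
  qed
  have m31: "\<bar>m3\<bar> \<le> 1"
  proof -
    have "\<bar>m3\<bar> \<le> (LINT x|U. 1)" unfolding m3(1)[symmetric]
      by (rule integral_abs_le(2)) (use ip[of 3] pow[of _ 3] in \<open>auto simp: space_U\<close>)
    thus ?thesis by (simp add: prob_space)
  qed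
  define e where "e = m3 / 4"
  have e: "\<bar>e\<bar> \<le> 1 / 4" "e \<noteq> 0" using m31 m3(2) by (auto simp: e_def)
  have eu: "\<bar>e * u x\<bar> \<le> 1 / 4" if "x \<in> S" for x
  proof -
    have "\<bar>e * u x\<bar> \<le> 1 / 4 * 1" unfolding abs_mult using e(1) u(2)[OF that] by (intro mult_mono) auto
    thus ?thesis by simp
  qed
  define r where "r = (\<lambda>x. 1 + e * u x)"
  have rd: "r \<in> densities"
  proof (rule bounded_density[of _ 2])
    show "0 < r x" "r x \<le> 2" if "x \<in> S" for x using eu[OF that] by (auto simp: r_def abs_le_iff)
    show "(LINT x|U. r x) = 1" using ip[of 1] u(3) by (simp add: r_def prob_space)
  qed (simp add: r_def)
  note R = densitiesD[OF rd]
  have "boltzmann_entropy r \<le> (LINT x|U. e * u x + e\<^sup>2 / 2 * (u x)\<^sup>2 - e ^ 3 / 6 * u x ^ 3 + e ^ 4 / 3 * u x ^ 4)"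
    unfolding boltzmann_entropy_def
  proof (rule integral_mono)
    fix x assume "x \<in> space U"
    hence x: "x \<in> S" by (simp add: space_U)
    define s where "s = e * u x"
    have s: "\<bar>s\<bar> \<le> 1 / 4" using eu[OF x] by (simp add: s_def)
    hence "ln (1 + s) \<le> s - s\<^sup>2 / 2 + s ^ 3 / 3" by (intro ln_cubic_upper) auto
    hence "(1 + s) * ln (1 + s) \<le> (1 + s) * (s - s\<^sup>2 / 2 + s ^ 3 / 3)"
      using s by (intro mult_left_mono) auto
    also have "\<dots> = s + s\<^sup>2 / 2 - s ^ 3 / 6 + s ^ 4 / 3"
      by (simp add: field_simps power2_eq_square power3_eq_cube power4_eq_xxxx)
    finally show "r x * ln (r x) \<le> e * u x + e\<^sup>2 / 2 * (u x)\<^sup>2 - e ^ 3 / 6 * u x ^ 3 + e ^ 4 / 3 * u x ^ 4"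
      by (simp add: r_def s_def power_mult_distrib)
  qed (use R ip[of 1] ip in auto)
  also have "\<dots> = e\<^sup>2 / 2 * N - e ^ 3 / 6 * m3 + e ^ 4 / 3 * (LINT x|U. u x ^ 4)"
    using ip[of 1] ip u(3) m3(1) by (simp add: N_def)
  also have "\<dots> \<le> e\<^sup>2 / 2 * N - e ^ 3 / 6 * m3 + e ^ 4 / 3 * 1"
    using U4 by (intro add_left_mono mult_left_mono) auto
  also have "\<dots> = e\<^sup>2 * (N / 2 - m3\<^sup>2 / 48)"
    by (simp add: e_def field_simps power2_eq_square power3_eq_cube power4_eq_xxxx)
  finally have ent: "boltzmann_entropy r \<le> e\<^sup>2 * (N / 2 - m3\<^sup>2 / 48)" .
  have "excess r = e\<^sup>2 * pairing u u"
    by (simp add: r_def pairing_scale_left pairing_scale_right power2_eq_square)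
  hence "g / 2 * excess r = e\<^sup>2 / 2 * (g * pairing u u)" by simp
  also have "\<dots> \<le> e\<^sup>2 / 2 * (- (1 - \<delta>) * N)" using neg by (intro mult_left_mono) (auto simp: N_def)
  finally have "boltzmann_entropy r + g / 2 * excess r \<le> e\<^sup>2 * (N / 2 - m3\<^sup>2 / 48) + e\<^sup>2 / 2 * (- (1 - \<delta>) * N)"
    using ent by linarith
  also have "\<dots> = e\<^sup>2 * (\<delta> * N / 2 - m3\<^sup>2 / 48)" by (simp add: field_simps)
  also have "\<dots> < 0"
  proof -
    have "\<delta> * N \<le> \<delta> * 1" using N \<delta> by (intro mult_left_mono) auto
    moreover have "0 \<le> m3\<^sup>2" by simp
    ultimately have "\<delta> * N / 2 - m3\<^sup>2 / 48 < 0" using \<delta>(2) by linarith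
    thus ?thesis using e(2) by (simp add: mult_pos_neg)
  qed
  finally show thesis using that rd by blast
qed

end

section \<open>Gegenbauer polynomials\<close>

text \<open>
  The polynomials \<open>gegenbauer l k\<close> as elements of \<open>real poly\<close>, so that degrees and coefficients are
  available.
\<close>

fun gegen_poly :: "real \<Rightarrow> nat \<Rightarrow> real poly" where
  "gegen_poly l 0 = 1"
| "gegen_poly l (Suc 0) = [:0, 2 * l:]"
| "gegen_poly l (Suc (Suc k)) = smult (1 / (real k + 2))
     (smult (2 * (l + real k + 1)) ([:0, 1:] * gegen_poly l (Suc k)) - smult (2 * l + real k) (gegen_poly l k))"

lemma poly_gegen_poly [simp]: "poly (gegen_poly l k) t = gegenbauer l k t"
  by (induction l k rule: gegen_poly.induct) (auto simp: algebra_simps add_divide_distrib diff_divide_distrib)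

lemma gegen_recurrence:
  "smult (real k + 2) (gegen_poly l (Suc (Suc k))) =
     smult (2 * (l + real k + 1)) ([:0, 1:] * gegen_poly l (Suc k)) - smult (2 * l + real k) (gegen_poly l k)"
  by (simp del: mult_pCons_left)

text \<open>
  Two classical relations between consecutive polynomials and their derivatives. They
  have to be proved together, since each step of the three-term recurrence uses both.
\<close>

lemma gegen_deriv_relations:
  defines "C \<equiv> \<lambda>l k t. poly (gegen_poly l k) t" and "D \<equiv> \<lambda>l k t. poly (pderiv (gegen_poly l k)) t"
  shows "D l (Suc k) t = t * D l k t + (2 * l + real k) * C l k t
     \<and> t * D l (Suc k) t - D l k t = (real k + 1) * C l (Suc k) t"
proof (induction k)
  case 0
  show ?case by (simp add: C_def D_def pderiv_pCons)
next
  case (Suc k)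
  let ?c = "C l (Suc k) t" and ?d = "D l (Suc k) t"
  have a: "?d = t * D l k t + (2 * l + real k) * C l k t"
    and b: "D l k t = t * ?d - (real k + 1) * ?c" using Suc by auto
  have "(real k + 2) * C l (Suc (Suc k)) t = poly (smult (real k + 2) (gegen_poly l (Suc (Suc k)))) t"
    by (simp only: C_def poly_smult)
  also have "\<dots> = 2 * (l + real k + 1) * t * ?c - (2 * l + real k) * C l k t"
    unfolding gegen_recurrence by (simp add: C_def del: poly_gegen_poly)
  finally have rC: "(real k + 2) * C l (Suc (Suc k)) t = 2 * (l + real k + 1) * t * ?c - (2 * l + real k) * C l k t" .
  have "(real k + 2) * D l (Suc (Suc k)) t = poly (pderiv (smult (real k + 2) (gegen_poly l (Suc (Suc k))))) t"
    by (simp only: D_def poly_smult pderiv_smult)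
  also have "\<dots> = 2 * (l + real k + 1) * (?c + t * ?d) - (2 * l + real k) * D l k t"
    unfolding gegen_recurrence
    by (simp add: C_def D_def pderiv_diff pderiv_smult pderiv_mult pderiv_pCons algebra_simps del: poly_gegen_poly)
  also have "\<dots> = (real k + 2) * (t * ?d + (2 * l + real (Suc k)) * ?c)"
    unfolding b by (simp add: algebra_simps)
  finally have A: "D l (Suc (Suc k)) t = t * ?d + (2 * l + real (Suc k)) * ?c"
    by (subst (asm) mult_left_cancel) auto
  have "t * (t * ?d) - ?d = (real k + 1) * t * ?c - (2 * l + real k) * C l k t"
    using a b by algebra
  hence "t * D l (Suc (Suc k)) t - ?d = 2 * (l + real k + 1) * t * ?c - (2 * l + real k) * C l k t"
    unfolding A by (simp add: algebra_simps)
  also have "\<dots> = (real (Suc k) + 1) * C l (Suc (Suc k)) t" using rC by (simp add: algebra_simps)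
  finally show ?case using A by simp
qed

lemma gegen_first_order:
  "[:1, 0, -1:] * pderiv (gegen_poly l k) =
     smult (2 * l + real k) ([:0, 1:] * gegen_poly l k) - smult (real k + 1) (gegen_poly l (Suc k))"
proof (rule poly_eq_poly_eq_iff[THEN iffD1], rule ext)
  fix t
  show "poly ([:1, 0, -1:] * pderiv (gegen_poly l k)) t =
     poly (smult (2 * l + real k) ([:0, 1:] * gegen_poly l k) - smult (real k + 1) (gegen_poly l (Suc k))) t"
    using gegen_deriv_relations[where l=l and k=k and t=t] by (simp del: poly_gegen_poly) algebra
qed

text \<open>
  Differentiating the first-order relation and eliminating the next polynomial yields the
  Gegenbauer differential equation; orthogonality comes from it.
\<close>

lemma gegen_ode:
  "[:1, 0, -1:] * pderiv (pderiv (gegen_poly l k)) - smult (2 * l + 1) ([:0, 1:] * pderiv (gegen_poly l k))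
     = smult (- (real k * (2 * l + real k))) (gegen_poly l k)"
proof (rule poly_eq_poly_eq_iff[THEN iffD1], rule ext)
  fix t
  have "pderiv ([:1, 0, -1:] * pderiv (gegen_poly l k))
      = [:1, 0, -1:] * pderiv (pderiv (gegen_poly l k)) + [:0, -2:] * pderiv (gegen_poly l k)"
    unfolding pderiv_mult by (simp add: pderiv_pCons)
  moreover have "poly (pderiv ([:1, 0, -1:] * pderiv (gegen_poly l k))) t =
    poly (pderiv (smult (2 * l + real k) ([:0, 1:] * gegen_poly l k) - smult (real k + 1) (gegen_poly l (Suc k)))) t"
    unfolding gegen_first_order ..
  ultimately have "poly ([:1, 0, -1:] * pderiv (pderiv (gegen_poly l k)) + [:0, -2:] * pderiv (gegen_poly l k)) t =
    poly (pderiv (smult (2 * l + real k) ([:0, 1:] * gegen_poly l k) - smult (real k + 1) (gegen_poly l (Suc k)))) t"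
    by simp
  thus "poly ([:1, 0, -1:] * pderiv (pderiv (gegen_poly l k)) - smult (2 * l + 1) ([:0, 1:] * pderiv (gegen_poly l k))) t
     = poly (smult (- (real k * (2 * l + real k))) (gegen_poly l k)) t"
    using gegen_deriv_relations[where l=l and k=k and t=t]
    by (simp add: pderiv_mult pderiv_diff pderiv_smult pderiv_pCons del: poly_gegen_poly) algebra
qed

lemma gegen_degree_lead:
  assumes "0 < l"
  shows "degree (gegen_poly l k) \<le> k \<and> 0 < coeff (gegen_poly l k) k"
proof (induction k rule: induct_nat_012)
  case (ge2 k)
  have "degree (gegen_poly l (Suc (Suc k))) \<le> Suc (Suc k)"
    using ge2 by (auto intro!: degree_smult_le[THEN order_trans] degree_diff_le degree_pCons_le[THEN order_trans])
  moreover have "coeff (gegen_poly l k) (Suc (Suc k)) = 0" using ge2 by (intro coeff_eq_0) auto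
  ultimately show ?case using ge2 assms by (auto simp: coeff_pCons)
qed (use assms in auto)

lemma gegenbauer_at_1_pos:
  assumes "0 < l" shows "0 < gegenbauer l k 1"
proof -
  have step: "(real k + 1) * gegenbauer l (Suc k) 1 = (2 * l + real k) * gegenbauer l k 1" for k
  proof (induction k)
    case (Suc k)
    have "(real k + 2) * gegenbauer l (Suc (Suc k)) 1
        = 2 * (l + real k + 1) * gegenbauer l (Suc k) 1 - (2 * l + real k) * gegenbauer l k 1" by simp
    with Suc show ?case by (simp add: algebra_simps del: gegenbauer.simps)
  qed simp
  show ?thesis
  proof (induction k)
    case (Suc k)
    have "0 < (real k + 1) * gegenbauer l (Suc k) 1" unfolding step using Suc assms by simp
    thus ?case by (simp add: zero_less_mult_iff del: gegenbauer.simps)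
  qed simp
qed

lemma gegen_basis:
  assumes l: "0 < l" and "degree P \<le> k"
  shows "\<exists>a. P = (\<Sum>i\<le>k. smult (a i) (gegen_poly l i))"
  using assms(2)
proof (induction k arbitrary: P)
  case 0
  then obtain c where "P = [:c:]" using degree_eq_zeroE by (metis le_zero_eq)
  thus ?case by (intro exI[of _ "\<lambda>_. c"]) simp
next
  case (Suc k)
  let ?C = "gegen_poly l (Suc k)"
  define c where "c = coeff P (Suc k) / coeff ?C (Suc k)"
  have C: "degree ?C \<le> Suc k" "0 < coeff ?C (Suc k)" using gegen_degree_lead[OF l, of "Suc k"] by auto
  have "degree (P - smult c ?C) \<le> k"
  proof (rule degree_le, intro allI impI)
    fix i assume "k < i"
    show "coeff (P - smult c ?C) i = 0"
    proof (cases "i = Suc k")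
      case False
      hence "coeff P i = 0" "coeff ?C i = 0" using Suc.prems C(1) \<open>k < i\<close> by (auto intro!: coeff_eq_0)
      thus ?thesis by (simp del: gegen_poly.simps)
    qed (use C in \<open>simp add: c_def del: gegen_poly.simps\<close>)
  qed
  from Suc.IH[OF this] obtain a where a: "P - smult c ?C = (\<Sum>i\<le>k. smult (a i) (gegen_poly l i))" by blast
  have "P = (\<Sum>i\<le>Suc k. smult ((a(Suc k := c)) i) (gegen_poly l i))"
    using a by (simp add: algebra_simps del: gegen_poly.simps)
  thus ?case by blast
qed

text \<open>
  The polynomial \<open>1 + 2 c s + s\<^sup>2\<close> is \<open>\<parallel>x + s z\<parallel>\<^sup>2\<close> for unit vectors with inner product \<open>c\<close>.
  The degree bound in \<open>c\<close> is what later keeps convolutions from raising degrees.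
\<close>

lemma trinomial_coeff_poly:
  "\<exists>P::real poly. degree P \<le> k \<and> (\<forall>c::real. coeff ([:1, 2 * c, 1:] ^ h) k = poly P c)"
proof (induction h arbitrary: k)
  case 0
  show ?case by (intro exI[of _ "if k = 0 then 1 else 0"]) auto
next
  case (Suc h)
  obtain P where P: "\<And>k. degree (P k) \<le> k" "\<And>k (c::real). coeff ([:1, 2 * c, 1:] ^ h) k = poly (P k) c"
    using Suc by metis
  consider "k = 0" | "k = 1" | m where "k = Suc (Suc m)" by (metis One_nat_def not0_implies_Suc)
  thus ?case
  proof cases
    case 1
    thus ?thesis using P by (intro exI[of _ "P 0"]) auto
  next
    case 2
    have "degree (P 1 + [:0, 2:] * P 0) \<le> 1"
      using P(1)[of 1] P(1)[of 0] degree_mult_le[of "[:0,2:]" "P 0"] by (intro degree_add_le) auto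
    thus ?thesis using P 2 by (intro exI[of _ "P 1 + [:0, 2:] * P 0"]) (auto simp: coeff_pCons)
  next
    case (3 m)
    have "degree (P k + [:0, 2:] * P (Suc m) + P m) \<le> k"
      using P(1)[of k] P(1)[of "Suc m"] P(1)[of m] 3 degree_mult_le[of "[:0,2:]" "P (Suc m)"]
      by (intro degree_add_le) auto
    thus ?thesis using P 3
      by (intro exI[of _ "P k + [:0, 2:] * P (Suc m) + P m"]) (auto simp: coeff_pCons)
  qed
qed

lemma binomial_square_coeff:
  "coeff ([:1, 0, 1::real:] ^ h) 0 = 1 \<and> coeff ([:1, 0, 1::real:] ^ h) (Suc 0) = 0 \<and> coeff ([:1, 0, 1::real:] ^ h) 2 = real h"
  by (induction h) (auto simp: coeff_pCons numeral_2_eq_2)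

section \<open>Moments and zonal polynomials on the sphere\<close>

declare gegen_poly.simps(3) [simp del]

text \<open>
  The dimension is the parameter \<open>n\<close>, since an abbreviation for \<open>CARD('n)\<close> would not mention
  any parameter that fixes the type \<open>'n\<close>.
\<close>

locale rotation_invariant_sphere = compact_prob_space U "sphere 0 1" for U :: "(real ^ 'n) measure" +
  fixes p :: 'n and n :: nat
  assumes card_n: "CARD('n) = n"
    and rotation_invariant: "orthogonal_transformation T \<Longrightarrow> distr U U T = U"
    and dim_ge_3: "3 \<le> n"
begin

abbreviation pole :: "real ^ 'n" where "pole \<equiv> axis p 1"
abbreviation dim :: real where "dim \<equiv> real n"
abbreviation gindex :: real where "gindex \<equiv> (dim - 2) / 2"
abbreviation gegen :: "nat \<Rightarrow> real poly" where "gegen \<equiv> gegen_poly gindex"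

lemma gindex_pos: "0 < gindex" using dim_ge_3 by simp

lemma pole_sphere: "pole \<in> sphere 0 1" by (simp add: norm_axis_1)

lemma inner_range: "x \<in> sphere 0 1 \<Longrightarrow> y \<in> sphere 0 1 \<Longrightarrow> x \<bullet> y \<in> {-1..1::real}" for x y :: "real ^ 'n"
  using Cauchy_Schwarz_ineq2[of x y] by auto

lemma rotate_measurable:
  assumes "orthogonal_transformation (T :: real ^ 'n \<Rightarrow> real ^ 'n)" shows "T \<in> U \<rightarrow>\<^sub>M U"
proof -
  note T = orthogonal_transformation_borel[OF assms]
  have "T \<in> restrict_space borel (sphere 0 1) \<rightarrow>\<^sub>M restrict_space borel (sphere 0 1)"
    by (rule measurable_restrict_space3[OF T]) (use assms in \<open>auto simp: orthogonal_transformation_norm\<close>)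
  thus ?thesis using measurable_cong_sets[OF sets_U sets_U] by blast
qed

lemma rotate_integral:
  fixes f :: "real ^ 'n \<Rightarrow> real"
  assumes "orthogonal_transformation T" "f \<in> borel_measurable U"
  shows "(LINT x|U. f (T x)) = (LINT x|U. f x)"
proof -
  have "(LINT x|U. f x) = (LINT x|distr U U T. f x)" using rotation_invariant[OF assms(1)] by simp
  also have "\<dots> = (LINT x|U. f (T x))" by (rule integral_distr[OF rotate_measurable[OF assms(1)] assms(2)])
  finally show ?thesis by simp
qed

lemma zonal_continuous:
  fixes x :: "real ^ 'n"
  assumes "continuous_on {-1..1::real} f" "x \<in> sphere 0 1"
  shows "continuous_on (sphere 0 1) (\<lambda>y. (f (y \<bullet> x) :: real))"
  by (rule continuous_on_compose2[OF assms(1)]) (use inner_range assms(2) in \<open>auto intro!: continuous_intros\<close>)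

lemma poly_zonal_continuous: "continuous_on A (\<lambda>y. poly q (y \<bullet> (x :: real ^ 'n)))"
  by (intro continuous_intros)

lemma zonal_mean:
  fixes f :: "real \<Rightarrow> real"
  assumes "continuous_on {-1..1} f" "x \<in> sphere 0 1"
  shows "(LINT y|U. f (y \<bullet> x)) = (LINT y|U. f (y \<bullet> pole))"
proof -
  obtain T where T: "orthogonal_transformation T" "T pole = x"
    using orthogonal_transformation_exists[of pole x] assms(2) by (auto simp: norm_axis_1)
  have "(LINT y|U. f (y \<bullet> x)) = (LINT y|U. f (T y \<bullet> x))"
    by (rule rotate_integral[OF T(1), of "\<lambda>y. f (y \<bullet> x)", symmetric]) (intro continuous_measurable zonal_continuous assms)
  also have "(\<lambda>y. f (T y \<bullet> x)) = (\<lambda>y. f (y \<bullet> pole))"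
    using T by (auto simp: orthogonal_transformation_def)
  finally show ?thesis .
qed

definition moment :: "nat \<Rightarrow> real" where "moment N = (LINT y|U. (y \<bullet> pole) ^ N)"

lemma moment_0 [simp]: "moment 0 = 1" by (simp add: moment_def prob_space)

lemma homogeneous_moment: "(LINT y|U. (y \<bullet> x) ^ N) = moment N * norm x ^ N"
proof (cases "x = 0")
  case True
  thus ?thesis by (cases N) (auto simp: prob_space)
next
  case False
  define z where "z = x /\<^sub>R norm x"
  have z: "z \<in> sphere 0 1" using False by (simp add: z_def)
  have x: "x = norm x *\<^sub>R z" using False by (simp add: z_def)
  have "(LINT y|U. (y \<bullet> x) ^ N) = (LINT y|U. norm x ^ N * (y \<bullet> z) ^ N)"
    by (subst x) (simp add: power_mult_distrib)
  also have "\<dots> = norm x ^ N * moment N"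
    unfolding moment_def using zonal_mean[OF _ z, of "\<lambda>t. t ^ N"] by (simp add: continuous_intros)
  finally show ?thesis by simp
qed

lemma moment_odd: "odd N \<Longrightarrow> moment N = 0"
  using homogeneous_moment[of "- pole" N] by (simp add: moment_def norm_axis_1)

lemma mixed_integrable: "integrable U (\<lambda>y. (y \<bullet> x) ^ i * (y \<bullet> z) ^ j)"
  by (intro continuous_integrable continuous_intros)

text \<open>
  Both sides are coefficients of \<open>s\<^sup>k\<close> in \<open>\<integral> \<langle>y, x + s z\<rangle>\<^sup>N\<close>, which \<open>homogeneous_moment\<close>
  evaluates.
\<close>

lemma mixed_moment:
  assumes xz: "x \<in> sphere 0 1" "z \<in> sphere 0 1" and N: "N = j + k"
  shows "real (N choose k) * (LINT y|U. (y \<bullet> x) ^ j * (y \<bullet> z) ^ k)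
     = (if even N then moment N * coeff ([:1, 2 * (x \<bullet> z), 1:] ^ (N div 2)) k else 0)"
proof -
  define L where "L = (\<Sum>i\<le>N. monom (real (N choose i) * (LINT y|U. (y \<bullet> x) ^ (N - i) * (y \<bullet> z) ^ i)) i)"
  define R where "R = (if even N then smult (moment N) ([:1, 2 * (x \<bullet> z), 1:] ^ (N div 2)) else 0)"
  have "poly L s = poly R s" for s
  proof -
    have "poly L s = (\<Sum>i\<le>N. LINT y|U. real (N choose i) * s ^ i * ((y \<bullet> x) ^ (N - i) * (y \<bullet> z) ^ i))"
      unfolding L_def poly_sum poly_monom by (simp add: mult_ac)
    also have "\<dots> = (LINT y|U. (\<Sum>i\<le>N. real (N choose i) * s ^ i * ((y \<bullet> x) ^ (N - i) * (y \<bullet> z) ^ i)))"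
      using mixed_integrable by (subst Bochner_Integration.integral_sum) auto
    also have "\<dots> = (LINT y|U. (y \<bullet> (x + s *\<^sub>R z)) ^ N)"
      by (rule Bochner_Integration.integral_cong)
         (simp_all add: inner_add_right add.commute[of "_ \<bullet> x"] binomial_ring power_mult_distrib mult_ac)
    also have "\<dots> = moment N * norm (x + s *\<^sub>R z) ^ N" by (rule homogeneous_moment)
    also have "\<dots> = poly R s"
    proof (cases "even N")
      case True
      then obtain h where h: "N = 2 * h" by (elim evenE)
      have "norm (x + s *\<^sub>R z) ^ N = (norm (x + s *\<^sub>R z) ^ 2) ^ h" by (simp add: h power_mult)
      also have "norm (x + s *\<^sub>R z) ^ 2 = 1 + s * (2 * (x \<bullet> z) + s)"
        using xz unfolding power2_norm_eq_inner
        by (simp add: inner_add_left inner_add_right inner_commute algebra_simps norm_eq_1)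
      finally show ?thesis using True h by (simp add: R_def)
    qed (simp add: R_def moment_odd)
    finally show ?thesis .
  qed
  hence "L = R" by (intro poly_eq_poly_eq_iff[THEN iffD1] ext)
  hence "coeff L k = coeff R k" by simp
  moreover have "coeff L k = real (N choose k) * (LINT y|U. (y \<bullet> x) ^ (N - k) * (y \<bullet> z) ^ k)"
    unfolding L_def coeff_sum coeff_monom using N by (simp add: sum.delta)
  ultimately show ?thesis using N by (auto simp: R_def)
qed

lemma mixed_moment_poly:
  "\<exists>P. degree P \<le> k \<and> (\<forall>x\<in>sphere 0 1. \<forall>z\<in>sphere 0 1. (LINT y|U. (y \<bullet> x) ^ j * (y \<bullet> z) ^ k) = poly P (x \<bullet> z))"
proof -
  obtain P :: "real poly" where P: "degree P \<le> k" "\<And>c. coeff ([:1, 2 * c, 1:] ^ ((j + k) div 2)) k = poly P c"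
    using trinomial_coeff_poly[of k "(j + k) div 2"] by blast
  define c where "c = (if even (j + k) then moment (j + k) / real ((j + k) choose k) else 0)"
  have "0 < real ((j + k) choose k)" by simp
  hence "(LINT y|U. (y \<bullet> x) ^ j * (y \<bullet> z) ^ k) = poly (smult c P) (x \<bullet> z)"
    if "x \<in> sphere 0 1" "z \<in> sphere 0 1" for x z
    using mixed_moment[OF that refl, of j k] unfolding P(2) by (auto simp: c_def field_simps split: if_splits)
  moreover have "degree (smult c P) \<le> k" using P(1) degree_smult_le order_trans by blast
  ultimately show ?thesis by blast
qed

text \<open>
  The bilinear extension of \<open>mixed_moment_poly\<close>: convolution with the zonal kernel \<open>a\<close> does not
  raise the degree of \<open>b\<close>.
\<close>

lemma zonal_convolution_poly:
  fixes a b :: "real poly"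
  obtains P where "degree P \<le> degree b"
    "\<And>x z. x \<in> sphere 0 1 \<Longrightarrow> z \<in> sphere 0 1 \<Longrightarrow> (LINT y|U. poly a (y \<bullet> x) * poly b (y \<bullet> z)) = poly P (x \<bullet> z)"
proof -
  define Q where "Q j k = (SOME P. degree P \<le> k \<and> (\<forall>x\<in>sphere 0 1. \<forall>z\<in>sphere 0 1.
    (LINT y|U. (y \<bullet> x) ^ j * (y \<bullet> z) ^ k) = poly P (x \<bullet> z)))" for j k
  have Q: "degree (Q j k) \<le> k"
    "x \<in> sphere 0 1 \<Longrightarrow> z \<in> sphere 0 1 \<Longrightarrow> (LINT y|U. (y \<bullet> x) ^ j * (y \<bullet> z) ^ k) = poly (Q j k) (x \<bullet> z)" for j k x z
    using someI_ex[OF mixed_moment_poly[of k j]] unfolding Q_def by auto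
  define P where "P = (\<Sum>j\<le>degree a. \<Sum>k\<le>degree b. smult (coeff a j * coeff b k) (Q j k))"
  show thesis
  proof (rule that)
    have "degree (smult c (Q j k)) \<le> degree b" if "k \<le> degree b" for c j k
      using order_trans[OF degree_smult_le order_trans[OF Q(1) that]] .
    thus "degree P \<le> degree b" unfolding P_def by (intro degree_sum_le finite_atMost) (simp del: degree_smult_eq)
    fix x z :: "real ^ 'n" assume xz: "x \<in> sphere 0 1" "z \<in> sphere 0 1"
    have "(LINT y|U. poly a (y \<bullet> x) * poly b (y \<bullet> z))
        = (LINT y|U. (\<Sum>j\<le>degree a. \<Sum>k\<le>degree b. (coeff a j * coeff b k) * ((y \<bullet> x) ^ j * (y \<bullet> z) ^ k)))"
      by (simp add: poly_altdef sum_product mult_ac)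
    also have "\<dots> = (\<Sum>j\<le>degree a. \<Sum>k\<le>degree b. (coeff a j * coeff b k) * (LINT y|U. (y \<bullet> x) ^ j * (y \<bullet> z) ^ k))"
      using mixed_integrable by (simp add: Bochner_Integration.integral_sum)
    also have "\<dots> = poly P (x \<bullet> z)" by (simp add: P_def poly_sum Q(2)[OF xz])
    finally show "(LINT y|U. poly a (y \<bullet> x) * poly b (y \<bullet> z)) = poly P (x \<bullet> z)" .
  qed
qed

text \<open>
  Compare \<open>mixed_moment\<close> for \<open>k = 2\<close> in each direction orthogonal to the pole and sum:
  the squares of these coordinates add up to \<open>1 - \<langle>y, pole\<rangle>\<^sup>2\<close>.
\<close>

lemma moment_recurrence: "(dim + real j) * moment (j + 2) = (real j + 1) * moment j"
proof (cases "even j")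
  case False
  thus ?thesis by (simp add: moment_odd)
next
  case True
  define N h where "N = j + 2" and "h = N div 2"
  have N: "even N" "real N = 2 * real h" using True by (auto simp: N_def h_def)
  have each: "real (N choose 2) * (LINT y|U. (y \<bullet> pole) ^ j * (y \<bullet> axis q 1) ^ 2) = moment N * real h"
    if "q \<noteq> p" for q
  proof -
    have "pole \<bullet> axis q 1 = 0" using that by (simp add: inner_axis_axis)
    thus ?thesis
      using mixed_moment[OF pole_sphere, of "axis q 1" N j 2] binomial_square_coeff[of h] N
      by (simp add: N_def h_def norm_axis_1)
  qed
  have "real (N choose 2) * (moment j - moment N)
      = real (N choose 2) * (LINT y|U. (\<Sum>q\<in>UNIV - {p}. (y \<bullet> pole) ^ j * (y \<bullet> axis q 1) ^ 2))"
  proof -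
    have "(LINT y|U. (\<Sum>q\<in>UNIV - {p}. (y \<bullet> pole) ^ j * (y \<bullet> axis q 1) ^ 2))
        = (LINT y|U. (y \<bullet> pole) ^ j - (y \<bullet> pole) ^ N)"
    proof (rule Bochner_Integration.integral_cong[OF refl])
      fix y assume "y \<in> space U"
      hence "y \<bullet> y = 1" by (simp add: space_U norm_eq_1)
      hence "(\<Sum>q\<in>UNIV. (y $ q)^2) = 1" by (simp add: inner_vec_def power2_eq_square)
      hence "(\<Sum>q\<in>UNIV - {p}. (y $ q)^2) = 1 - (y $ p)^2" by (subst sum_diff1) auto
      hence "(\<Sum>q\<in>UNIV - {p}. (y \<bullet> axis q 1)^2) = 1 - (y \<bullet> pole)^2" by (simp add: inner_axis)
      thus "(\<Sum>q\<in>UNIV - {p}. (y \<bullet> pole) ^ j * (y \<bullet> axis q 1) ^ 2) = (y \<bullet> pole) ^ j - (y \<bullet> pole) ^ N"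
        unfolding sum_distrib_left[symmetric] N_def power_add by (simp add: right_diff_distrib)
    qed
    also have "\<dots> = moment j - moment N"
      unfolding moment_def
      by (rule Bochner_Integration.integral_diff) (intro continuous_integrable continuous_intros)+
    finally show ?thesis by simp
  qed
  also have "\<dots> = (\<Sum>q\<in>UNIV - {p}. real (N choose 2) * (LINT y|U. (y \<bullet> pole) ^ j * (y \<bullet> axis q 1) ^ 2))"
    using mixed_integrable by (simp add: Bochner_Integration.integral_sum sum_distrib_left)
  also have "\<dots> = (dim - 1) * (moment N * real h)"
    using dim_ge_3 by (simp add: each card_Diff_singleton card_n of_nat_diff)
  finally have E: "real (N choose 2) * (moment j - moment N) = (dim - 1) * (moment N * real h)" .
  have c: "real (N choose 2) = real h * (real j + 1)"
  proof -
    obtain m where m: "j = 2 * m" using True by (elim evenE)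
    have "N * (N - 1) = 2 * ((m + 1) * (2 * m + 1))" by (simp add: N_def m algebra_simps)
    hence "N choose 2 = (m + 1) * (2 * m + 1)" by (simp add: choose_two)
    thus ?thesis by (simp add: m h_def N_def algebra_simps)
  qed
  have "0 < real h" using N by (simp add: N_def)
  moreover have "real h * ((real j + 1) * (moment j - moment N)) = real h * ((dim - 1) * moment N)"
    using E unfolding c by (simp add: mult_ac)
  ultimately have "(real j + 1) * (moment j - moment N) = (dim - 1) * moment N" by simp
  thus ?thesis unfolding N_def by (simp add: algebra_simps)
qed

definition zmean :: "real poly \<Rightarrow> real" where "zmean q = (LINT y|U. poly q (y \<bullet> pole))"

lemma poly_integrable: "integrable U (\<lambda>y. poly q (y \<bullet> (x :: real ^ 'n)))"
  by (intro continuous_integrable poly_zonal_continuous)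

lemma zmean_add: "zmean (a + b) = zmean a + zmean b"
  and zmean_diff: "zmean (a - b) = zmean a - zmean b"
  and zmean_smult: "zmean (smult c a) = c * zmean a"
  unfolding zmean_def using poly_integrable by simp_all

lemma zmean_0 [simp]: "zmean 0 = 0" by (simp add: zmean_def)

lemma zmean_sum: "zmean (\<Sum>i\<in>A. f i) = (\<Sum>i\<in>A. zmean (f i))"
  by (induction A rule: infinite_finite_induct) (auto simp: zmean_add)

lemma zmean_1: "zmean 1 = 1" by (simp add: zmean_def prob_space)

lemma zmean_monom: "zmean (monom c i) = c * moment i"
  by (simp add: zmean_def moment_def poly_monom)

text \<open>
  Integration by parts against the weight \<open>(1 - t\<^sup>2)\<^bsup>(n-3)/2\<^esup>\<close>, in the form that involves only
  the moments.
\<close>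

lemma zmean_by_parts: "zmean ([:1, 0, -1:] * pderiv a) = (dim - 1) * zmean ([:0, 1:] * a)"
proof -
  have mono: "zmean ([:1, 0, -1:] * pderiv (monom c i)) = (dim - 1) * zmean ([:0, 1:] * monom c i)" for c i
  proof (cases i)
    case 0
    have "[:0, 1:] * monom c 0 = monom c 1" by (simp add: monom_Suc)
    thus ?thesis using 0 by (simp add: zmean_monom moment_odd pderiv_monom)
  next
    case (Suc j)
    have "[:1, 0, -1:] * monom d j = monom d j - monom d (j + 2)" for d :: real by (simp add: monom_Suc)
    hence 1: "[:1, 0, -1:] * pderiv (monom c i) = smult (real i) (monom c j - monom c (j + 2))"
      unfolding Suc pderiv_monom smult_diff_right smult_monom by simp
    have 2: "[:0, 1:] * monom c i = monom c (j + 2)" by (simp add: Suc monom_Suc)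
    have "c * ((dim + real j) * moment (j + 2)) = c * ((real j + 1) * moment j)"
      by (simp only: moment_recurrence)
    thus ?thesis unfolding 1 2 zmean_smult zmean_diff zmean_monom
      by (simp add: Suc algebra_simps del: add_2_eq_Suc')
  qed
  have pderiv_sum: "pderiv (\<Sum>i\<in>A. f i) = (\<Sum>i\<in>A. pderiv (f i))" for A and f :: "nat \<Rightarrow> real poly"
    by (induction A rule: infinite_finite_induct) (auto simp: pderiv_add)
  have a: "a = (\<Sum>i\<le>degree a. monom (coeff a i) i)" by (simp add: poly_as_sum_of_monoms)
  show ?thesis
    by (subst (1 2) a) (simp only: pderiv_sum sum_distrib_left zmean_sum mono)
qed

text \<open>
  The operator \<open>L\<close> of the Gegenbauer equation is symmetric for \<open>zmean\<close> by
  \<open>zmean_by_parts\<close>, and the polynomials are eigenvectors with distinct eigenvalues.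
\<close>

lemma gegen_orthogonal:
  assumes "k \<noteq> i" shows "zmean (gegen k * gegen i) = 0"
proof -
  define L where "L a = [:1, 0, -1:] * pderiv (pderiv a) - smult (dim - 1) ([:0, 1:] * pderiv a)" for a :: "real poly"
  have sym: "zmean (b * L a) = - zmean ([:1, 0, -1:] * (pderiv a * pderiv b))" for a b
  proof -
    have "zmean ([:1, 0, -1:] * pderiv (pderiv a * b)) = (dim - 1) * zmean ([:0, 1:] * (pderiv a * b))"
      by (rule zmean_by_parts)
    moreover have "[:1, 0, -1:] * pderiv (pderiv a * b)
        = b * ([:1, 0, -1:] * pderiv (pderiv a)) + [:1, 0, -1:] * (pderiv a * pderiv b)"
      unfolding pderiv_mult by (simp only: algebra_simps)
    moreover have "b * L a = b * ([:1, 0, -1:] * pderiv (pderiv a)) - smult (dim - 1) ([:0, 1:] * (pderiv a * b))"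
      unfolding L_def by (simp only: right_diff_distrib mult_smult_right mult_ac)
    ultimately show ?thesis by (simp only: zmean_add zmean_diff zmean_smult)
  qed
  have eig: "L (gegen m) = smult (- (real m * (dim - 2 + real m))) (gegen m)" for m
  proof -
    have e: "2 * gindex + 1 = dim - 1" "2 * gindex + real m = dim - 2 + real m" by (auto simp: field_simps)
    show ?thesis using gegen_ode[of gindex m] unfolding L_def e .
  qed
  have "zmean (gegen i * L (gegen k)) = zmean (gegen k * L (gegen i))"
    unfolding sym by (simp only: mult_ac)
  hence "(real k * (dim - 2 + real k) - real i * (dim - 2 + real i)) * zmean (gegen k * gegen i) = 0"
    unfolding eig mult_smult_right zmean_smult mult.commute[of "gegen i" "gegen k"] by (simp add: algebra_simps)
  moreover have "real k * (dim - 2 + real k) - real i * (dim - 2 + real i) = (real k - real i) * (dim - 2 + real k + real i)"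
    by (simp add: algebra_simps)
  moreover have "dim - 2 + real k + real i \<noteq> 0" using dim_ge_3 by simp
  ultimately show ?thesis using assms by simp
qed

text \<open>
  Multiplying the recurrence by one of the outer polynomials gives the ratio of consecutive
  norms as a positive number.
\<close>

lemma gegen_norm_pos: "0 < zmean (gegen k * gegen k)"
proof (induction k rule: induct_nat_012)
  case 0
  show ?case by (simp add: zmean_1)
next
  case 1
  have "gegen (Suc 0) * gegen (Suc 0) = monom ((2 * gindex)^2) 2"
    by (simp add: monom_altdef power2_eq_square)
  moreover have "dim * moment 2 = 1" using moment_recurrence[of 0] by (simp add: numeral_2_eq_2)
  hence "0 < moment 2" using dim_ge_3 by (metis zero_less_mult_pos zero_less_one of_nat_0_less_iff less_le_trans zero_less_numeral)
  ultimately show ?case using gindex_pos by (simp add: zmean_monom)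
next
  case (ge2 k)
  let ?C = "gegen"
  define Z where "Z = zmean ([:0, 1:] * ?C (Suc k) * ?C (Suc (Suc k)))"
  have g: "0 < gindex" by (rule gindex_pos)
  have "zmean (smult (real k + 2) (?C (Suc (Suc k))) * ?C (Suc (Suc k))) = 2 * (gindex + real k + 1) * Z"
    unfolding gegen_recurrence left_diff_distrib mult_smult_left zmean_diff zmean_smult Z_def
    using gegen_orthogonal[of k "Suc (Suc k)"] by simp
  hence 1: "(real k + 2) * zmean (?C (Suc (Suc k)) * ?C (Suc (Suc k))) = 2 * (gindex + real k + 1) * Z"
    by (simp only: mult_smult_left zmean_smult)
  have "zmean (smult (real (Suc k) + 2) (?C (Suc (Suc (Suc k)))) * ?C (Suc k))
      = 2 * (gindex + real (Suc k) + 1) * zmean ([:0, 1:] * ?C (Suc (Suc k)) * ?C (Suc k))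
        - (2 * gindex + real (Suc k)) * zmean (?C (Suc k) * ?C (Suc k))"
    unfolding gegen_recurrence left_diff_distrib mult_smult_left zmean_diff zmean_smult by simp
  moreover have "zmean (smult (real (Suc k) + 2) (?C (Suc (Suc (Suc k)))) * ?C (Suc k)) = 0"
    unfolding mult_smult_left zmean_smult using gegen_orthogonal[of "Suc (Suc (Suc k))" "Suc k"] by simp
  moreover have C: "[:0, 1:] * ?C (Suc (Suc k)) * ?C (Suc k) = [:0, 1:] * ?C (Suc k) * ?C (Suc (Suc k))"
    by (simp only: mult_ac)
  ultimately have 2: "2 * (gindex + real (Suc k) + 1) * Z = (2 * gindex + real (Suc k)) * zmean (?C (Suc k) * ?C (Suc k))"
    unfolding C Z_def by linarith
  have "0 < 2 * gindex + real (Suc k)" using g by linarith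
  hence "0 < 2 * (gindex + real (Suc k) + 1) * Z" unfolding 2 using ge2 by (intro mult_pos_pos)
  moreover have pos: "0 < 2 * (gindex + real m + 1)" for m
    by (intro mult_pos_pos add_pos_nonneg g) auto
  ultimately have "0 < Z" by (metis zero_less_mult_pos)
  have "0 < (real k + 2) * zmean (?C (Suc (Suc k)) * ?C (Suc (Suc k)))" unfolding 1
    by (rule mult_pos_pos[OF pos \<open>0 < Z\<close>])
  thus ?case by (simp add: zero_less_mult_iff del: gegen_poly.simps)
qed

lemma gegen_orthogonal_lower:
  assumes "degree b < k" shows "zmean (b * gegen k) = 0"
proof -
  obtain a where b: "b = (\<Sum>i\<le>degree b. smult (a i) (gegen i))" using gegen_basis[OF gindex_pos order_refl] by blast
  have "zmean (b * gegen k) = (\<Sum>i\<le>degree b. a i * zmean (gegen i * gegen k))"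
    by (subst b) (simp only: sum_distrib_right mult_smult_left zmean_sum zmean_smult)
  also have "\<dots> = 0" using assms by (intro sum.neutral) (auto simp: gegen_orthogonal)
  finally show ?thesis .
qed

end

section \<open>The Funk-Hecke formula\<close>

context rotation_invariant_sphere
begin

lemma poly_kernel_measurable [measurable]: "(\<lambda>(x, y). poly q (x \<bullet> y)) \<in> borel_measurable (U \<Otimes>\<^sub>M U)"
proof -
  note ident_measurable[measurable]
  have "poly q \<in> borel_measurable borel" by (intro borel_measurable_continuous_onI continuous_intros)
  moreover have "(\<lambda>(x, y). x \<bullet> y) \<in> borel_measurable (U \<Otimes>\<^sub>M U)" by measurable
  ultimately show ?thesis using measurable_compose[of "\<lambda>(x, y). x \<bullet> y" "U \<Otimes>\<^sub>M U" borel "poly q" borel]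
    by (simp add: case_prod_beta')
qed

lemma poly_kernel_bounded:
  obtains M where "0 \<le> M" "\<And>x y. x \<in> sphere 0 1 \<Longrightarrow> y \<in> sphere 0 1 \<Longrightarrow> \<bar>poly q (x \<bullet> (y :: real ^ 'n))\<bar> \<le> M"
proof -
  have "continuous_on {-1..1} (poly q)" by (intro continuous_intros)
  then obtain M where "0 \<le> M" "\<And>t. t \<in> {-1..1} \<Longrightarrow> \<bar>poly q t\<bar> \<le> M"
    using continuous_interval_bound by blast
  with inner_range that show thesis by blast
qed

text \<open>
  By \<open>gegenbauer_coeff_eq\<close> this is the Gegenbauer coefficient, written as a mean over the sphere.
\<close>

definition coefficient :: "(real \<Rightarrow> real) \<Rightarrow> nat \<Rightarrow> real" where
  "coefficient w k = (LINT y|U. w (y \<bullet> pole) * poly (gegen k) (y \<bullet> pole)) / poly (gegen k) 1"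

lemma gegen_1_pos: "0 < poly (gegen k) 1"
  using gegenbauer_at_1_pos[OF gindex_pos] by simp

lemma coefficient_poly: "coefficient (poly q) k = zmean (q * gegen k) / poly (gegen k) 1"
  by (simp add: coefficient_def zmean_def)

text \<open>
  The convolution of \<open>C\<^sub>k\<close> is a zonal polynomial \<open>P\<close> of degree at most \<open>k\<close>. For \<open>i < k\<close>,
  symmetry moves the convolution onto \<open>C\<^sub>i\<close>, where the degree stays below \<open>k\<close>, so \<open>P\<close> is orthogonal to
  \<open>C\<^sub>i\<close>. Hence \<open>P\<close> is a multiple of \<open>C\<^sub>k\<close>, and evaluation at the pole identifies the factor.
\<close>

lemma funk_hecke_poly:
  assumes xz: "x \<in> sphere 0 1" "z \<in> sphere 0 1"
  shows "(LINT y|U. poly a (y \<bullet> x) * poly (gegen k) (y \<bullet> z)) = coefficient (poly a) k * poly (gegen k) (x \<bullet> z)"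
proof -
  obtain P where P: "degree P \<le> degree (gegen k)"
    "\<And>x z. x \<in> sphere 0 1 \<Longrightarrow> z \<in> sphere 0 1 \<Longrightarrow> (LINT y|U. poly a (y \<bullet> x) * poly (gegen k) (y \<bullet> z)) = poly P (x \<bullet> z)"
    using zonal_convolution_poly[of "gegen k" a] by blast
  have "degree P \<le> k" using P(1) gegen_degree_lead[OF gindex_pos, of k] by simp
  then obtain b where b: "P = (\<Sum>i\<le>k. smult (b i) (gegen i))" using gegen_basis[OF gindex_pos] by blast
  have "b i = 0" if "i < k" for i
  proof -
    obtain R where R: "degree R \<le> degree (gegen i)"
      "\<And>x z. x \<in> sphere 0 1 \<Longrightarrow> z \<in> sphere 0 1 \<Longrightarrow> (LINT y|U. poly a (y \<bullet> x) * poly (gegen i) (y \<bullet> z)) = poly R (x \<bullet> z)"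
      using zonal_convolution_poly[of "gegen i" a] by blast
    have dR: "degree R < k" using R(1) gegen_degree_lead[OF gindex_pos, of i] that by simp
    obtain Ma where Ma: "0 \<le> Ma" "\<And>x y. x \<in> sphere 0 1 \<Longrightarrow> y \<in> sphere 0 1 \<Longrightarrow> \<bar>poly a (x \<bullet> (y :: real ^ 'n))\<bar> \<le> Ma"
      using poly_kernel_bounded by blast
    obtain Mk where Mk: "0 \<le> Mk" "\<And>x y. x \<in> sphere 0 1 \<Longrightarrow> y \<in> sphere 0 1 \<Longrightarrow> \<bar>poly (gegen k) (x \<bullet> (y :: real ^ 'n))\<bar> \<le> Mk"
      using poly_kernel_bounded by blast
    obtain Mi where Mi: "0 \<le> Mi" "\<And>x y. x \<in> sphere 0 1 \<Longrightarrow> y \<in> sphere 0 1 \<Longrightarrow> \<bar>poly (gegen i) (x \<bullet> (y :: real ^ 'n))\<bar> \<le> Mi"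
      using poly_kernel_bounded by blast
    note ident_measurable[measurable]
    have [measurable]: "(\<lambda>y. poly q (y \<bullet> pole)) \<in> borel_measurable U" for q
      by (intro continuous_measurable poly_zonal_continuous)
    have "zmean (P * gegen i) = (LINT x|U. LINT y|U. poly a (y \<bullet> x) * poly (gegen k) (y \<bullet> pole) * poly (gegen i) (x \<bullet> pole))"
      unfolding zmean_def
      by (rule Bochner_Integration.integral_cong) (auto simp: space_U P(2)[OF _ pole_sphere, symmetric] simp del: poly_gegen_poly)
    also have "\<dots> = (LINT y|U. LINT x|U. poly a (y \<bullet> x) * poly (gegen k) (y \<bullet> pole) * poly (gegen i) (x \<bullet> pole))"
    proof (rule bounded_fubini)
      have "(\<lambda>(x, y). poly a (x \<bullet> y)) \<in> borel_measurable (U \<Otimes>\<^sub>M U)" by (rule poly_kernel_measurable)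
      hence [measurable]: "(\<lambda>z. poly a (snd z \<bullet> fst z)) \<in> borel_measurable (U \<Otimes>\<^sub>M U)"
        by (simp add: case_prod_beta' inner_commute)
      show "(\<lambda>(x, y). poly a (y \<bullet> x) * poly (gegen k) (y \<bullet> pole) * poly (gegen i) (x \<bullet> pole)) \<in> borel_measurable (U \<Otimes>\<^sub>M U)"
        unfolding case_prod_beta' by measurable
      show "\<bar>poly a (y \<bullet> x) * poly (gegen k) (y \<bullet> pole) * poly (gegen i) (x \<bullet> pole)\<bar> \<le> Ma * Mk * Mi"
        if "x \<in> sphere 0 1" "y \<in> sphere 0 1" for x y
        unfolding abs_mult using Ma Mk Mi that pole_sphere by (intro mult_mono mult_nonneg_nonneg) auto
    qed
    also have "\<dots> = (LINT y|U. poly (gegen k) (y \<bullet> pole) * poly R (y \<bullet> pole))"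
    proof (rule Bochner_Integration.integral_cong[OF refl])
      fix y assume "y \<in> space U"
      hence y: "y \<in> sphere 0 1" by (simp add: space_U)
      have "(LINT x|U. poly a (y \<bullet> x) * poly (gegen k) (y \<bullet> pole) * poly (gegen i) (x \<bullet> pole))
          = (LINT x|U. poly (gegen k) (y \<bullet> pole) * (poly a (x \<bullet> y) * poly (gegen i) (x \<bullet> pole)))"
        by (simp only: inner_commute[of y] mult_ac)
      also have "\<dots> = poly (gegen k) (y \<bullet> pole) * poly R (y \<bullet> pole)"
        using R(2)[OF y pole_sphere] by simp
      finally show "(LINT x|U. poly a (y \<bullet> x) * poly (gegen k) (y \<bullet> pole) * poly (gegen i) (x \<bullet> pole))
          = poly (gegen k) (y \<bullet> pole) * poly R (y \<bullet> pole)" .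
    qed
    also have "\<dots> = zmean (R * gegen k)" by (simp add: zmean_def mult.commute)
    also have "\<dots> = 0" by (rule gegen_orthogonal_lower[OF dR])
    finally have "zmean (P * gegen i) = 0" .
    moreover have "zmean (P * gegen i) = (\<Sum>j\<le>k. b j * zmean (gegen j * gegen i))"
      unfolding b by (simp only: sum_distrib_right mult_smult_left zmean_sum zmean_smult)
    also have "\<dots> = (\<Sum>j\<le>k. if j = i then b i * zmean (gegen i * gegen i) else 0)"
      by (rule sum.cong) (auto simp: gegen_orthogonal)
    also have "\<dots> = b i * zmean (gegen i * gegen i)" using that by simp
    ultimately show ?thesis using gegen_norm_pos[of i] by simp
  qed
  hence "P = (\<Sum>i\<le>k. if i = k then smult (b k) (gegen k) else 0)"
    unfolding b by (intro sum.cong) auto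
  hence Pk: "P = smult (b k) (gegen k)" by simp
  have "zmean (a * gegen k) = poly P 1"
    using P(2)[OF pole_sphere pole_sphere] by (simp add: zmean_def norm_axis_1 inner_axis_axis del: poly_gegen_poly)
  hence "b k = coefficient (poly a) k" using gegen_1_pos[of k] by (simp add: coefficient_poly Pk field_simps del: poly_gegen_poly)
  thus ?thesis using P(2)[OF xz] by (simp add: Pk)
qed

lemma kernel_continuous:
  fixes w :: "real \<Rightarrow> real" and x z :: "real ^ 'n"
  assumes "continuous_on {-1..1} w" "x \<in> sphere 0 1"
  shows "continuous_on (sphere 0 1) (\<lambda>y. w (y \<bullet> x) * poly q (y \<bullet> z) :: real)"
  by (intro continuous_on_mult zonal_continuous[OF assms] poly_zonal_continuous)

lemma polynomial_approximation:
  fixes w :: "real \<Rightarrow> real"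
  assumes "continuous_on {-1..1} w" "0 < e"
  obtains q where "\<And>t. t \<in> {-1..1} \<Longrightarrow> \<bar>w t - poly q t\<bar> < e"
proof -
  obtain g where g: "real_polynomial_function g" "\<And>t. t \<in> {-1..1} \<Longrightarrow> \<bar>w t - g t\<bar> < e"
    using Stone_Weierstrass_real_polynomial_function[OF _ assms] by (metis compact_Icc)
  then obtain a m where a: "g = (\<lambda>t. \<Sum>i\<le>m::nat. a i * t ^ i)" using real_polynomial_function_imp_sum by blast
  have "g t = poly (\<Sum>i\<le>m. monom (a i) i) t" for t by (simp add: a poly_sum poly_monom)
  with g(2) that show thesis by metis
qed

lemma kernel_integral_bound:
  assumes w: "continuous_on {-1..1} w" "\<And>t. t \<in> {-1..1} \<Longrightarrow> \<bar>w t\<bar> \<le> e"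
    and q: "\<And>y. y \<in> sphere 0 1 \<Longrightarrow> \<bar>poly q (y \<bullet> z)\<bar> \<le> M" and x: "x \<in> sphere 0 1"
  shows "\<bar>LINT y|U. w (y \<bullet> x) * poly q (y \<bullet> z)\<bar> \<le> e * M"
proof -
  have "0 \<le> e" using w(2)[of 0] by simp
  have "\<bar>LINT y|U. w (y \<bullet> x) * poly q (y \<bullet> z)\<bar> \<le> (LINT y|U. e * M)"
  proof (rule integral_abs_le(2))
    show "integrable U (\<lambda>y. w (y \<bullet> x) * poly q (y \<bullet> z))"
      by (intro continuous_integrable kernel_continuous w x)
    fix y assume "y \<in> space U"
    hence y: "y \<in> sphere 0 1" by (simp add: space_U)
    show "\<bar>w (y \<bullet> x) * poly q (y \<bullet> z)\<bar> \<le> e * M"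
      unfolding abs_mult using w(2)[OF inner_range[OF y x]] q[OF y] \<open>0 \<le> e\<close> by (intro mult_mono) auto
  qed simp
  thus ?thesis by (simp add: prob_space)
qed

lemma coefficient_diff:
  assumes "continuous_on {-1..1} w" "continuous_on {-1..1} v"
  shows "coefficient (\<lambda>t. w t - v t) k = coefficient w k - coefficient v k"
proof -
  have "integrable U (\<lambda>y. w (y \<bullet> pole) * poly (gegen k) (y \<bullet> pole))" "integrable U (\<lambda>y. v (y \<bullet> pole) * poly (gegen k) (y \<bullet> pole))"
    by (intro continuous_integrable kernel_continuous assms pole_sphere)+
  thus ?thesis unfolding coefficient_def left_diff_distrib by (simp add: diff_divide_distrib)
qed

theorem funk_hecke:
  fixes w :: "real \<Rightarrow> real"
  assumes w: "continuous_on {-1..1} w" and xz: "x \<in> sphere 0 1" "z \<in> sphere 0 1"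
  shows "(LINT y|U. w (y \<bullet> x) * poly (gegen k) (y \<bullet> z)) = coefficient w k * poly (gegen k) (x \<bullet> z)"
proof -
  obtain M where M: "0 \<le> M" "\<And>x y. x \<in> sphere 0 1 \<Longrightarrow> y \<in> sphere 0 1 \<Longrightarrow> \<bar>poly (gegen k) (x \<bullet> (y :: real ^ 'n))\<bar> \<le> M"
    using poly_kernel_bounded by blast
  define c where "c = poly (gegen k) 1"
  have c: "0 < c" using gegen_1_pos by (simp add: c_def)
  define E where "E = \<bar>(LINT y|U. w (y \<bullet> x) * poly (gegen k) (y \<bullet> z)) - coefficient w k * poly (gegen k) (x \<bullet> z)\<bar>"
  have "E \<le> e * (M + M / c * M)" if e: "0 < e" for e
  proof -
    obtain q where q: "\<And>t. t \<in> {-1..1} \<Longrightarrow> \<bar>w t - poly q t\<bar> < e" using polynomial_approximation[OF w e] by blast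
    have d: "continuous_on {-1..1} (\<lambda>t. w t - poly q t)" by (intro continuous_intros w)
    have b: "\<And>t. t \<in> {-1..1} \<Longrightarrow> \<bar>w t - poly q t\<bar> \<le> e" using q by force
    define I where "I = (\<lambda>x z. LINT y|U. (w (y \<bullet> x) - poly q (y \<bullet> x)) * poly (gegen k) (y \<bullet> z))"
    have I: "\<bar>I x' z'\<bar> \<le> e * M" if "x' \<in> sphere 0 1" "z' \<in> sphere 0 1" for x' z'
      unfolding I_def using kernel_integral_bound[OF d b M(2)[OF _ that(2)] that(1)] by simp
    have "I x z = (LINT y|U. w (y \<bullet> x) * poly (gegen k) (y \<bullet> z)) - (LINT y|U. poly q (y \<bullet> x) * poly (gegen k) (y \<bullet> z))"
      unfolding I_def left_diff_distrib
      by (rule Bochner_Integration.integral_diff)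
         (intro continuous_integrable kernel_continuous w xz continuous_intros)+
    also have "(LINT y|U. poly q (y \<bullet> x) * poly (gegen k) (y \<bullet> z)) = coefficient (poly q) k * poly (gegen k) (x \<bullet> z)"
      by (rule funk_hecke_poly[OF xz])
    finally have 1: "(LINT y|U. w (y \<bullet> x) * poly (gegen k) (y \<bullet> z))
      = I x z + coefficient (poly q) k * poly (gegen k) (x \<bullet> z)" by simp
    have "coefficient w k - coefficient (poly q) k = coefficient (\<lambda>t. w t - poly q t) k"
      using coefficient_diff[OF w, of "poly q"] by (simp add: continuous_intros)
    also have "\<dots> = I pole pole / c" by (simp add: coefficient_def I_def c_def)
    finally have 2: "coefficient w k = coefficient (poly q) k + I pole pole / c" by simp
    have "E = \<bar>I x z - I pole pole / c * poly (gegen k) (x \<bullet> z)\<bar>"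
      unfolding E_def 1 2 distrib_right by simp
    also have "\<dots> \<le> \<bar>I x z\<bar> + \<bar>I pole pole\<bar> / c * \<bar>poly (gegen k) (x \<bullet> z)\<bar>"
      using c abs_triangle_ineq4[of "I x z" "I pole pole / c * poly (gegen k) (x \<bullet> z)"] by (simp add: abs_mult del: poly_gegen_poly)
    also have "\<dots> \<le> e * M + e * M / c * M"
      using I[OF xz] I[OF pole_sphere pole_sphere] M xz c e
      by (intro add_mono mult_mono divide_right_mono) auto
    finally show ?thesis by (simp add: algebra_simps)
  qed
  note * = this
  have "E \<le> 0"
  proof (rule field_le_epsilon)
    fix e :: real assume e: "0 < e"
    define A where "A = M + M / c * M + 1"
    have A: "1 \<le> A" using M c by (simp add: A_def)
    have "E \<le> e / A * (M + M / c * M)" using *[of "e / A"] e A by simp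
    also have "\<dots> \<le> e / A * A" using e A by (intro mult_left_mono) (auto simp: A_def)
    finally show "E \<le> 0 + e" using A by simp
  qed
  thus ?thesis by (simp add: E_def)
qed

text \<open>
  The coefficient is an eigenvalue of the convolution; test the eigenvalue equation at a
  maximum point of the absolute value of the eigenfunction.
\<close>

lemma coefficient_bound:
  assumes w: "continuous_on {-1..1} w" "\<And>t. t \<in> {-1..1} \<Longrightarrow> \<bar>w t\<bar> \<le> e"
  shows "\<bar>coefficient w k\<bar> \<le> e"
proof -
  have "continuous_on (sphere 0 1) (\<lambda>x. \<bar>poly (gegen k) (x \<bullet> pole)\<bar>)" by (intro continuous_intros)
  from continuous_attains_sup[OF compact_S S_nonempty this] obtain x where x: "x \<in> sphere 0 1"
    "\<And>y. y \<in> sphere 0 1 \<Longrightarrow> \<bar>poly (gegen k) (y \<bullet> pole)\<bar> \<le> \<bar>poly (gegen k) (x \<bullet> pole)\<bar>" by blast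
  define M where "M = \<bar>poly (gegen k) (x \<bullet> pole)\<bar>"
  have "0 < M" using x(2)[OF pole_sphere] gegen_1_pos[of k] by (simp add: M_def inner_axis_axis)
  have "\<bar>coefficient w k * poly (gegen k) (x \<bullet> pole)\<bar> \<le> e * M"
    unfolding funk_hecke[OF w(1) x(1) pole_sphere, symmetric]
    by (rule kernel_integral_bound[OF w x(2)[folded M_def] x(1)])
  hence "\<bar>coefficient w k\<bar> * M \<le> e * M" by (simp add: abs_mult M_def)
  thus ?thesis using \<open>0 < M\<close> by simp
qed

lemma coefficient_poly_high: "degree q < k \<Longrightarrow> coefficient (poly q) k = 0"
  by (simp add: coefficient_poly gegen_orthogonal_lower)

text \<open>
  A polynomial approximation of \<open>w\<close> has no coefficients of high index, so those of \<open>w\<close>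
  are eventually above the negative one, and only finitely many remain.
\<close>

lemma coefficient_min_attained:
  assumes w: "continuous_on {-1..1} w" and j: "1 \<le> j" "coefficient w j < 0"
  obtains m where "1 \<le> m" "\<And>k. 1 \<le> k \<Longrightarrow> coefficient w m \<le> coefficient w k"
proof -
  \<comment> \<open>with this error, coefficients of index above \<open>degree q\<close> are at least \<open>coefficient w j\<close>\<close>
  define e where "e = - coefficient w j"
  have "0 < e" using j by (simp add: e_def)
  from polynomial_approximation[OF w this] obtain q where q: "\<And>t. t \<in> {-1..1} \<Longrightarrow> \<bar>w t - poly q t\<bar> < e" by blast
  define N where "N = max (degree q) j"
  have high: "coefficient w j \<le> coefficient w k" if "N < k" for k
  proof -
    have "\<bar>coefficient (\<lambda>t. w t - poly q t) k\<bar> \<le> e"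
      by (rule coefficient_bound) (use q w in \<open>force intro!: continuous_intros\<close>)+
    moreover have "coefficient (\<lambda>t. w t - poly q t) k = coefficient w k - coefficient (poly q) k"
      using coefficient_diff[OF w, of "poly q"] by (simp add: continuous_intros)
    moreover have "coefficient (poly q) k = 0" using that by (intro coefficient_poly_high) (simp add: N_def)
    ultimately show ?thesis by (simp add: e_def)
  qed
  have "finite {1..N}" "{1..N} \<noteq> {}" using j by (auto simp: N_def)
  then obtain m where m: "m \<in> {1..N}" "\<And>k. k \<in> {1..N} \<Longrightarrow> coefficient w m \<le> coefficient w k"
    using ex_min_if_finite[of "coefficient w ` {1..N}"] by (metis (mono_tags) arg_min_if_finite(1) arg_min_least)
  have "coefficient w m \<le> coefficient w j" using m(2)[of j] j by (simp add: N_def)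
  with m high have "coefficient w m \<le> coefficient w k" if "1 \<le> k" for k
    using that by (cases "k \<le> N") (auto intro: order_trans)
  with m(1) that show thesis by auto
qed

end

section \<open>The spectral bound\<close>

context rotation_invariant_sphere
begin

lemma zonal_kernel_measurable:
  fixes w :: "real \<Rightarrow> real"
  assumes "continuous_on {-1..1} w"
  shows "(\<lambda>(x, y). w (x \<bullet> y)) \<in> borel_measurable (U \<Otimes>\<^sub>M U)"
proof (rule continuous_kernel_measurable)
  have "continuous_on (sphere 0 1 \<times> sphere 0 1) (\<lambda>z. w (fst z \<bullet> snd (z :: (real ^ 'n) \<times> (real ^ 'n))))"
    by (rule continuous_on_compose2[OF assms]) (use inner_range in \<open>auto intro!: continuous_intros\<close>)
  thus "continuous_on (sphere 0 1 \<times> sphere 0 1) (\<lambda>(x, y). w (x \<bullet> (y :: real ^ 'n)))"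
    by (simp add: case_prod_beta')
qed

definition convolve :: "(real \<Rightarrow> real) \<Rightarrow> (real ^ 'n \<Rightarrow> real) \<Rightarrow> real ^ 'n \<Rightarrow> real" where
  "convolve w f x = (LINT y|U. w (x \<bullet> y) * f y)"

definition qform :: "(real \<Rightarrow> real) \<Rightarrow> (real ^ 'n \<Rightarrow> real) \<Rightarrow> real" where
  "qform w f = (LINT x|U. f x * convolve w f x)"

lemma poly_continuous: "continuous_on A (poly q)" for q :: "real poly"
  by (intro continuous_intros)

abbreviation gegen_eigenvalue :: "nat \<Rightarrow> real" where
  "gegen_eigenvalue k \<equiv> coefficient (poly (gegen k)) k"

lemma gegen_eigenvalue_pos: "0 < gegen_eigenvalue k"
  using gegen_norm_pos gegen_1_pos by (simp add: coefficient_poly del: poly_gegen_poly)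

lemma coefficient_expansion:
  "coefficient (poly (\<Sum>i\<le>N. smult (b i) (gegen i))) k = (if k \<le> N then b k * gegen_eigenvalue k else 0)"
proof -
  have "zmean ((\<Sum>i\<le>N. smult (b i) (gegen i)) * gegen k) = (\<Sum>i\<le>N. b i * zmean (gegen i * gegen k))"
    by (simp only: sum_distrib_right mult_smult_left zmean_sum zmean_smult)
  also have "\<dots> = (\<Sum>i\<le>N. if i = k then b k * zmean (gegen k * gegen k) else 0)"
    by (rule sum.cong) (auto simp: gegen_orthogonal)
  finally show ?thesis by (simp add: coefficient_poly del: poly_gegen_poly)
qed

context
  fixes f :: "real ^ 'n \<Rightarrow> real" and F :: real
  assumes f_measurable [measurable]: "f \<in> borel_measurable U"
    and f_bound: "\<And>x. x \<in> sphere 0 1 \<Longrightarrow> \<bar>f x\<bar> \<le> F"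
begin

lemma F_nonneg: "0 \<le> F" using f_bound[OF pole_sphere] by simp

lemma convolve_integrable:
  fixes w :: "real \<Rightarrow> real"
  assumes "continuous_on {-1..1} w" "x \<in> sphere 0 1"
  shows "integrable U (\<lambda>y. w (x \<bullet> y) * f y)"
proof -
  have "integrable U (\<lambda>y. w (y \<bullet> x) * f y)"
  proof -
    obtain M where "0 \<le> M" and M: "\<And>t. t \<in> {-1..1} \<Longrightarrow> \<bar>w t\<bar> \<le> M"
      using continuous_interval_bound[OF assms(1)] by blast
    have [measurable]: "(\<lambda>y. w (y \<bullet> x)) \<in> borel_measurable U"
      by (intro continuous_measurable zonal_continuous assms)
    have "\<bar>w (y \<bullet> x) * f y\<bar> \<le> M * F" if "y \<in> sphere 0 1" for y
      unfolding abs_mult using \<open>0 \<le> M\<close> M[OF inner_range[OF that assms(2)]] f_bound[OF that] by (intro mult_mono) auto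
    thus ?thesis by (intro bounded_integrable) measurable
  qed
  thus ?thesis by (simp add: inner_commute)
qed

lemma convolve_measurable:
  assumes "continuous_on {-1..1} w"
  shows "convolve w f \<in> borel_measurable U"
proof -
  note zonal_kernel_measurable[OF assms, measurable]
  show ?thesis unfolding convolve_def[abs_def] by measurable
qed

lemma convolve_bound:
  assumes w: "continuous_on {-1..1} w" "\<And>t. t \<in> {-1..1} \<Longrightarrow> \<bar>w t\<bar> \<le> M" and x: "x \<in> sphere 0 1"
  shows "\<bar>convolve w f x\<bar> \<le> M * F"
proof -
  have "0 \<le> M" using w(2)[of 0] by simp
  have "\<bar>convolve w f x\<bar> \<le> (LINT y|U. M * F)" unfolding convolve_def
  proof (rule integral_abs_le(2)[OF convolve_integrable[OF w(1) x]])
    fix y assume "y \<in> space U"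
    hence y: "y \<in> sphere 0 1" by (simp add: space_U)
    show "\<bar>w (x \<bullet> y) * f y\<bar> \<le> M * F"
      unfolding abs_mult using w(2)[OF inner_range[OF x y]] f_bound[OF y] \<open>0 \<le> M\<close> by (intro mult_mono) auto
  qed simp
  thus ?thesis by (simp add: prob_space)
qed

lemma convolve_bounded:
  fixes w :: "real \<Rightarrow> real"
  assumes "continuous_on {-1..1} w"
  obtains M where "0 \<le> M" "\<And>x. x \<in> sphere 0 1 \<Longrightarrow> \<bar>convolve w f x\<bar> \<le> M"
proof -
  obtain M where "0 \<le> M" and M: "\<And>t. t \<in> {-1..1} \<Longrightarrow> \<bar>w t\<bar> \<le> M"
    using continuous_interval_bound[OF assms] by blast
  hence "0 \<le> M * F" using F_nonneg by simp
  with that convolve_bound[OF assms M] show thesis by blast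
qed

lemma qform_integrable:
  assumes "continuous_on {-1..1} w" shows "integrable U (\<lambda>x. f x * convolve w f x)"
proof -
  obtain M where M: "0 \<le> M" "\<And>x. x \<in> sphere 0 1 \<Longrightarrow> \<bar>convolve w f x\<bar> \<le> M"
    using convolve_bounded[OF assms] by blast
  note convolve_measurable[OF assms, measurable]
  have "\<bar>f x * convolve w f x\<bar> \<le> F * M" if "x \<in> sphere 0 1" for x
    unfolding abs_mult using M f_bound that F_nonneg by (intro mult_mono) auto
  thus ?thesis by (intro bounded_integrable) measurable
qed

lemma qform_diff:
  assumes "continuous_on {-1..1} w" "continuous_on {-1..1} v"
  shows "qform (\<lambda>t. w t - v t) f = qform w f - qform v f"
proof -
  have "convolve (\<lambda>t. w t - v t) f x = convolve w f x - convolve v f x" if "x \<in> sphere 0 1" for x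
    unfolding convolve_def left_diff_distrib using convolve_integrable[OF _ that] assms by simp
  hence "qform (\<lambda>t. w t - v t) f = (LINT x|U. f x * convolve w f x - f x * convolve v f x)"
    unfolding qform_def by (intro Bochner_Integration.integral_cong) (auto simp: space_U right_diff_distrib)
  thus ?thesis unfolding qform_def using qform_integrable assms by simp
qed

lemma qform_bound:
  assumes "continuous_on {-1..1} w" "\<And>t. t \<in> {-1..1} \<Longrightarrow> \<bar>w t\<bar> \<le> e"
  shows "\<bar>qform w f\<bar> \<le> e * F * F"
proof -
  have "\<bar>qform w f\<bar> \<le> (LINT x|U. F * (e * F))" unfolding qform_def
  proof (rule integral_abs_le(2)[OF qform_integrable[OF assms(1)]])
    fix x assume "x \<in> space U"
    hence x: "x \<in> sphere 0 1" by (simp add: space_U)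
    show "\<bar>f x * convolve w f x\<bar> \<le> F * (e * F)"
      unfolding abs_mult using convolve_bound[OF assms x] f_bound[OF x] F_nonneg by (intro mult_mono) auto
  qed simp
  thus ?thesis by (simp add: prob_space mult_ac)
qed

lemma qform_poly_sum:
  "qform (poly (\<Sum>i\<in>A. smult (b i) (q i))) f = (\<Sum>i\<in>A. b i * qform (poly (q i)) f)"
proof -
  have c: "convolve (poly (\<Sum>i\<in>A. smult (b i) (q i))) f x = (\<Sum>i\<in>A. b i * convolve (poly (q i)) f x)"
    if "x \<in> sphere 0 1" for x
    unfolding convolve_def poly_sum poly_smult sum_distrib_right mult.assoc
    using convolve_integrable[OF poly_continuous that] by (simp add: Bochner_Integration.integral_sum)
  have "qform (poly (\<Sum>i\<in>A. smult (b i) (q i))) f = (LINT x|U. (\<Sum>i\<in>A. b i * (f x * convolve (poly (q i)) f x)))"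
    unfolding qform_def
    by (intro Bochner_Integration.integral_cong) (auto simp: space_U c sum_distrib_left mult_ac)
  also have "\<dots> = (\<Sum>i\<in>A. b i * qform (poly (q i)) f)"
    unfolding qform_def using qform_integrable[OF poly_continuous] by (simp add: Bochner_Integration.integral_sum)
  finally show ?thesis .
qed

text \<open>
  Composition of two convolution operators, tested on \<open>f\<close>: two exchanges of the order of
  integration.
\<close>

lemma convolution_product:
  assumes c: "\<And>x y. x \<in> sphere 0 1 \<Longrightarrow> y \<in> sphere 0 1 \<Longrightarrow> (LINT z|U. poly a (z \<bullet> x) * poly b (z \<bullet> y)) = poly c (x \<bullet> y)"
  shows "(LINT z|U. convolve (poly a) f z * convolve (poly b) f z) = qform (poly c) f"
proof -
  note convolve_measurable[OF poly_continuous, measurable]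
  obtain Ma where Ma: "0 \<le> Ma" "\<And>x y. x \<in> sphere 0 1 \<Longrightarrow> y \<in> sphere 0 1 \<Longrightarrow> \<bar>poly a (x \<bullet> (y :: real ^ 'n))\<bar> \<le> Ma"
    using poly_kernel_bounded by blast
  obtain Mb where Mb: "0 \<le> Mb" "\<And>x y. x \<in> sphere 0 1 \<Longrightarrow> y \<in> sphere 0 1 \<Longrightarrow> \<bar>poly b (x \<bullet> (y :: real ^ 'n))\<bar> \<le> Mb"
    using poly_kernel_bounded by blast
  obtain C where C: "0 \<le> C" "\<And>x. x \<in> sphere 0 1 \<Longrightarrow> \<bar>convolve (poly b) f x\<bar> \<le> C"
    using convolve_bounded[OF poly_continuous] by blast
  have "(LINT z|U. convolve (poly a) f z * convolve (poly b) f z)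
      = (LINT z|U. LINT x|U. poly a (z \<bullet> x) * f x * convolve (poly b) f z)"
    by (simp add: convolve_def)
  also have "\<dots> = (LINT x|U. LINT z|U. poly a (z \<bullet> x) * f x * convolve (poly b) f z)"
  proof (rule bounded_fubini)
    show "(\<lambda>(z, x). poly a (z \<bullet> x) * f x * convolve (poly b) f z) \<in> borel_measurable (U \<Otimes>\<^sub>M U)"
      using poly_kernel_measurable[of a] unfolding case_prod_beta' by measurable
    show "\<bar>poly a (z \<bullet> x) * f x * convolve (poly b) f z\<bar> \<le> Ma * F * C" if "z \<in> sphere 0 1" "x \<in> sphere 0 1" for z x
      unfolding abs_mult using Ma C f_bound F_nonneg that by (intro mult_mono mult_nonneg_nonneg) auto
  qed
  also have "\<dots> = (LINT x|U. f x * convolve (poly c) f x)"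
  proof (rule Bochner_Integration.integral_cong[OF refl])
    fix x assume "x \<in> space U"
    hence x: "x \<in> sphere 0 1" by (simp add: space_U)
    have "(LINT z|U. poly a (z \<bullet> x) * f x * convolve (poly b) f z)
        = (LINT z|U. f x * (poly a (z \<bullet> x) * convolve (poly b) f z))" by (simp only: mult_ac)
    also have "\<dots> = f x * (LINT z|U. poly a (z \<bullet> x) * convolve (poly b) f z)" by simp
    also have "(LINT z|U. poly a (z \<bullet> x) * convolve (poly b) f z)
        = (LINT z|U. LINT y|U. poly a (z \<bullet> x) * (poly b (z \<bullet> y) * f y))" by (simp add: convolve_def)
    also have "(LINT z|U. LINT y|U. poly a (z \<bullet> x) * (poly b (z \<bullet> y) * f y))
        = (LINT y|U. LINT z|U. poly a (z \<bullet> x) * (poly b (z \<bullet> y) * f y))"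
    proof (rule bounded_fubini)
      have [measurable]: "(\<lambda>z. poly a (z \<bullet> x)) \<in> borel_measurable U"
        by (intro continuous_measurable poly_zonal_continuous)
      show "(\<lambda>(z, y). poly a (z \<bullet> x) * (poly b (z \<bullet> y) * f y)) \<in> borel_measurable (U \<Otimes>\<^sub>M U)"
        using poly_kernel_measurable[of b] unfolding case_prod_beta' by measurable
      show "\<bar>poly a (z \<bullet> x) * (poly b (z \<bullet> y) * f y)\<bar> \<le> Ma * (Mb * F)" if "z \<in> sphere 0 1" "y \<in> sphere 0 1" for z y
        unfolding abs_mult using Ma Mb f_bound F_nonneg x that by (intro mult_mono mult_nonneg_nonneg) auto
    qed
    also have "\<dots> = (LINT y|U. LINT z|U. f y * (poly a (z \<bullet> x) * poly b (z \<bullet> y)))" by (simp add: mult_ac)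
    also have "\<dots> = (LINT y|U. f y * poly c (x \<bullet> y))"
      by (rule Bochner_Integration.integral_cong[OF refl]) (simp add: space_U c[OF x])
    also have "\<dots> = convolve (poly c) f x" by (simp add: convolve_def mult.commute)
    finally show "(LINT z|U. poly a (z \<bullet> x) * f x * convolve (poly b) f z) = f x * convolve (poly c) f x" .
  qed
  also have "\<dots> = qform (poly c) f" by (simp add: qform_def)
  finally show ?thesis .
qed

text \<open>
  By Funk-Hecke the convolution with \<open>C\<^sub>k\<close> is a positive multiple of its own square, so
  the quadratic form is a positive multiple of an integral of a square.
\<close>

lemma qform_gegen_nonneg: "0 \<le> qform (poly (gegen k)) f"
proof -
  have "(LINT z|U. convolve (poly (gegen k)) f z * convolve (poly (gegen k)) f z)
      = qform (poly (smult (gegen_eigenvalue k) (gegen k))) f"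
    by (rule convolution_product) (simp add: funk_hecke_poly del: poly_gegen_poly)
  also have "\<dots> = gegen_eigenvalue k * qform (poly (gegen k)) f"
    using qform_poly_sum[of "\<lambda>_. gegen_eigenvalue k" "\<lambda>_. gegen k" "{()}"] by simp
  finally have "(LINT z|U. convolve (poly (gegen k)) f z * convolve (poly (gegen k)) f z)
      = gegen_eigenvalue k * qform (poly (gegen k)) f" .
  moreover have "0 \<le> (LINT z|U. convolve (poly (gegen k)) f z * convolve (poly (gegen k)) f z)" by simp
  ultimately have "0 \<le> gegen_eigenvalue k * qform (poly (gegen k)) f" by linarith
  thus ?thesis using gegen_eigenvalue_pos[of k] by (simp add: zero_le_mult_iff)
qed

text \<open>
  The kernel \<open>q\<close> reproduces itself under convolution, so convolution with \<open>q\<close> is an orthogonal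
  projection and \<open>\<parallel>f - g\<parallel>\<^sup>2 \<ge> 0\<close> for the projection \<open>g\<close> of \<open>f\<close> is the claim.
\<close>

lemma bessel: "(\<Sum>k\<le>N. qform (poly (gegen k)) f / gegen_eigenvalue k) \<le> (LINT x|U. (f x)\<^sup>2)"
proof -
  define q where "q = (\<Sum>i\<le>N. smult (1 / gegen_eigenvalue i) (gegen i))"
  define g where "g = convolve (poly q) f"
  have q1: "coefficient (poly q) i = 1" if "i \<le> N" for i
    using that gegen_eigenvalue_pos[of i] by (simp add: q_def coefficient_expansion)
  have "(LINT z|U. g z * g z) = qform (poly q) f" unfolding g_def
  proof (rule convolution_product)
    fix x y :: "real ^ 'n" assume xy: "x \<in> sphere 0 1" "y \<in> sphere 0 1"
    have "(LINT z|U. poly q (z \<bullet> x) * poly q (z \<bullet> y))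
        = (LINT z|U. (\<Sum>i\<le>N. 1 / gegen_eigenvalue i * (poly q (z \<bullet> x) * poly (gegen i) (z \<bullet> y))))"
      by (subst (2) q_def) (simp add: poly_sum sum_distrib_left sum_distrib_right mult_ac del: poly_gegen_poly)
    also have "\<dots> = (\<Sum>i\<le>N. 1 / gegen_eigenvalue i * (LINT z|U. poly q (z \<bullet> x) * poly (gegen i) (z \<bullet> y)))"
    proof -
      have "integrable U (\<lambda>z. poly q (z \<bullet> x) * poly (gegen i) (z \<bullet> y))" for i
        by (intro continuous_integrable kernel_continuous[OF poly_continuous xy(1)])
      thus ?thesis by (simp add: Bochner_Integration.integral_sum del: poly_gegen_poly)
    qed
    also have "\<dots> = (\<Sum>i\<le>N. 1 / gegen_eigenvalue i * poly (gegen i) (x \<bullet> y))"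
      by (rule sum.cong) (auto simp: funk_hecke_poly[OF xy] q1 simp del: poly_gegen_poly)
    also have "\<dots> = poly q (x \<bullet> y)" by (simp add: q_def poly_sum del: poly_gegen_poly)
    finally show "(LINT z|U. poly q (z \<bullet> x) * poly q (z \<bullet> y)) = poly q (x \<bullet> y)" .
  qed
  moreover have "(LINT x|U. f x * g x) = qform (poly q) f" by (simp add: g_def qform_def)
  moreover have "0 \<le> (LINT x|U. (f x - g x)\<^sup>2)" by simp
  moreover have "(LINT x|U. (f x - g x)\<^sup>2) = (LINT x|U. (f x)\<^sup>2) - 2 * (LINT x|U. f x * g x) + (LINT x|U. g x * g x)"
  proof -
    have [measurable]: "g \<in> borel_measurable U" unfolding g_def by (rule convolve_measurable[OF poly_continuous])
    obtain M where M: "0 \<le> M" "\<And>x. x \<in> sphere 0 1 \<Longrightarrow> \<bar>g x\<bar> \<le> M"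
      using convolve_bounded[OF poly_continuous] unfolding g_def by blast
    have "\<bar>(f x)\<^sup>2\<bar> \<le> F\<^sup>2" if "x \<in> sphere 0 1" for x
      using f_bound[OF that] by (simp add: abs_le_square_iff[symmetric] F_nonneg)
    hence 1: "integrable U (\<lambda>x. (f x)\<^sup>2)" by (intro bounded_integrable) measurable
    have "\<bar>g x * g x\<bar> \<le> M * M" if "x \<in> sphere 0 1" for x
      unfolding abs_mult using M that by (intro mult_mono) auto
    hence 2: "integrable U (\<lambda>x. g x * g x)" by (intro bounded_integrable) measurable
    have 3: "integrable U (\<lambda>x. f x * g x)" unfolding g_def by (rule qform_integrable[OF poly_continuous])
    have "(LINT x|U. (f x - g x)\<^sup>2) = (LINT x|U. (f x)\<^sup>2 - 2 * (f x * g x) + g x * g x)"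
      by (simp add: power2_eq_square algebra_simps)
    also have "\<dots> = (LINT x|U. (f x)\<^sup>2) - 2 * (LINT x|U. f x * g x) + (LINT x|U. g x * g x)"
      using 1 2 3 by simp
    finally show ?thesis .
  qed
  ultimately have "qform (poly q) f \<le> (LINT x|U. (f x)\<^sup>2)" by linarith
  thus ?thesis unfolding q_def qform_poly_sum by simp
qed

text \<open>
  For a polynomial kernel the form is the sum of the coefficients times the squared norms
  \<open>n2 k\<close> of the projections of \<open>f\<close>; the term of index 0 vanishes as \<open>f\<close> has mean zero, and Bessel's
  inequality bounds the sum of the others. Uniform approximation of \<open>w\<close> costs an error of order \<open>e\<close>.
\<close>

theorem spectral_bound:
  assumes w: "continuous_on {-1..1} w" and mean: "(LINT x|U. f x) = 0"
    and v: "v \<le> 0" "\<And>k. 1 \<le> k \<Longrightarrow> v \<le> coefficient w k"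
  shows "v * (LINT x|U. (f x)\<^sup>2) \<le> qform w f"
proof (rule field_le_epsilon)
  fix \<epsilon> :: real assume \<epsilon>: "0 < \<epsilon>"
  define N2 where "N2 = (LINT x|U. (f x)\<^sup>2)"
  have N2: "0 \<le> N2" by (simp add: N2_def)
  define A where "A = N2 + F * F + 1"
  have A: "1 \<le> A" using N2 F_nonneg by (simp add: A_def)
  define e where "e = \<epsilon> / A"
  have e: "0 < e" using \<epsilon> A by (simp add: e_def)
  obtain q where q: "\<And>t. t \<in> {-1..1} \<Longrightarrow> \<bar>w t - poly q t\<bar> < e" using polynomial_approximation[OF w e] by blast
  have d: "continuous_on {-1..1} (\<lambda>t. w t - poly q t)" by (intro continuous_intros w)
  have b: "\<And>t. t \<in> {-1..1} \<Longrightarrow> \<bar>w t - poly q t\<bar> \<le> e" using q by force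
  obtain c where c: "q = (\<Sum>i\<le>degree q. smult (c i) (gegen i))" using gegen_basis[OF gindex_pos order_refl] by blast
  define N where "N = degree q"
  define n2 where "n2 k = qform (poly (gegen k)) f / gegen_eigenvalue k" for k
  have n2: "0 \<le> n2 k" for k
    unfolding n2_def by (intro divide_nonneg_pos qform_gegen_nonneg gegen_eigenvalue_pos)
  have n20: "n2 0 = 0" using mean by (simp add: n2_def qform_def convolve_def)
  have "qform (poly q) f = (\<Sum>i\<le>N. c i * qform (poly (gegen i)) f)"
    unfolding N_def by (subst c) (rule qform_poly_sum)
  also have "\<dots> = (\<Sum>i\<le>N. coefficient (poly q) i * n2 i)"
  proof (rule sum.cong[OF refl])
    fix i assume "i \<in> {..N}"
    hence "coefficient (poly q) i = c i * gegen_eigenvalue i"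
      using coefficient_expansion[of c N i] c by (simp add: N_def)
    thus "c i * qform (poly (gegen i)) f = coefficient (poly q) i * n2 i"
      using gegen_eigenvalue_pos[of i] by (simp add: n2_def)
  qed
  also have "\<dots> \<ge> (\<Sum>i\<le>N. (v - e) * n2 i)"
  proof (rule sum_mono)
    fix i
    show "(v - e) * n2 i \<le> coefficient (poly q) i * n2 i"
    proof (cases "i = 0")
      case False
      have "\<bar>coefficient (\<lambda>t. w t - poly q t) i\<bar> \<le> e" by (rule coefficient_bound[OF d b])
      hence "v - e \<le> coefficient (poly q) i"
        using coefficient_diff[OF w poly_continuous, of q i] v(2)[of i] False by auto
      thus ?thesis using n2 by (intro mult_right_mono)
    qed (simp add: n20)
  qed
  finally have "(v - e) * (\<Sum>i\<le>N. n2 i) \<le> qform (poly q) f" by (simp add: sum_distrib_left)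
  moreover have "(v - e) * N2 \<le> (v - e) * (\<Sum>i\<le>N. n2 i)"
    using bessel[of N] v(1) e by (intro mult_left_mono_neg) (auto simp: N2_def n2_def)
  moreover have "\<bar>qform w f - qform (poly q) f\<bar> \<le> e * F * F"
    using qform_bound[OF d b] qform_diff[OF w poly_continuous] by simp
  ultimately have "v * N2 \<le> qform w f + e * (N2 + F * F)" by (simp add: algebra_simps abs_le_iff)
  also have "e * (N2 + F * F) \<le> e * A" using e by (intro mult_left_mono) (auto simp: A_def)
  also have "e * A = \<epsilon>" using A by (simp add: e_def)
  finally show "v * (LINT x|U. (f x)\<^sup>2) \<le> qform w f + \<epsilon>" by (simp add: N2_def)
qed

end

end

section \<open>Gegenbauer coefficients as means over the sphere\<close>

context rotation_invariant_sphere
begin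

definition weight :: "real \<Rightarrow> real" where "weight t = sqrt (1 - t\<^sup>2) ^ (n - 3)"

definition weight_mean :: "(real \<Rightarrow> real) \<Rightarrow> real" where
  "weight_mean f = (LBINT t:{-1..1}. f t * weight t)"

lemma weight_continuous: "continuous_on A weight"
  unfolding weight_def by (intro continuous_intros)

lemma weight_nonneg: "t \<in> {-1..1} \<Longrightarrow> 0 \<le> weight t"
  unfolding weight_def by (intro zero_le_power real_sqrt_ge_zero) (auto simp: abs_square_le_1 abs_le_iff)

lemma weight_integrable:
  assumes "continuous_on {-1..1} f" shows "set_integrable lborel {-1..1} (\<lambda>t. f t * weight t :: real)"
  by (intro borel_integrable_atLeastAtMost' continuous_on_mult assms weight_continuous)

lemma weight_mean_add:
  "continuous_on {-1..1} f \<Longrightarrow> continuous_on {-1..1} g \<Longrightarrow> weight_mean (\<lambda>t. f t + g t) = weight_mean f + weight_mean g"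
  unfolding weight_mean_def distrib_right by (intro set_integral_add weight_integrable)

lemma weight_mean_diff:
  "continuous_on {-1..1} f \<Longrightarrow> continuous_on {-1..1} g \<Longrightarrow> weight_mean (\<lambda>t. f t - g t) = weight_mean f - weight_mean g"
  unfolding weight_mean_def left_diff_distrib by (intro set_integral_diff weight_integrable)

lemma weight_mean_scale: "weight_mean (\<lambda>t. c * f t) = c * weight_mean f"
  unfolding weight_mean_def mult.assoc by simp

text \<open>
  The integral over \<open>[-1, 1]\<close> of the derivative of \<open>t\<^sup>j (1 - t\<^sup>2)\<^bsup>(n-1)/2\<^esup>\<close>, which vanishes at
  both end points. With \<open>j\<close> shifted by one it is the recurrence satisfied by the moments of a
  coordinate on the sphere.
\<close>

lemma weight_mean_by_parts:
  "weight_mean (\<lambda>t. real j * t ^ (j - 1) * (1 - t\<^sup>2) - (dim - 1) * t ^ (j + 1)) = 0"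
proof -
  let ?G = "\<lambda>t. t ^ j * sqrt (1 - t\<^sup>2) ^ (n - 1)"
  let ?g = "\<lambda>t. (real j * t ^ (j - 1) * (1 - t\<^sup>2) - (dim - 1) * t ^ (j + 1)) * weight t"
  define m where "m = n - 3"
  have wt: "weight t = sqrt (1 - t\<^sup>2) ^ m" for t by (simp add: weight_def m_def)
  have m: "n = m + 3" using dim_ge_3 by (simp add: m_def)
  have "(?g has_integral (?G 1 - ?G (-1))) {-1..1}"
  proof (rule fundamental_theorem_of_calculus_interior)
    show "continuous_on {-1..1} ?G" by (intro continuous_intros)
    fix t :: real assume t: "t \<in> {-1<..<1}"
    hence p: "0 < 1 - t\<^sup>2" by (simp add: abs_square_less_1 abs_less_iff)
    define s where "s = sqrt (1 - t\<^sup>2)"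
    have s: "0 < s" "s * s = 1 - t\<^sup>2" using p by (auto simp: s_def)
    have D: "((\<lambda>t. sqrt (1 - t\<^sup>2)) has_real_derivative (- t / s)) (at t)"
      using p by (auto intro!: derivative_eq_intros simp: s_def field_simps)
    have "((\<lambda>t. sqrt (1 - t\<^sup>2) ^ (m + 2)) has_real_derivative (real (m + 2) * s ^ (m + 1) * (- t / s))) (at t)"
      using DERIV_power[OF D, of "m + 2"] by (simp add: s_def mult_ac)
    from DERIV_mult[OF DERIV_pow[of j t] this] have "((\<lambda>t. t ^ j * sqrt (1 - t\<^sup>2) ^ (m + 2)) has_real_derivative
        (real j * t ^ (j - 1)) * s ^ (m + 2) + (real (m + 2) * s ^ (m + 1) * (- t / s)) * t ^ j) (at t)"
      by (simp add: s_def)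
    also have "s ^ (m + 2) = (1 - t\<^sup>2) * s ^ m" using s(2) by (simp add: power_add power2_eq_square)
    also have "real (m + 2) * s ^ (m + 1) * (- t / s) = - (real (m + 2) * t * s ^ m)" using s(1) by simp
    also have "(real j * t ^ (j - 1)) * ((1 - t\<^sup>2) * s ^ m) + - (real (m + 2) * t * s ^ m) * t ^ j = ?g t"
      unfolding wt s_def by (simp add: m algebra_simps)
    finally show "(?G has_vector_derivative ?g t) (at t)"
      by (simp add: m has_real_derivative_iff_has_vector_derivative)
  qed auto
  hence "integral {-1..1} ?g = 0" using m by (simp add: integral_unique)
  moreover have "set_integrable lborel {-1..1} ?g" by (intro weight_integrable continuous_intros)
  ultimately show ?thesis unfolding weight_mean_def by (simp add: set_borel_integral_eq_integral)
qed

lemma weight_mean_power: "weight_mean (\<lambda>t. t ^ j) = weight_mean (\<lambda>_. 1) * moment j"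
proof (induction j rule: induct_nat_012)
  case 0
  show ?case by simp
next
  case 1
  have "(\<lambda>t. real 0 * t ^ (0 - 1) * (1 - t\<^sup>2) - (dim - 1) * t ^ (0 + 1)) = (\<lambda>t. - (dim - 1) * t)"
    by (auto simp: algebra_simps)
  hence "- (dim - 1) * weight_mean (\<lambda>t. t) = 0"
    using weight_mean_by_parts[of 0] by (simp only: weight_mean_scale)
  thus ?case using dim_ge_3 by (simp add: moment_odd)
next
  case (ge2 j)
  define J where "J i = weight_mean (\<lambda>t. t ^ i)" for i
  have "weight_mean (\<lambda>t. (real j + 1) * t ^ j - (dim + real j) * t ^ (j + 2)) = 0"
    using weight_mean_by_parts[of "Suc j"] by (simp add: algebra_simps power2_eq_square)
  moreover have "weight_mean (\<lambda>t. (real j + 1) * t ^ j - (dim + real j) * t ^ (j + 2)) = (real j + 1) * J j - (dim + real j) * J (j + 2)"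
    unfolding J_def by (subst weight_mean_diff) (auto intro!: continuous_intros simp: weight_mean_scale)
  ultimately have "(dim + real j) * J (j + 2) = (real j + 1) * J j" by simp
  also have "\<dots> = weight_mean (\<lambda>_. 1) * ((real j + 1) * moment j)" using ge2(1) by (simp add: J_def)
  also have "\<dots> = weight_mean (\<lambda>_. 1) * ((dim + real j) * moment (j + 2))" by (simp only: moment_recurrence)
  also have "\<dots> = (dim + real j) * (weight_mean (\<lambda>_. 1) * moment (j + 2))" by (simp only: mult_ac)
  finally have "J (j + 2) = weight_mean (\<lambda>_. 1) * moment (j + 2)" using dim_ge_3 by (subst (asm) mult_left_cancel) auto
  thus ?case by (simp add: J_def)
qed

lemma weight_mean_poly: "weight_mean (poly q) = weight_mean (\<lambda>_. 1) * zmean q"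
proof -
  have s: "weight_mean (\<lambda>t. \<Sum>i\<in>A. c i * t ^ i) = (\<Sum>i\<in>A. c i * weight_mean (\<lambda>t. t ^ i))" if "finite A" for A and c :: "nat \<Rightarrow> real"
    using that
  proof (induction A rule: finite_induct)
    case empty
    show ?case by (simp add: weight_mean_def)
  next
    case (insert i A)
    thus ?case by (simp add: weight_mean_add[where f = "\<lambda>t. c i * t ^ i"] weight_mean_scale continuous_intros)
  qed
  have "weight_mean (poly q) = (\<Sum>i\<le>degree q. coeff q i * weight_mean (\<lambda>t. t ^ i))"
    using s[of "{..degree q}" "coeff q"] by (simp add: poly_altdef[abs_def])
  also have "\<dots> = weight_mean (\<lambda>_. 1) * (\<Sum>i\<le>degree q. coeff q i * moment i)"
    by (simp add: weight_mean_power sum_distrib_left mult_ac)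
  also have "(\<Sum>i\<le>degree q. coeff q i * moment i) = zmean q"
  proof -
    have "zmean q = zmean (\<Sum>i\<le>degree q. monom (coeff q i) i)" by (simp add: poly_as_sum_of_monoms)
    thus ?thesis by (simp only: zmean_sum zmean_monom)
  qed
  finally show ?thesis .
qed

lemma weight_mean_1_nonneg: "0 \<le> weight_mean (\<lambda>_. 1)"
  unfolding weight_mean_def set_lebesgue_integral_def
  by (intro Bochner_Integration.integral_nonneg) (auto simp: indicator_def weight_nonneg)

lemma weight_mean_bound:
  assumes "continuous_on {-1..1} f" "\<And>t. t \<in> {-1..1} \<Longrightarrow> \<bar>f t\<bar> \<le> e"
  shows "\<bar>weight_mean f\<bar> \<le> e * weight_mean (\<lambda>_. 1)"
proof -
  have "\<bar>weight_mean f\<bar> \<le> weight_mean (\<lambda>_. e * 1)" unfolding weight_mean_def set_lebesgue_integral_def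
  proof (rule integral_abs_le(2))
    show "integrable lborel (\<lambda>x. indicat_real {- 1..1} x *\<^sub>R (f x * weight x))"
      using weight_integrable[OF assms(1)] unfolding set_integrable_def .
    show "integrable lborel (\<lambda>x. indicat_real {- 1..1} x *\<^sub>R (e * 1 * weight x))"
      using weight_integrable[of "\<lambda>_. e * 1"] unfolding set_integrable_def by simp
    show "\<bar>indicat_real {- 1..1} x *\<^sub>R (f x * weight x)\<bar> \<le> indicat_real {- 1..1} x *\<^sub>R (e * 1 * weight x)" for x
      using assms(2)[of x] weight_nonneg[of x] by (auto simp: indicator_def abs_mult intro!: mult_mono)
  qed
  thus ?thesis unfolding weight_mean_scale .
qed

text \<open>
  Equality of moments and the Weierstrass theorem determine the distribution of a
  coordinate on the sphere.
\<close>

lemma weight_mean_zonal: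
  fixes f :: "real \<Rightarrow> real"
  assumes f: "continuous_on {-1..1} f"
  shows "weight_mean f = weight_mean (\<lambda>_. 1) * (LINT y|U. f (y \<bullet> pole))"
proof -
  define J where "J = weight_mean (\<lambda>_. 1)"
  have J: "0 \<le> J" by (simp add: J_def weight_mean_1_nonneg)
  have "\<bar>weight_mean f - J * (LINT y|U. f (y \<bullet> pole))\<bar> \<le> 0"
  proof (rule field_le_epsilon)
    fix \<epsilon> :: real assume \<epsilon>: "0 < \<epsilon>"
    define e where "e = \<epsilon> / (2 * J + 1)"
    have e: "0 < e" using \<epsilon> J by (simp add: e_def)
    obtain q where q: "\<And>t. t \<in> {-1..1} \<Longrightarrow> \<bar>f t - poly q t\<bar> < e" using polynomial_approximation[OF f e] by blast
    have d: "continuous_on {-1..1} (\<lambda>t. f t - poly q t)" by (intro continuous_intros f)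
    have b: "\<And>t. t \<in> {-1..1} \<Longrightarrow> \<bar>f t - poly q t\<bar> \<le> e" using q by force
    have "\<bar>weight_mean f - weight_mean (poly q)\<bar> \<le> e * J"
      using weight_mean_bound[OF d b] weight_mean_diff[OF f poly_continuous] by (simp add: J_def)
    moreover have "\<bar>LINT y|U. f (y \<bullet> pole) - poly q (y \<bullet> pole)\<bar> \<le> e"
      using kernel_integral_bound[OF d b, of 1 pole 1 pole] pole_sphere by simp
    moreover have "(LINT y|U. f (y \<bullet> pole) - poly q (y \<bullet> pole)) = (LINT y|U. f (y \<bullet> pole)) - zmean q"
      unfolding zmean_def
      by (intro Bochner_Integration.integral_diff continuous_integrable zonal_continuous f pole_sphere poly_continuous)
    ultimately have "\<bar>weight_mean f - J * zmean q\<bar> \<le> e * J" "J * \<bar>(LINT y|U. f (y \<bullet> pole)) - zmean q\<bar> \<le> J * e"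
      using J by (auto simp: weight_mean_poly J_def[symmetric] intro!: mult_left_mono)
    moreover have "J * \<bar>(LINT y|U. f (y \<bullet> pole)) - zmean q\<bar> = \<bar>J * (LINT y|U. f (y \<bullet> pole)) - J * zmean q\<bar>"
      using J by (simp add: abs_mult flip: right_diff_distrib)
    ultimately have "\<bar>weight_mean f - J * (LINT y|U. f (y \<bullet> pole))\<bar> \<le> e * (2 * J)" by (simp add: algebra_simps)
    also have "\<dots> \<le> e * (2 * J + 1)" using e by simp
    also have "\<dots> = \<epsilon>" using J by (simp add: e_def)
    finally show "\<bar>weight_mean f - J * (LINT y|U. f (y \<bullet> pole))\<bar> \<le> 0 + \<epsilon>" by simp
  qed
  thus ?thesis by (simp add: J_def)
qed

lemma weight_mean_1: "weight_mean (\<lambda>_. 1) = sqrt pi * Gamma ((dim - 1) / 2) / Gamma (dim / 2)"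
proof -
  define m where "m = n - 3"
  have wt: "weight t = sqrt (1 - t\<^sup>2) ^ m" for t by (simp add: weight_def m_def)
  have m: "n = m + 3" using dim_ge_3 by (simp add: m_def)
  have "weight_mean (\<lambda>_. 1) = (LINT x|lborel. indicator {-1..1} x * sqrt (1 - x\<^sup>2) ^ m)"
    unfolding weight_mean_def set_lebesgue_integral_def wt by simp
  also have "\<dots> = enn2real (\<integral>\<^sup>+ x. ennreal (indicator {-1..1} x * sqrt (1 - x\<^sup>2) ^ m) \<partial>lborel)"
    by (rule integral_eq_nn_integral) (auto simp: indicator_def abs_square_le_1 abs_le_iff intro!: AE_I2 zero_le_power)
  also have "(\<integral>\<^sup>+ x. ennreal (indicator {-1..1} x * sqrt (1 - x\<^sup>2) ^ m) \<partial>lborel) = ennreal (Beta (1 / 2) (real m / 2 + 1))"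
    using emeasure_cball_aux_integral[of m] by simp
  also have "Beta (1 / 2) (real m / 2 + 1) = sqrt pi * Gamma ((dim - 1) / 2) / Gamma (dim / 2)"
    by (simp add: Beta_def Gamma_one_half_real m add_divide_distrib add_ac)
  also have "enn2real (ennreal (sqrt pi * Gamma ((dim - 1) / 2) / Gamma (dim / 2))) = sqrt pi * Gamma ((dim - 1) / 2) / Gamma (dim / 2)"
    using dim_ge_3 by (intro enn2real_ennreal) (auto intro!: divide_nonneg_nonneg mult_nonneg_nonneg Gamma_real_nonneg)
  finally show ?thesis .
qed

text \<open>
  The two weights differ at most at the end points: for \<open>n = 3\<close> the power with exponent 0
  is 0 there.
\<close>

theorem gegenbauer_coeff_eq:
  fixes w :: "real \<Rightarrow> real"
  assumes w: "continuous_on {-1..1} w"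
  shows "gegenbauer_coeff n w k = coefficient w k"
proof -
  define c where "c = poly (gegen k) 1"
  let ?g = "\<lambda>t. gegenbauer gindex k t"
  have pw: "(1 - t\<^sup>2) powr ((dim - 3) / 2) = weight t" if "t \<in> {-1<..<1}" for t :: real
  proof -
    have p: "0 < 1 - t\<^sup>2" using that by (simp add: abs_square_less_1 abs_less_iff)
    have "(1 - t\<^sup>2) powr ((dim - 3) / 2) = ((1 - t\<^sup>2) powr (1 / 2)) powr real (n - 3)"
      using dim_ge_3 by (simp add: powr_powr of_nat_diff)
    also have "\<dots> = weight t" using p by (simp add: powr_half_sqrt powr_realpow weight_def)
    finally show ?thesis .
  qed
  have "(LBINT t:{-1..1}. w t * (?g t / ?g 1) * (1 - t\<^sup>2) powr ((dim - 3) / 2))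
      = (LBINT t:{-1..1}. (1 / c * (w t * poly (gegen k) t)) * weight t)"
    unfolding set_lebesgue_integral_def
  proof (rule integral_cong_AE)
    have cg: "continuous_on {-1..1} ?g" using poly_continuous[of "{-1..1}" "gegen k"] by simp
    have m: "(\<lambda>t. indicator {-1..1} t *\<^sub>R (w t * (?g t / ?g 1))) \<in> borel_measurable borel"
      by (rule borel_measurable_continuous_on_indicator)
         (auto intro!: continuous_intros w cg simp: gegenbauer_at_1_pos[OF gindex_pos, THEN less_imp_neq[THEN not_sym]])
    have "(\<lambda>t. (indicator {-1..1} t *\<^sub>R (w t * (?g t / ?g 1))) * (1 - t\<^sup>2) powr ((dim - 3) / 2)) \<in> borel_measurable borel"
      by (intro borel_measurable_times m) measurable
    thus "(\<lambda>t. indicator {-1..1} t *\<^sub>R (w t * (?g t / ?g 1) * (1 - t\<^sup>2) powr ((dim - 3) / 2))) \<in> borel_measurable lborel"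
      by (simp add: mult_ac)
    show "(\<lambda>t. indicator {-1..1} t *\<^sub>R ((1 / c * (w t * poly (gegen k) t)) * weight t)) \<in> borel_measurable lborel"
      by (rule borel_measurable_integrable[OF weight_integrable[unfolded set_integrable_def]])
         (intro continuous_on_mult continuous_on_const w poly_continuous)
    have "AE t in lborel. t \<noteq> (-1 :: real)" "AE t in lborel. t \<noteq> (1 :: real)" by (auto intro: AE_lborel_singleton)
    thus "AE t in lborel. indicator {-1..1} t *\<^sub>R (w t * (?g t / ?g 1) * (1 - t\<^sup>2) powr ((dim - 3) / 2))
        = indicator {-1..1} t *\<^sub>R ((1 / c * (w t * poly (gegen k) t)) * weight t)"
    proof eventually_elim
      case (elim t)
      thus ?case using pw[of t] by (auto simp: indicator_def c_def)
    qed
  qed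
  also have "\<dots> = weight_mean (\<lambda>t. 1 / c * (w t * poly (gegen k) t))" by (simp add: weight_mean_def)
  also have "\<dots> = 1 / c * weight_mean (\<lambda>t. w t * poly (gegen k) t)" by (rule weight_mean_scale)
  also have "weight_mean (\<lambda>t. w t * poly (gegen k) t)
      = weight_mean (\<lambda>_. 1) * (LINT y|U. w (y \<bullet> pole) * poly (gegen k) (y \<bullet> pole))"
    by (intro weight_mean_zonal continuous_on_mult w poly_continuous)
  also have "1 / c * \<dots> = weight_mean (\<lambda>_. 1) * coefficient w k" by (simp add: coefficient_def c_def)
  finally have E: "(LBINT t:{-1..1}. w t * (?g t / ?g 1) * (1 - t\<^sup>2) powr ((dim - 3) / 2))
      = weight_mean (\<lambda>_. 1) * coefficient w k" .
  have "0 < Gamma (dim / 2)" "0 < Gamma ((dim - 1) / 2)"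
    using dim_ge_3 by (auto intro!: Gamma_real_pos)
  thus ?thesis unfolding gegenbauer_coeff_def E weight_mean_1 by simp
qed

lemma gegen_expansion_product:
  assumes "finite L"
  shows "zmean ((\<Sum>l\<in>L. smult (b l) (gegen l)) * (\<Sum>l\<in>L. smult (c l) (gegen l)))
    = (\<Sum>l\<in>L. b l * c l * zmean (gegen l * gegen l))"
proof -
  have "zmean ((\<Sum>l\<in>L. smult (b l) (gegen l)) * (\<Sum>l\<in>L. smult (c l) (gegen l)))
      = (\<Sum>l\<in>L. \<Sum>m\<in>L. b l * (c m * zmean (gegen l * gegen m)))"
    by (simp only: sum_product mult_smult_left mult_smult_right zmean_sum zmean_smult) (simp only: mult_ac)
  also have "\<dots> = (\<Sum>l\<in>L. \<Sum>m\<in>L. if m = l then b l * (c l * zmean (gegen l * gegen l)) else 0)"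
    by (intro sum.cong refl) (auto simp: gegen_orthogonal)
  also have "\<dots> = (\<Sum>l\<in>L. b l * c l * zmean (gegen l * gegen l))"
    using assms by (simp add: mult.assoc)
  finally show ?thesis .
qed

text \<open>
  By Funk-Hecke each zonal harmonic is an eigenfunction of the convolution with \<open>w\<close>, and
  harmonics of different index are orthogonal.
\<close>

lemma zonal_expansion:
  fixes w :: "real \<Rightarrow> real" and b :: "nat \<Rightarrow> real"
  assumes w: "continuous_on {-1..1} w" and L: "finite L" "L \<subseteq> {1..}"
  defines "u \<equiv> \<lambda>x :: real ^ 'n. \<Sum>l\<in>L. b l * poly (gegen l) (x \<bullet> pole)"
  shows "(LINT x|U. u x) = 0"
    "(LINT x|U. (u x)\<^sup>2) = (\<Sum>l\<in>L. (b l)\<^sup>2 * zmean (gegen l * gegen l))"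
    "qform w u = (\<Sum>l\<in>L. coefficient w l * ((b l)\<^sup>2 * zmean (gegen l * gegen l)))"
proof -
  define q where "q = (\<Sum>l\<in>L. smult (b l) (gegen l))"
  have u: "u x = poly q (x \<bullet> pole)" for x by (simp add: u_def q_def poly_sum)
  have "(LINT x|U. u x) = zmean q" by (simp add: u zmean_def)
  also have "\<dots> = (\<Sum>l\<in>L. b l * zmean (gegen l * gegen 0))" by (simp add: q_def zmean_sum zmean_smult)
  also have "\<dots> = 0" using L(2) by (intro sum.neutral) (auto simp: gegen_orthogonal simp del: gegen_poly.simps)
  finally show "(LINT x|U. u x) = 0" .
  have "(LINT x|U. (u x)\<^sup>2) = zmean (q * q)" by (simp add: u zmean_def power2_eq_square)
  thus "(LINT x|U. (u x)\<^sup>2) = (\<Sum>l\<in>L. (b l)\<^sup>2 * zmean (gegen l * gegen l))"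
    unfolding q_def gegen_expansion_product[OF L(1)] by (simp add: power2_eq_square)
  have conv: "convolve w u x = poly (\<Sum>l\<in>L. smult (b l * coefficient w l) (gegen l)) (x \<bullet> pole)"
    if x: "x \<in> sphere 0 1" for x
  proof -
    have "convolve w u x = (LINT y|U. (\<Sum>l\<in>L. b l * (w (y \<bullet> x) * poly (gegen l) (y \<bullet> pole))))"
      unfolding convolve_def u_def by (simp add: sum_distrib_left inner_commute[of x] mult_ac del: poly_gegen_poly)
    also have "\<dots> = (\<Sum>l\<in>L. b l * (LINT y|U. w (y \<bullet> x) * poly (gegen l) (y \<bullet> pole)))"
    proof -
      have "integrable U (\<lambda>y. w (y \<bullet> x) * poly (gegen l) (y \<bullet> pole))" for l
        by (intro continuous_integrable kernel_continuous w x)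
      thus ?thesis by (simp add: Bochner_Integration.integral_sum del: poly_gegen_poly)
    qed
    also have "\<dots> = (\<Sum>l\<in>L. b l * (coefficient w l * poly (gegen l) (x \<bullet> pole)))"
      by (simp only: funk_hecke[OF w x pole_sphere])
    finally show ?thesis by (simp add: poly_sum mult.assoc)
  qed
  have "qform w u = (LINT x|U. poly q (x \<bullet> pole) * poly (\<Sum>l\<in>L. smult (b l * coefficient w l) (gegen l)) (x \<bullet> pole))"
    unfolding qform_def by (rule Bochner_Integration.integral_cong) (auto simp: space_U u conv)
  also have "\<dots> = zmean (q * (\<Sum>l\<in>L. smult (b l * coefficient w l) (gegen l)))"
    by (simp add: zmean_def)
  also have "\<dots> = (\<Sum>l\<in>L. coefficient w l * ((b l)\<^sup>2 * zmean (gegen l * gegen l)))"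
    unfolding q_def gegen_expansion_product[OF L(1)] by (simp add: power2_eq_square mult_ac)
  finally show "qform w u = (\<Sum>l\<in>L. coefficient w l * ((b l)\<^sup>2 * zmean (gegen l * gegen l)))" .
qed

end

section \<open>The uniform measure on the sphere\<close>

lemma scale_measure_eq_density: "scale_measure c M = density M (\<lambda>_. c)"
  by (rule measure_eqI) (auto simp: emeasure_density nn_integral_cmult_indicator)

lemma emeasure_density_space: "f \<in> borel_measurable M \<Longrightarrow> emeasure (density M f) (space M) = (\<integral>\<^sup>+ x. f x \<partial>M)"
  by (subst emeasure_density) (auto intro!: nn_integral_cong)

lemma surface_measure_sphere:
  "emeasure (surface_measure :: (real ^ 'n) measure) (sphere 0 1) = ennreal (sphere_area TYPE('n))"
  "0 < sphere_area TYPE('n::finite)"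
proof -
  have S: "sphere 0 1 \<in> sets (restrict_space borel (sphere 0 1 :: (real ^ 'n) set))"
    using sets.top[of "restrict_space borel (sphere 0 1 :: (real ^ 'n) set)"] by (simp add: space_restrict_space)
  have "{x \<in> cball 0 1 - {0}. x /\<^sub>R norm x \<in> sphere 0 1} = cball 0 1 - {0 :: real ^ 'n}" by auto
  moreover have "emeasure lborel (cball 0 1 - {0 :: real ^ 'n}) = emeasure lborel (cball 0 1 :: (real ^ 'n) set)"
    by (rule emeasure_Diff_null_set) auto
  ultimately have e: "emeasure (surface_measure :: (real ^ 'n) measure) (sphere 0 1)
      = ennreal (real CARD('n)) * ennreal (unit_ball_vol (real CARD('n)))"
    by (simp add: emeasure_surface_measure[OF S] emeasure_cball)
  hence e': "emeasure (surface_measure :: (real ^ 'n) measure) (sphere 0 1)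
      = ennreal (real CARD('n) * unit_ball_vol (real CARD('n)))"
    by (simp add: ennreal_mult)
  have a: "sphere_area TYPE('n) = real CARD('n) * unit_ball_vol (real CARD('n))"
    unfolding sphere_area_def measure_def e' by simp
  show "emeasure (surface_measure :: (real ^ 'n) measure) (sphere 0 1) = ennreal (sphere_area TYPE('n))"
    unfolding e' a ..
  show "0 < sphere_area TYPE('n)" unfolding a by simp
qed

lemma space_uniform_sphere [simp]: "space uniform_sphere = sphere 0 1"
  by (simp add: uniform_sphere_def space_scale_measure)

lemma sets_uniform_sphere: "sets uniform_sphere = sets (restrict_space borel (sphere 0 1))"
  by (simp add: uniform_sphere_def)

lemma prob_space_uniform_sphere: "prob_space (uniform_sphere :: (real ^ 'n::finite) measure)"
proof
  have "emeasure (uniform_sphere :: (real ^ 'n) measure) (sphere 0 1)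
      = ennreal (1 / sphere_area TYPE('n)) * ennreal (sphere_area TYPE('n))"
    by (simp add: uniform_sphere_def surface_measure_sphere)
  also have "\<dots> = 1" using surface_measure_sphere(2)[where 'n = 'n] by (simp flip: ennreal_mult)
  finally show "emeasure (uniform_sphere :: (real ^ 'n) measure) (space uniform_sphere) = 1" by simp
qed

lemma nn_integral_lborel_translate:
  fixes f :: "'a::euclidean_space \<Rightarrow> ennreal"
  assumes "f \<in> borel_measurable borel"
  shows "(\<integral>\<^sup>+ x. f (c + x) \<partial>lborel) = (\<integral>\<^sup>+ x. f x \<partial>lborel)"
proof -
  have "(\<integral>\<^sup>+ x. f x \<partial>lborel) = (\<integral>\<^sup>+ x. f x \<partial>distr lborel borel ((+) c))" by (simp add: lborel_distr_plus)
  also have "\<dots> = (\<integral>\<^sup>+ x. f (c + x) \<partial>lborel)" by (rule nn_integral_distr) (use assms in auto)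
  finally show ?thesis by simp
qed

text \<open>
  The image of Lebesgue measure under \<open>T\<close> is translation invariant, and comparing it
  with Lebesgue measure on the product of \<open>A\<close> and the unit ball, whose measure \<open>T\<close> preserves, shows
  that they agree. The exchange of integrals is Fubini's theorem, between two translations.
\<close>

lemma orthogonal_emeasure_vimage:
  fixes T :: "'a::euclidean_space \<Rightarrow> 'a"
  assumes T: "orthogonal_transformation T" and A[measurable]: "A \<in> sets borel"
  shows "emeasure lborel (T -` A) = emeasure lborel A"
proof -
  have lin: "linear T" using T by (rule orthogonal_transformation_linear)
  note Tm[measurable] = orthogonal_transformation_borel[OF T]
  define B where "B = ball (0 :: 'a) 1"
  have [measurable]: "B \<in> sets borel" by (simp add: B_def)
  have TA[measurable]: "T -` A \<in> sets borel" using measurable_sets[OF Tm A] by simp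
  have B: "0 < emeasure lborel B" "emeasure lborel B < \<infinity>" by (simp_all add: B_def emeasure_ball)
  have "emeasure lborel (T -` A) * emeasure lborel B
      = (\<integral>\<^sup>+ x. indicator A (T x) * (\<integral>\<^sup>+ y. indicator B y \<partial>lborel) \<partial>lborel)"
  proof -
    have "(\<integral>\<^sup>+ x. indicator A (T x) \<partial>lborel) = emeasure lborel (T -` A)"
      using nn_integral_indicator[of "T -` A" lborel] by (simp add: indicator_vimage)
    thus ?thesis by (simp add: nn_integral_multc)
  qed
  also have "\<dots> = (\<integral>\<^sup>+ x. indicator A (T x) * (\<integral>\<^sup>+ y. indicator B (- T x + y) \<partial>lborel) \<partial>lborel)"
    by (subst nn_integral_lborel_translate) auto
  also have "\<dots> = (\<integral>\<^sup>+ x. \<integral>\<^sup>+ y. indicator A (T x) * indicator B (- T x + y) \<partial>lborel \<partial>lborel)"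
    by (simp add: nn_integral_cmult)
  also have "\<dots> = (\<integral>\<^sup>+ y. \<integral>\<^sup>+ x. indicator A (T x) * indicator B (- T x + y) \<partial>lborel \<partial>lborel)"
    by (rule lborel_pair.Fubini'[symmetric]) measurable
  also have "\<dots> = (\<integral>\<^sup>+ y. \<integral>\<^sup>+ x. indicator A (T x + y) * indicator B (T x) \<partial>lborel \<partial>lborel)"
  proof (rule nn_integral_cong)
    fix y :: 'a
    obtain c where c: "T c = y" using orthogonal_transformation_surj[OF T] by (metis surjD)
    have "(\<integral>\<^sup>+ x. indicator A (T x) * indicator B (- T x + y) \<partial>lborel)
        = (\<integral>\<^sup>+ x. indicator A (T (c + x)) * indicator B (- T (c + x) + y) \<partial>lborel)"
      by (rule nn_integral_lborel_translate[symmetric]) measurable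
    also have "\<dots> = (\<integral>\<^sup>+ x. indicator A (T x + y) * indicator B (T x) \<partial>lborel)"
      using c by (simp add: linear_add[OF lin] add.commute B_def indicator_def)
    finally show "(\<integral>\<^sup>+ x. indicator A (T x) * indicator B (- T x + y) \<partial>lborel)
        = (\<integral>\<^sup>+ x. indicator A (T x + y) * indicator B (T x) \<partial>lborel)" .
  qed
  also have "\<dots> = (\<integral>\<^sup>+ x. \<integral>\<^sup>+ y. indicator A (T x + y) * indicator B (T x) \<partial>lborel \<partial>lborel)"
    by (rule lborel_pair.Fubini') measurable
  also have "\<dots> = (\<integral>\<^sup>+ x. (\<integral>\<^sup>+ y. indicator A (T x + y) \<partial>lborel) * indicator B (T x) \<partial>lborel)"
    by (simp add: nn_integral_multc)
  also have "\<dots> = (\<integral>\<^sup>+ x. emeasure lborel A * indicator B x \<partial>lborel)"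
    using T by (subst nn_integral_lborel_translate) (auto simp: B_def indicator_def orthogonal_transformation_norm)
  also have "\<dots> = emeasure lborel A * emeasure lborel B" by (simp add: nn_integral_cmult)
  finally show ?thesis using B by (auto simp: ennreal_mult_cancel_left mult.commute[of _ "emeasure lborel B"])
qed

lemma uniform_sphere_rotation_invariant:
  fixes T :: "real ^ 'n::finite \<Rightarrow> real ^ 'n"
  assumes T: "orthogonal_transformation T"
  shows "distr uniform_sphere uniform_sphere T = uniform_sphere"
proof (rule measure_eqI)
  note Tb = orthogonal_transformation_borel[OF T]
  have "T \<in> restrict_space borel (sphere 0 1) \<rightarrow>\<^sub>M restrict_space borel (sphere 0 1)"
    by (rule measurable_restrict_space3[OF Tb]) (use T in \<open>auto simp: orthogonal_transformation_norm\<close>)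
  hence Tm: "T \<in> uniform_sphere \<rightarrow>\<^sub>M uniform_sphere"
    using measurable_cong_sets[OF sets_uniform_sphere sets_uniform_sphere] by blast
  fix A assume "A \<in> sets (distr uniform_sphere uniform_sphere T)"
  hence A: "A \<in> sets uniform_sphere" by simp
  hence A': "A \<in> sets (restrict_space borel (sphere 0 1))" by (simp add: sets_uniform_sphere)
  define P where "P A = {x \<in> cball 0 1 - {0}. x /\<^sub>R norm x \<in> A}" for A :: "(real ^ 'n) set"
  have TA: "T -` A \<inter> sphere 0 1 \<in> sets uniform_sphere" using measurable_sets[OF Tm A] by simp
  hence TA': "T -` A \<inter> sphere 0 1 \<in> sets (restrict_space borel (sphere 0 1))" by (simp add: sets_uniform_sphere)
  have "P A \<in> sets borel"
  proof -
    have "(\<lambda>x :: real ^ 'n. x /\<^sub>R norm x) -` A \<inter> space (restrict_space lborel (cball 0 1 - {0}))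
        \<in> sets (restrict_space lborel (cball 0 1 - {0}))"
      by (rule measurable_sets[OF radial_measurable A'])
    moreover have "(\<lambda>x :: real ^ 'n. x /\<^sub>R norm x) -` A \<inter> space (restrict_space lborel (cball 0 1 - {0})) = P A"
      by (auto simp: P_def space_restrict_space)
    ultimately show ?thesis by (simp add: sets_restrict_space_iff)
  qed
  moreover have "P (T -` A \<inter> sphere 0 1) = T -` P A"
  proof (rule set_eqI)
    fix x
    have n: "norm (T x) = norm x" by (rule orthogonal_transformation_norm[OF T])
    have "T x = 0 \<longleftrightarrow> x = 0" using n by (metis norm_eq_zero)
    moreover have "T (x /\<^sub>R norm x) = T x /\<^sub>R norm x"
      by (rule linear_scale[OF orthogonal_transformation_linear[OF T]])
    ultimately show "x \<in> P (T -` A \<inter> sphere 0 1) \<longleftrightarrow> x \<in> T -` P A" using n by (cases "x = 0") (simp_all add: P_def)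
  qed
  ultimately have "emeasure lborel (P (T -` A \<inter> sphere 0 1)) = emeasure lborel (P A)"
    using orthogonal_emeasure_vimage[OF T, of "P A"] by simp
  hence "emeasure uniform_sphere (T -` A \<inter> sphere 0 1) = emeasure uniform_sphere A"
    by (simp add: uniform_sphere_def emeasure_surface_measure[OF A'] emeasure_surface_measure[OF TA'] P_def)
  thus "emeasure (distr uniform_sphere uniform_sphere T) A = emeasure uniform_sphere A"
    by (simp add: emeasure_distr[OF Tm A])
qed simp

lemma surface_eq_scaled_uniform:
  "(surface_measure :: (real ^ 'n::finite) measure) = density uniform_sphere (\<lambda>_. ennreal (sphere_area TYPE('n)))"
proof -
  have "surface_measure = scale_measure (ennreal (sphere_area TYPE('n)) * ennreal (1 / sphere_area TYPE('n)))
      (surface_measure :: (real ^ 'n) measure)"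
    using surface_measure_sphere(2)[where 'n = 'n] by (simp flip: ennreal_mult)
  thus ?thesis by (simp add: uniform_sphere_def flip: scale_measure_eq_density)
qed

lemma surface_integral:
  fixes f :: "real ^ 'n::finite \<Rightarrow> real"
  assumes "f \<in> borel_measurable uniform_sphere"
  shows "(LINT x|surface_measure. f x) = sphere_area TYPE('n) * (LINT x|uniform_sphere. f x)"
  using surface_measure_sphere(2)[where 'n = 'n] assms
  by (subst surface_eq_scaled_uniform, subst integral_real_density) auto

lemma density_surface:
  fixes \<rho> :: "real ^ 'n::finite \<Rightarrow> real"
  assumes "\<rho> \<in> borel_measurable uniform_sphere"
  shows "density surface_measure (\<lambda>x. ennreal (\<rho> x)) = density uniform_sphere (\<lambda>x. ennreal (sphere_area TYPE('n) * \<rho> x))"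
  using surface_measure_sphere(2)[where 'n = 'n] assms
  by (subst surface_eq_scaled_uniform, subst density_density_eq) (auto simp: ennreal_mult')

section \<open>Free energy of measures on the sphere\<close>

locale sphere_interaction = compact_interaction "uniform_sphere :: (real ^ 'n::finite) measure" "sphere 0 1" K B \<kappa>
  for K B \<kappa>
begin

abbreviation "unif \<equiv> uniform_sphere :: (real ^ 'n) measure"

lemma density_prob:
  assumes "r \<in> densities" shows "density unif (\<lambda>x. ennreal (r x)) \<in> sphere_probs"
proof -
  note R = densitiesD[OF assms]
  have "prob_space (density unif (\<lambda>x. ennreal (r x)))"
  proof
    have "emeasure (density unif (\<lambda>x. ennreal (r x))) (space unif) = (\<integral>\<^sup>+ x. ennreal (r x) \<partial>unif)"
      using R(1) by (intro emeasure_density_space) simp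
    also have "\<dots> = ennreal (LINT x|unif. r x)"
      by (rule nn_integral_eq_integral[OF R(3)]) (use R(2) in auto)
    finally show "emeasure (density unif (\<lambda>x. ennreal (r x))) (space (density unif (\<lambda>x. ennreal (r x)))) = 1"
      using R(4) by simp
  qed
  thus ?thesis by (simp add: sphere_probs_def sets_uniform_sphere)
qed

lemma density_eq_iff:
  assumes "r \<in> borel_measurable unif" "q \<in> borel_measurable unif" "AE x in unif. 0 \<le> r x" "AE x in unif. 0 \<le> q x"
  shows "density unif (\<lambda>x. ennreal (r x)) = density unif (\<lambda>x. ennreal (q x)) \<longleftrightarrow> (AE x in unif. r x = q x)"
proof -
  have "density unif (\<lambda>x. ennreal (r x)) = density unif (\<lambda>x. ennreal (q x)) \<longleftrightarrow> (AE x in unif. ennreal (r x) = ennreal (q x))"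
    using assms by (intro density_unique_iff) auto
  also have "\<dots> \<longleftrightarrow> (AE x in unif. r x = q x)"
  proof
    assume "AE x in unif. ennreal (r x) = ennreal (q x)"
    thus "AE x in unif. r x = q x" using assms(3,4) by eventually_elim simp
  next
    assume "AE x in unif. r x = q x"
    thus "AE x in unif. ennreal (r x) = ennreal (q x)" by eventually_elim simp
  qed
  finally show ?thesis .
qed

lemma entropy_density:
  assumes r: "has_pos_density unif \<mu> r"
  shows "sphere_entropy \<mu> = (if integrable unif (\<lambda>x. r x * ln (r x)) then ereal (boltzmann_entropy r) else \<infinity>)"
proof -
  define q where "q = (SOME \<rho>. has_pos_density unif \<mu> \<rho>)"
  have q: "has_pos_density unif \<mu> q" unfolding q_def by (rule someI[of "has_pos_density unif \<mu>", OF r])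
  note D = r[unfolded has_pos_density_def has_density_def] q[unfolded has_pos_density_def has_density_def]
  have [measurable]: "r \<in> borel_measurable unif" "q \<in> borel_measurable unif" using D by auto
  have "AE x in unif. q x = r x" using D density_eq_iff[of q r] by auto
  hence ae: "AE x in unif. q x * ln (q x) = r x * ln (r x)" by eventually_elim simp
  have "integrable unif (\<lambda>x. q x * ln (q x)) \<longleftrightarrow> integrable unif (\<lambda>x. r x * ln (r x))"
    by (rule integrable_cong_AE) (use ae in auto)
  moreover have "(LINT x|unif. q x * ln (q x)) = (LINT x|unif. r x * ln (r x))"
    by (rule integral_cong_AE) (use ae in auto)
  ultimately show ?thesis using r unfolding sphere_entropy_def q_def[symmetric] Let_def boltzmann_entropy_def by auto
qed

lemma densities_has_pos_density:
  "r \<in> densities \<Longrightarrow> has_pos_density unif (density unif (\<lambda>x. ennreal (r x))) r"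
  using densitiesD[of r] by (auto simp: has_pos_density_def has_density_def elim: eventually_mono)

lemma interaction_density:
  assumes "r \<in> densities"
  shows "interaction_energy K (density unif (\<lambda>x. ennreal (r x))) = pairing r r / 2"
proof -
  note R = densitiesD[OF assms]
  have nn: "AE x in unif. 0 \<le> r x" using R(2) by eventually_elim simp
  let ?\<mu> = "density unif (\<lambda>x. ennreal (r x))"
  have inner: "(LINT y|?\<mu>. K x y) = potential r x" if "x \<in> sphere 0 1" for x
    unfolding potential_def using integral_real_density[OF R(1) nn K_measurable[OF that]] by (simp add: mult.commute)
  have "(LINT x|?\<mu>. LINT y|?\<mu>. K x y) = (LINT x|?\<mu>. potential r x)"
    by (rule Bochner_Integration.integral_cong) (auto simp: inner)
  also have "\<dots> = pairing r r"
    unfolding pairing_def using integral_real_density[OF R(1) nn potential_measurable[OF R(3)]] by simp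
  finally show ?thesis by (simp add: interaction_energy_def)
qed

lemma free_energy_density:
  assumes "r \<in> densities"
  shows "free_energy K \<gamma> (density unif (\<lambda>x. ennreal (r x))) = ereal (energy \<gamma> r)"
  unfolding free_energy_def entropy_density[OF densities_has_pos_density[OF assms]] interaction_density[OF assms]
  using densitiesD(5)[OF assms] by (simp add: energy_def)

lemma finite_free_energy:
  assumes "\<mu> \<in> sphere_probs" "free_energy K \<gamma> \<mu> \<noteq> \<infinity>" "0 < \<gamma>"
  obtains r where "r \<in> densities" "\<mu> = density unif (\<lambda>x. ennreal (r x))"
proof -
  have "sphere_entropy \<mu> \<noteq> \<infinity>" using assms(2,3) by (auto simp: free_energy_def)
  then obtain r where r: "has_pos_density unif \<mu> r" by (auto simp: sphere_entropy_def split: if_splits)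
  note D = r[unfolded has_pos_density_def has_density_def]
  have i: "integrable unif (\<lambda>x. r x * ln (r x))"
    using entropy_density[OF r] \<open>sphere_entropy \<mu> \<noteq> \<infinity>\<close> by (auto split: if_splits)
  have nn: "(\<integral>\<^sup>+ x. ennreal (r x) \<partial>unif) = 1"
  proof -
    have "prob_space \<mu>" using assms(1) by (simp add: sphere_probs_def)
    hence "emeasure \<mu> (space \<mu>) = 1" by (rule prob_space.emeasure_space_1)
    moreover have "emeasure \<mu> (space \<mu>) = (\<integral>\<^sup>+ x. ennreal (r x) \<partial>unif)"
    proof -
      have "\<mu> = density unif (\<lambda>x. ennreal (r x))" "(\<lambda>x. ennreal (r x)) \<in> borel_measurable unif" using D by auto
      thus ?thesis using emeasure_density_space[of "\<lambda>x. ennreal (r x)" unif] by simp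
    qed
    ultimately show ?thesis by simp
  qed
  have ir: "integrable unif r" using D nn by (intro integrableI_nonneg) auto
  have "(LINT x|unif. r x) = 1" using D nn by (simp add: integral_eq_nn_integral)
  hence "r \<in> densities" using D i ir by (auto simp: densities_def)
  with D that show thesis by blast
qed

text \<open>
  Measures without a positive density of finite entropy have infinite free energy, so the
  minimization reduces to densities.
\<close>

lemma is_minimizer_iff:
  assumes \<gamma>: "0 < \<gamma>"
  shows "is_minimizer K \<gamma> \<mu> \<longleftrightarrow> (\<exists>r\<in>densities. \<mu> = density unif (\<lambda>x. ennreal (r x)) \<and> (\<forall>q\<in>densities. energy \<gamma> r \<le> energy \<gamma> q))"
proof
  assume m: "is_minimizer K \<gamma> \<mu>"
  hence \<mu>: "\<mu> \<in> sphere_probs" and le: "\<And>\<nu>. \<nu> \<in> sphere_probs \<Longrightarrow> free_energy K \<gamma> \<mu> \<le> free_energy K \<gamma> \<nu>"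
    by (auto simp: is_minimizer_def)
  have "free_energy K \<gamma> \<mu> \<le> ereal (energy \<gamma> (\<lambda>_. 1))"
    using le[OF density_prob[OF const_one_density]] free_energy_density[OF const_one_density] by simp
  hence "free_energy K \<gamma> \<mu> \<noteq> \<infinity>" by auto
  then obtain r where r: "r \<in> densities" "\<mu> = density unif (\<lambda>x. ennreal (r x))"
    using finite_free_energy[OF \<mu> _ \<gamma>] by blast
  have "energy \<gamma> r \<le> energy \<gamma> q" if "q \<in> densities" for q
    using le[OF density_prob[OF that]] by (simp add: r free_energy_density that)
  with r show "\<exists>r\<in>densities. \<mu> = density unif (\<lambda>x. ennreal (r x)) \<and> (\<forall>q\<in>densities. energy \<gamma> r \<le> energy \<gamma> q)" by blast
next
  assume "\<exists>r\<in>densities. \<mu> = density unif (\<lambda>x. ennreal (r x)) \<and> (\<forall>q\<in>densities. energy \<gamma> r \<le> energy \<gamma> q)"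
  then obtain r where r: "r \<in> densities" "\<mu> = density unif (\<lambda>x. ennreal (r x))" "\<And>q. q \<in> densities \<Longrightarrow> energy \<gamma> r \<le> energy \<gamma> q"
    by blast
  have "free_energy K \<gamma> \<mu> \<le> free_energy K \<gamma> \<nu>" if \<nu>: "\<nu> \<in> sphere_probs" for \<nu>
  proof (cases "free_energy K \<gamma> \<nu> = \<infinity>")
    case False
    then obtain q where "q \<in> densities" "\<nu> = density unif (\<lambda>x. ennreal (q x))"
      using finite_free_energy[OF \<nu> _ \<gamma>] by blast
    thus ?thesis using r by (simp add: free_energy_density)
  qed simp
  thus "is_minimizer K \<gamma> \<mu>" using density_prob[OF r(1)] r(2) by (simp add: is_minimizer_def)
qed

lemma density_eq_uniform_iff:
  assumes "r \<in> densities" shows "density unif (\<lambda>x. ennreal (r x)) = unif \<longleftrightarrow> (AE x in unif. r x = 1)"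
proof -
  have "AE x in unif. 0 \<le> r x" using densitiesD(2)[OF assms] by eventually_elim simp
  thus ?thesis using density_eq_iff[of r "\<lambda>_. 1"] densitiesD(1)[OF assms] by (simp add: density_1)
qed

lemma uniform_minimizer_iff:
  assumes "0 < \<gamma>"
  shows "is_minimizer K \<gamma> unif \<longleftrightarrow> (\<forall>q\<in>densities. energy \<gamma> (\<lambda>_. 1) \<le> energy \<gamma> q)"
proof
  assume "is_minimizer K \<gamma> unif"
  then obtain r where r: "r \<in> densities" "unif = density unif (\<lambda>x. ennreal (r x))" "\<forall>q\<in>densities. energy \<gamma> r \<le> energy \<gamma> q"
    using is_minimizer_iff[OF assms] by blast
  have "energy \<gamma> r = energy \<gamma> (\<lambda>_. 1)"
    using r density_eq_uniform_iff[OF r(1)] by (intro energy_cong_AE const_one_density) auto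
  thus "\<forall>q\<in>densities. energy \<gamma> (\<lambda>_. 1) \<le> energy \<gamma> q" using r(3) by simp
next
  assume "\<forall>q\<in>densities. energy \<gamma> (\<lambda>_. 1) \<le> energy \<gamma> q"
  hence "\<exists>r\<in>densities. unif = density unif (\<lambda>x. ennreal (r x)) \<and> (\<forall>q\<in>densities. energy \<gamma> r \<le> energy \<gamma> q)"
    using const_one_density by (intro bexI[of _ "\<lambda>_. 1"]) (auto simp: density_1)
  thus "is_minimizer K \<gamma> unif" using is_minimizer_iff[OF assms] by blast
qed

text \<open>
  If the transition were continuous, nonuniform minimizers for parameters slightly
  above the critical one would come within the distance \<open>\<eta>\<close> of \<open>uniform_isolated_minimizer\<close>, at
  parameters that still lie below a fixed \<open>\<gamma>1 < -1 / v\<close>.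
\<close>

theorem discontinuous_transition:
  assumes v: "v < 0"
    and spectral: "\<And>d F. d \<in> borel_measurable unif \<Longrightarrow> (\<And>x. x \<in> sphere 0 1 \<Longrightarrow> \<bar>d x\<bar> \<le> F) \<Longrightarrow> (LINT x|unif. d x) = 0
        \<Longrightarrow> v * (LINT x|unif. (d x)\<^sup>2) \<le> pairing d d"
    and witness: "r0 \<in> densities" "boltzmann_entropy r0 + (- 1 / v) / 2 * excess r0 < 0"
  shows "\<exists>\<gamma>c. 0 < \<gamma>c \<and> \<gamma>c < - 1 / v \<and> discontinuous_transition_point K \<gamma>c"
proof -
  have g: "0 < - 1 / v" using v by (simp add: divide_pos_neg)
  obtain \<gamma>c where \<gamma>c: "0 < \<gamma>c" "\<gamma>c < - 1 / v"
    and uniq: "\<And>\<gamma> r. 0 < \<gamma> \<Longrightarrow> \<gamma> < \<gamma>c \<Longrightarrow> r \<in> densities \<Longrightarrow> energy \<gamma> r \<le> energy \<gamma> (\<lambda>_. 1) \<Longrightarrow> AE x in unif. r x = 1"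
    and below: "\<And>\<gamma> r. 0 < \<gamma> \<Longrightarrow> \<gamma> \<le> \<gamma>c \<Longrightarrow> r \<in> densities \<Longrightarrow> energy \<gamma> (\<lambda>_. 1) \<le> energy \<gamma> r"
    and above: "\<And>\<gamma>. \<gamma>c < \<gamma> \<Longrightarrow> \<exists>r\<in>densities. energy \<gamma> r < energy \<gamma> (\<lambda>_. 1)"
    using critical_parameter[OF g witness] by blast
  have min: "is_minimizer K \<gamma> unif" if "0 < \<gamma>" "\<gamma> \<le> \<gamma>c" for \<gamma>
    using uniform_minimizer_iff[OF that(1)] below[OF that] by blast
  have tp: "transition_point K \<gamma>c" unfolding transition_point_def
  proof (intro conjI allI impI)
    fix \<gamma> assume \<gamma>: "0 < \<gamma> \<and> \<gamma> < \<gamma>c"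
    have "\<nu> = unif" if \<nu>: "is_minimizer K \<gamma> \<nu>" for \<nu>
    proof -
      obtain r where r: "r \<in> densities" "\<nu> = density unif (\<lambda>x. ennreal (r x))" "\<forall>q\<in>densities. energy \<gamma> r \<le> energy \<gamma> q"
        using \<nu> is_minimizer_iff \<gamma> by blast
      have "AE x in unif. r x = 1" using uniq[of \<gamma> r] \<gamma> r const_one_density by blast
      thus ?thesis using density_eq_uniform_iff[OF r(1)] r(2) by simp
    qed
    thus "is_unique_minimizer K \<gamma> unif" using min[of \<gamma>] \<gamma> by (simp add: is_unique_minimizer_def)
  next
    fix \<gamma> assume \<gamma>: "\<gamma>c < \<gamma>"
    hence \<gamma>0: "0 < \<gamma>" using \<gamma>c by simp
    obtain r where r: "r \<in> densities" "\<And>q. q \<in> densities \<Longrightarrow> energy \<gamma> r \<le> energy \<gamma> q"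
      using minimizer_exists[OF \<gamma>0] by blast
    define \<mu> where "\<mu> = density unif (\<lambda>x. ennreal (r x))"
    define \<rho> where "\<rho> = (\<lambda>x. r x / sphere_area TYPE('n))"
    note R = densitiesD[OF r(1)]
    have a: "0 < sphere_area TYPE('n)" by (rule surface_measure_sphere)
    have m: "is_minimizer K \<gamma> \<mu>" using is_minimizer_iff[OF \<gamma>0] r by (auto simp: \<mu>_def)
    obtain q where q: "q \<in> densities" "energy \<gamma> q < energy \<gamma> (\<lambda>_. 1)" using above[OF \<gamma>] by blast
    have "\<mu> \<noteq> unif"
      using uniform_minimizer_iff[OF \<gamma>0] m q by force
    moreover have "has_pos_density surface_measure \<mu> \<rho>"
    proof -
      have "AE x in surface_measure. 0 < \<rho> x"
        unfolding surface_eq_scaled_uniform using R(2) a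
        by (subst AE_density) (auto simp: \<rho>_def elim: eventually_mono)
      moreover have "\<rho> \<in> borel_measurable unif" unfolding \<rho>_def using R(1) by simp
      hence "\<rho> \<in> borel_measurable surface_measure"
        using measurable_cong_sets[OF sets_uniform_sphere[folded sets_surface_measure] refl] by blast
      moreover have "\<mu> = density surface_measure (\<lambda>x. ennreal (\<rho> x))"
        using a R(1) by (subst density_surface) (auto simp: \<rho>_def \<mu>_def)
      ultimately show ?thesis by (auto simp: has_pos_density_def has_density_def elim: eventually_mono)
    qed
    ultimately show "\<exists>\<mu> \<rho>. is_minimizer K \<gamma> \<mu> \<and> has_pos_density surface_measure \<mu> \<rho> \<and> \<mu> \<noteq> unif" using m by blast
  qed (use \<gamma>c min in auto)
  have "\<not> continuous_transition_point K \<gamma>c"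
  proof
    assume ct: "continuous_transition_point K \<gamma>c"
    \<comment> \<open>strictly between the critical parameter and \<open>-1 / v\<close>\<close>
    define \<gamma>1 where "\<gamma>1 = (\<gamma>c + (- 1 / v)) / 2"
    have \<gamma>1: "\<gamma>c < \<gamma>1" "\<gamma>1 < - 1 / v" "0 < \<gamma>1" using \<gamma>c by (auto simp: \<gamma>1_def)
    have "\<gamma>1 * (- v) < (- 1 / v) * (- v)" using \<gamma>1 v by (intro mult_strict_right_mono) auto
    hence \<gamma>1v: "\<gamma>1 * (- v) < 1" using v by simp
    obtain \<eta> where \<eta>: "0 < \<eta>"
      "\<And>\<gamma> r. 0 < \<gamma> \<Longrightarrow> \<gamma> \<le> \<gamma>1 \<Longrightarrow> r \<in> densities \<Longrightarrow> (\<And>q. q \<in> densities \<Longrightarrow> energy \<gamma> r \<le> energy \<gamma> q) \<Longrightarrow>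
        (LINT x|unif. \<bar>r x - 1\<bar>) \<le> \<eta> \<Longrightarrow> AE x in unif. r x = 1"
    proof (rule uniform_isolated_minimizer[OF v _ \<gamma>1(3) \<gamma>1v])
      show "v * (LINT x|unif. (d x)\<^sup>2) \<le> pairing d d"
        if "d \<in> borel_measurable unif" "\<And>x. x \<in> sphere 0 1 \<Longrightarrow> \<bar>d x\<bar> \<le> F" "(LINT x|unif. d x) = 0" for d F
        using spectral that by blast
    qed (use that in blast)
    define good where "good \<gamma> z \<longleftrightarrow> is_minimizer K \<gamma> (fst z) \<and> has_pos_density surface_measure (fst z) (snd z) \<and> fst z \<noteq> unif"
      for \<gamma> :: real and z :: "(real ^ 'n) measure \<times> (real ^ 'n \<Rightarrow> real)"
    define Z where "Z \<gamma> = (SOME z. good \<gamma> z)" for \<gamma>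
    have Z: "good \<gamma> (Z \<gamma>)" if \<gamma>: "\<gamma>c < \<gamma>" for \<gamma>
    proof -
      have "\<exists>\<mu> \<rho>. is_minimizer K \<gamma> \<mu> \<and> has_pos_density surface_measure \<mu> \<rho> \<and> \<mu> \<noteq> unif"
        using tp \<gamma> unfolding transition_point_def by blast
      hence "\<exists>z. good \<gamma> z" by (auto simp: good_def)
      thus ?thesis unfolding Z_def by (rule someI_ex)
    qed
    have "((\<lambda>\<gamma>. LINT x|surface_measure. \<bar>snd (Z \<gamma>) x - 1 / sphere_area TYPE('n)\<bar>) \<longlongrightarrow> 0) (at_right \<gamma>c)"
    proof -
      have "\<forall>\<gamma>>\<gamma>c. is_minimizer K \<gamma> (fst (Z \<gamma>)) \<and> has_density surface_measure (fst (Z \<gamma>)) (snd (Z \<gamma>))"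
        using Z by (auto simp: good_def has_pos_density_def)
      with ct show ?thesis unfolding continuous_transition_point_def
        by (elim conjE allE[of _ "\<lambda>\<gamma>. fst (Z \<gamma>)"] allE[of _ "\<lambda>\<gamma>. snd (Z \<gamma>)"]) simp
    qed
    hence "eventually (\<lambda>\<gamma>. (LINT x|surface_measure. \<bar>snd (Z \<gamma>) x - 1 / sphere_area TYPE('n)\<bar>) < \<eta>) (at_right \<gamma>c)"
      using \<eta>(1) by (rule order_tendstoD(2))
    moreover have "eventually (\<lambda>\<gamma>. \<gamma>c < \<gamma> \<and> \<gamma> < \<gamma>1) (at_right \<gamma>c)"
      using \<gamma>1(1) by (auto simp: eventually_at_right_field)
    ultimately have "eventually (\<lambda>\<gamma>. (LINT x|surface_measure. \<bar>snd (Z \<gamma>) x - 1 / sphere_area TYPE('n)\<bar>) < \<eta> \<and> \<gamma>c < \<gamma> \<and> \<gamma> < \<gamma>1) (at_right \<gamma>c)"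
      by eventually_elim auto
    then obtain \<gamma> where \<gamma>: "(LINT x|surface_measure. \<bar>snd (Z \<gamma>) x - 1 / sphere_area TYPE('n)\<bar>) < \<eta>" "\<gamma>c < \<gamma>" "\<gamma> < \<gamma>1"
      using eventually_happens'[OF trivial_limit_at_right_real] by blast
    define \<mu> \<rho> where "\<mu> = fst (Z \<gamma>)" and "\<rho> = snd (Z \<gamma>)"
    have \<gamma>0: "0 < \<gamma>" using \<gamma> \<gamma>c by simp
    have a: "0 < sphere_area TYPE('n)" by (rule surface_measure_sphere)
    have Zg: "is_minimizer K \<gamma> \<mu>" "has_pos_density surface_measure \<mu> \<rho>" "\<mu> \<noteq> unif"
      using Z[OF \<gamma>(2)] by (auto simp: good_def \<mu>_def \<rho>_def)
    obtain r where r: "r \<in> densities" "\<mu> = density unif (\<lambda>x. ennreal (r x))" "\<And>q. q \<in> densities \<Longrightarrow> energy \<gamma> r \<le> energy \<gamma> q"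
      using Zg(1) is_minimizer_iff[OF \<gamma>0] by blast
    note R = densitiesD[OF r(1)]
    have \<rho>m: "\<rho> \<in> borel_measurable unif"
      using Zg(2) measurable_cong_sets[OF sets_uniform_sphere[folded sets_surface_measure] refl]
      by (auto simp: has_pos_density_def has_density_def)
    have \<rho>0: "AE x in unif. 0 \<le> \<rho> x"
    proof -
      have "AE x in surface_measure. 0 < \<rho> x" using Zg(2) by (simp add: has_pos_density_def)
      hence "AE x in unif. 0 < \<rho> x" unfolding surface_eq_scaled_uniform using a by (subst (asm) AE_density) auto
      thus ?thesis by eventually_elim simp
    qed
    have "density unif (\<lambda>x. ennreal (r x)) = density unif (\<lambda>x. ennreal (sphere_area TYPE('n) * \<rho> x))"
      using Zg(2) r(2) density_surface[OF \<rho>m] by (simp add: has_pos_density_def has_density_def)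
    moreover have "AE x in unif. 0 \<le> r x" using R(2) by eventually_elim simp
    moreover have "AE x in unif. 0 \<le> sphere_area TYPE('n) * \<rho> x" using \<rho>0 by eventually_elim (use a in simp)
    ultimately have r\<rho>: "AE x in unif. r x = sphere_area TYPE('n) * \<rho> x"
      using R(1) \<rho>m by (subst (asm) density_eq_iff) auto
    have "(LINT x|unif. \<bar>r x - 1\<bar>) = (LINT x|unif. sphere_area TYPE('n) * \<bar>\<rho> x - 1 / sphere_area TYPE('n)\<bar>)"
    proof (rule integral_cong_AE)
      show "AE x in unif. \<bar>r x - 1\<bar> = sphere_area TYPE('n) * \<bar>\<rho> x - 1 / sphere_area TYPE('n)\<bar>"
        using r\<rho>
      proof eventually_elim
        case (elim x)
        have "sphere_area TYPE('n) * \<bar>\<rho> x - 1 / sphere_area TYPE('n)\<bar> = \<bar>sphere_area TYPE('n) * (\<rho> x - 1 / sphere_area TYPE('n))\<bar>"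
          using a by (simp add: abs_mult)
        also have "sphere_area TYPE('n) * (\<rho> x - 1 / sphere_area TYPE('n)) = r x - 1"
          using a elim by (simp add: field_simps)
        finally show ?case by simp
      qed
    qed (use R \<rho>m in auto)
    also have "\<dots> = (LINT x|surface_measure. \<bar>\<rho> x - 1 / sphere_area TYPE('n)\<bar>)"
      using \<rho>m by (subst surface_integral) auto
    also have "\<dots> \<le> \<eta>" using \<gamma>(1) by (simp add: \<rho>_def)
    finally have "AE x in unif. r x = 1" using \<eta>(2)[OF \<gamma>0 _ r(1) r(3)] \<gamma>(3) by simp
    thus False using density_eq_uniform_iff[OF r(1)] r(2) Zg(3) by simp
  qed
  with tp \<gamma>c show ?thesis unfolding discontinuous_transition_point_def by blast
qed

end

section \<open>Existence of a discontinuous transition\<close>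

theorem theorem5p11:
  fixes W :: "real ^ 'n \<Rightarrow> real ^ 'n \<Rightarrow> real"
    and w :: "real \<Rightarrow> real"
    and p :: "'n"
    and \<delta> :: real
  assumes "CARD('n) \<ge> 3"
    and "continuous_on (sphere 0 1 \<times> sphere 0 1) (\<lambda>(x, y). W x y)"
    and "bounded ((\<lambda>(x, y). W x y) ` (sphere 0 1 \<times> sphere 0 1))"
    and "rotationally_symmetric_with W w"
    and "\<exists>j\<ge>1. gegenbauer_coeff CARD('n) w j < 0"
    and "\<delta> \<ge> 0"
    and "relaxed_resonance p w \<delta>"
  shows "\<exists>\<gamma>c. 0 < \<gamma>c \<and> \<gamma>c < gamma_sharp CARD('n) w \<and> discontinuous_transition_point W \<gamma>c"
proof -
  let ?S = "sphere 0 1 :: (real ^ 'n) set" and ?U = "uniform_sphere :: (real ^ 'n) measure"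
  have Ww: "W x y = w (x \<bullet> y)" if "x \<in> ?S" "y \<in> ?S" for x y
    using assms(4) that by (simp add: rotationally_symmetric_with_def)
  have w: "continuous_on {-1..1} w"
  proof -
    obtain q :: 'n where q: "q \<noteq> p"
    proof -
      have "card (UNIV - {p}) \<noteq> 0" using assms(1) by (simp add: card_Diff_singleton)
      hence "UNIV - {p} \<noteq> {}" by (metis card.empty)
      with that show thesis by blast
    qed
    \<comment> \<open>a continuous curve on the sphere along which the coordinate \<open>p\<close> is \<open>t\<close>\<close>
    define X where "X t = t *\<^sub>R axis p 1 + sqrt (1 - t\<^sup>2) *\<^sub>R (axis q 1 :: real ^ 'n)" for t
    have o: "axis p (1 :: real) \<bullet> axis q 1 = 0" "axis q (1 :: real) \<bullet> axis p 1 = 0"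
      using q by (auto simp: inner_axis_axis)
    have Xp: "X t \<bullet> axis p 1 = t" for t using o by (simp add: X_def inner_add_left inner_axis_axis)
    have XS: "X t \<in> ?S" if "t \<in> {-1..1}" for t
    proof -
      have "0 \<le> 1 - t\<^sup>2" using that by (simp add: abs_square_le_1 abs_le_iff)
      hence "X t \<bullet> X t = 1"
        using o by (simp add: X_def inner_add_left inner_add_right inner_axis_axis flip: power2_eq_square)
      thus ?thesis by (simp add: norm_eq_1)
    qed
    have pS: "axis p 1 \<in> ?S" by (simp add: norm_axis_1)
    have "continuous_on {-1..1} (\<lambda>t. (\<lambda>(x, y). W x y) (X t, axis p 1))"
      by (rule continuous_on_compose2[OF assms(2)])
         (use XS pS in \<open>auto intro!: continuous_intros simp: X_def\<close>)
    moreover have "(\<lambda>(x, y). W x y) (X t, axis p 1) = w t" if "t \<in> {-1..1}" for t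
      using Ww[OF XS[OF that] pS] Xp by simp
    ultimately show ?thesis by (subst continuous_on_cong[OF refl]) (auto intro: sym)
  qed
  obtain B where B: "\<And>x y. x \<in> ?S \<Longrightarrow> y \<in> ?S \<Longrightarrow> \<bar>W x y\<bar> \<le> B"
    using assms(3) unfolding bounded_iff by (fastforce simp: image_iff)
  interpret prob_space ?U by (rule prob_space_uniform_sphere)
  interpret compact_prob_space ?U ?S
    by unfold_locales (auto simp: sets_uniform_sphere)
  interpret R: rotation_invariant_sphere ?U p "CARD('n)"
    by unfold_locales (use assms(1) uniform_sphere_rotation_invariant in auto)
  let ?coef = "R.coefficient w"
  have coef: "gegenbauer_coeff CARD('n) w k = ?coef k" for k by (rule R.gegenbauer_coeff_eq[OF w])
  define \<kappa> where "\<kappa> = (LINT y|?U. w (y \<bullet> axis p 1))"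
  interpret I: sphere_interaction W B \<kappa>
  proof unfold_locales
    show "(LINT y|?U. W x y) = \<kappa>" if x: "x \<in> ?S" for x
    proof -
      have "(LINT y|?U. W x y) = (LINT y|?U. w (y \<bullet> x))"
        by (rule Bochner_Integration.integral_cong) (use x in \<open>auto simp: Ww inner_commute\<close>)
      thus ?thesis using R.zonal_mean[OF w x] by (simp add: \<kappa>_def)
    qed
    show "W x y = W y x" if "x \<in> ?S" "y \<in> ?S" for x y using that by (simp add: Ww inner_commute)
  qed (use assms(2) B in auto)
  have pairing: "I.pairing f f = R.qform w f" for f
    unfolding I.pairing_def R.qform_def I.potential_def R.convolve_def
    by (intro Bochner_Integration.integral_cong arg_cong2[where f = "(*)"] refl) (auto simp: Ww)
  obtain j where j: "1 \<le> j" "?coef j < 0" using assms(5) coef by auto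
  obtain m where m: "1 \<le> m" "\<And>k. 1 \<le> k \<Longrightarrow> ?coef m \<le> ?coef k"
    using R.coefficient_min_attained[OF w j] by blast
  define v where "v = ?coef m"
  have v: "v < 0" using m(2)[OF j(1)] j(2) by (simp add: v_def)
  have "(LEAST a. a \<in> gegenbauer_coeff CARD('n) w ` {1..}) = v"
    by (rule Least_equality) (use m in \<open>auto simp: coef v_def\<close>)
  hence gs: "gamma_sharp CARD('n) w = - 1 / v" by (simp add: gamma_sharp_def)
  have spectral: "v * (LINT x|?U. (d x)\<^sup>2) \<le> I.pairing d d"
    if "d \<in> borel_measurable ?U" "\<And>x. x \<in> ?S \<Longrightarrow> \<bar>d x\<bar> \<le> F" "(LINT x|?U. d x) = 0" for d F
    unfolding pairing by (rule R.spectral_bound[OF that(1,2) w that(3)]) (use v m in \<open>auto simp: v_def\<close>)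
  obtain L c u U3 where L: "finite L" "L \<subseteq> resonant_modes CARD('n) w \<delta>"
    and u: "u = (\<lambda>x :: real ^ 'n. \<Sum>l\<in>L. c l * zonal_harmonic p l x)"
    and U3: "U3 = (LINT x|surface_measure. u x ^ 3)" "U3 \<noteq> 0"
    and u1: "\<forall>x\<in>?S. \<bar>u x\<bar> \<le> 1"
    and \<delta>: "\<delta> < min (1 / 4) (U3\<^sup>2 / (49 * (sphere_area TYPE('n))\<^sup>2))"
    using assms(7) unfolding relaxed_resonance_def by blast
  define b where "b l = c l / sphere_L2_norm (\<lambda>y :: real ^ 'n. gegenbauer ((real CARD('n) - 2) / 2) l (y $ p))" for l
  have ub: "u = (\<lambda>x. \<Sum>l\<in>L. b l * poly (R.gegen l) (x \<bullet> axis p 1))"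
    by (simp add: u zonal_harmonic_def b_def inner_axis)
  have L1: "L \<subseteq> {1..}" and res: "?coef l \<le> (1 - \<delta>) * v" if "l \<in> L" for l
    using L(2) that by (auto simp: resonant_modes_def coef gs)
  have L1: "L \<subseteq> {1..}" using L(2) by (auto simp: resonant_modes_def)
  note expansion = R.zonal_expansion[OF w L(1) L1, of b]
  have exp: "(LINT x|?U. u x) = 0"
    "(LINT x|?U. (u x)\<^sup>2) = (\<Sum>l\<in>L. (b l)\<^sup>2 * R.zmean (R.gegen l * R.gegen l))"
    "R.qform w u = (\<Sum>l\<in>L. ?coef l * ((b l)\<^sup>2 * R.zmean (R.gegen l * R.gegen l)))"
    unfolding ub by (rule expansion)+
  have um: "u \<in> borel_measurable ?U"
    unfolding ub by (intro continuous_measurable continuous_intros)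
  define m3 where "m3 = (LINT x|?U. u x ^ 3)"
  have a: "0 < sphere_area TYPE('n)" by (rule surface_measure_sphere)
  have U3m: "U3 = sphere_area TYPE('n) * m3"
    unfolding U3(1) m3_def by (rule surface_integral) (use um in measurable)
  have m30: "m3 \<noteq> 0" using U3(2) U3m by auto
  have \<delta>3: "\<delta> < m3\<^sup>2 / 49" using \<delta> a by (simp add: U3m power_mult_distrib)
  have "I.pairing u u \<le> (1 - \<delta>) * v * (LINT x|?U. (u x)\<^sup>2)"
    unfolding pairing exp(2,3) sum_distrib_left
    by (intro sum_mono mult_right_mono res mult_nonneg_nonneg less_imp_le[OF R.gegen_norm_pos]) auto
  hence "- 1 / v * I.pairing u u \<le> - 1 / v * ((1 - \<delta>) * v * (LINT x|?U. (u x)\<^sup>2))"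
    using v by (intro mult_left_mono) (auto simp: divide_nonneg_neg)
  also have "\<dots> = - (1 - \<delta>) * (LINT x|?U. (u x)\<^sup>2)" using v by (simp add: field_simps)
  finally have neg: "- 1 / v * I.pairing u u \<le> - (1 - \<delta>) * (LINT x|?U. (u x)\<^sup>2)" .
  have "0 < - 1 / v" using v by (simp add: divide_pos_neg)
  from I.cubic_resonance_witness[OF um _ exp(1) m3_def[symmetric] m30 this assms(6) \<delta>3 neg] u1
  obtain r where "r \<in> I.densities" "I.boltzmann_entropy r + - 1 / v / 2 * I.excess r < 0" by blast
  note witness = this
  show ?thesis unfolding gs
  proof (rule I.discontinuous_transition[OF v _ witness])
    show "v * (LINT x|?U. (d x)\<^sup>2) \<le> I.pairing d d"
      if "d \<in> borel_measurable ?U" "\<And>x. x \<in> ?S \<Longrightarrow> \<bar>d x\<bar> \<le> F" "(LINT x|?U. d x) = 0" for d F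
      by (rule spectral[OF that])
  qed
qed

end
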